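(* Let $(\Omega,\mathcal A,\mathbb P,\{\mathcal F_n\}_{n\ge 0})$ be a filtered probability space, $\Theta\subseteq\mathbb R^d$, $h:\Theta\to\mathbb R^d$ measurable, $\{\gamma_n\}_{n\ge1}$ a deterministic positive sequence, $\{e_n\}_{n\ge1}$, $\{r_n\}_{n\ge1}$ $\mathbb R^d$-valued random variables, and $\{\theta_n\}_{n\ge0}$ the $\Theta$-valued sequence with $\theta_0\in\Theta$ and $\theta_{n+1}=\theta_n+\gamma_{n+1}h(\theta_n)+\gamma_{n+1}e_{n+1}+\gamma_{n+1}r_{n+1}$. Let $\bar\theta_n=\frac1{n+1}\sum_{k=0}^n\theta_k$. Let $\theta_\star\in\Theta$, $\mathcal L=\{\lim_q\theta_q=\theta_\star\}$, and assume (C1), (C4a), (AV1), (AV2), (AV3) (defined in the context). Then for every $t\in\mathbb R^d$, $$\lim_n\mathbb E\left[\mathbf 1_{\mathcal L}\exp\left(i\sqrt n\,t^T(\bar\theta_n-\theta_\star)\right)\right]=\mathbb E\left[\mathbf 1_{\mathcal L}\exp\left(-\tfrac12t^T\nabla h(\theta_\star)^{-1}U_\star(\nabla h(\theta_\star)^{-1})^Tt\right)\right].$$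
   Context: $|\cdot|$ is the Euclidean norm; $x^T$ transpose. Order notation for random sequences $Z_n$: $Z_n=O_{w.p.1}(1)$ means $\sup_n|Z_n|<\infty$ a.s.; $Z_n=O_{L^2}(1)$ means $\sup_n\mathbb E|Z_n|^2<\infty$; $Z_n=O_{w.p.1}(1)O_{L^2}(1)$ means $Z_n=W_n\bar W_n$ with $W_n=O_{w.p.1}(1)$, $\bar W_n=O_{L^2}(1)$. (C1) (a) $\theta_\star$ is in the interior of $\Theta$ and $h(\theta_\star)=0$; (b) $h$ is twice continuously differentiable in a neighborhood of $\theta_\star$; (c) $\nabla h(\theta_\star)$ is Hurwitz (all eigenvalues have negative real part). (C4a) $\sum_k\gamma_k=\infty$, $\sum_k\gamma_k^2<\infty$ and $\log(\gamma_{k-1}/\gamma_k)=o(\gamma_k)$. (AV1) (a) $e_n$ is $\mathcal F_n$-measurable and $\mathbb E[e_n\mid\mathcal F_{n-1}]=0$ a.s. (b) There is a sequence of sets $\{\mathcal A_m\}_{m\ge1}$ with $\lim_m\mathbb P(\mathcal A_m\mid\mathcal L)=1$ and, for each $m$, sets $\mathcal A_{m,k}\in\mathcal F_k$ with $\sup_k\mathbb E[|e_k|^2\mathbf 1_{\mathcal A_{m,k-1}}]<\infty$ and $\lim_k\mathbf 1_{\mathcal A_{m,k}}=\mathbf 1_{\mathcal A_m}$ a.s. on $\mathcal L$. (c) With $\mathcal E_{n+1}=(n+1)^{-1/2}\sum_{k=0}^ne_{k+1}$, there is a random matrix $U_\star$, positive definite a.s. on $\mathcal L$, such that for every $t\in\mathbb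 R^d$, $\lim_n\mathbb E[\mathbf 1_{\mathcal L}\exp(it^T\mathcal E_{n+1})]=\mathbb E[\mathbf 1_{\mathcal L}\exp(-\frac12t^TU_\star t)]$. (AV2) $r_n$ is $\mathcal F_n$-measurable, $r_n=r_n^{(1)}+r_n^{(2)}$ with, for every $m\ge1$: (a) $\gamma_n^{-1/2}r_n^{(1)}\mathbf 1_{\mathcal L}\mathbf 1_{\mathcal A_m}=O_{w.p.1}(1)O_{L^2}(1)$; (b) $\sqrt{\gamma_n}\sum_{k=1}^nr_k^{(2)}\mathbf 1_{\mathcal L}\mathbf 1_{\mathcal A_m}=O_{w.p.1}(1)O_{L^2}(1)$; (c) $n^{-1/2}\sum_{k=0}^nr_{k+1}\mathbf 1_{\mathcal L}\to0$ in probability. (AV3) $\lim_n n\gamma_n=+\infty$, $\lim_n n^{-1/2}\sum_{k=1}^n\gamma_k^{-1/2}|1-\gamma_k/\gamma_{k+1}|=0$ and $\lim_nn^{-1/2}\sum_{k=1}^n\gamma_k=0$. *)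

theory Defs
  imports "HOL-Analysis.Analysis" "HOL-Probability.Probability"
begin

definition C2_on :: "('a::euclidean_space \<Rightarrow> 'b::euclidean_space) \<Rightarrow> 'a set \<Rightarrow> bool" where
  "C2_on f U \<longleftrightarrow>
     (\<exists>(f' :: 'a \<Rightarrow> 'a \<Rightarrow>\<^sub>L 'b) (f'' :: 'a \<Rightarrow> 'a \<Rightarrow>\<^sub>L ('a \<Rightarrow>\<^sub>L 'b)).
        (\<forall>x\<in>U. (f has_derivative blinfun_apply (f' x)) (at x)
               \<and> (f' has_derivative blinfun_apply (f'' x)) (at x))
        \<and> continuous_on U f'')"

definition hurwitz :: "real^'n^'n \<Rightarrow> bool" where
  "hurwitz A \<longleftrightarrow>
     (\<forall>\<mu>::complex. (\<exists>v::complex^'n. v \<noteq> 0 \<and>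
          (\<chi> i j. complex_of_real (A $ i $ j)) *v v = \<mu> *s v) \<longrightarrow> Re \<mu> < 0)"

definition O_wp1 :: "'a measure \<Rightarrow> (nat \<Rightarrow> 'a \<Rightarrow> 'b::real_normed_vector) \<Rightarrow> bool" where
  "O_wp1 M Z \<longleftrightarrow> (AE \<omega> in M. \<exists>B. \<forall>n. norm (Z n \<omega>) \<le> B)"

definition O_L2 :: "'a measure \<Rightarrow> (nat \<Rightarrow> 'a \<Rightarrow> 'b::real_normed_vector) \<Rightarrow> bool" where
  "O_L2 M Z \<longleftrightarrow> (\<exists>C::real. \<forall>n. (\<integral>\<^sup>+ \<omega>. ennreal ((norm (Z n \<omega>))\<^sup>2) \<partial>M) \<le> ennreal C)"

definition O_wp1_L2 :: "'a measure \<Rightarrow> (nat \<Rightarrow> 'a \<Rightarrow> 'b::euclidean_space) \<Rightarrow> bool" where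
  "O_wp1_L2 M Z \<longleftrightarrow>
     (\<exists>(W :: nat \<Rightarrow> 'a \<Rightarrow> real) (Wb :: nat \<Rightarrow> 'a \<Rightarrow> 'b).
        (\<forall>n. W n \<in> borel_measurable M \<and> Wb n \<in> borel_measurable M)
        \<and> (\<forall>n. \<forall>\<omega>\<in>space M. Z n \<omega> = W n \<omega> *\<^sub>R Wb n \<omega>)
        \<and> O_wp1 M W \<and> O_L2 M Wb)"

end

theory Submission
  imports Defs "HOL-Computational_Algebra.Fundamental_Theorem_Algebra" "HOL-Real_Asymp.Real_Asymp"
begin

text \<open>
  Write \<open>x n = \<theta> n - \<theta>s\<close>, \<open>g n = \<gamma> (Suc n)\<close> and \<open>R n = h (\<theta> n) - Dh *v x n\<close>. Dividing the recursion by the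
  step size and summing expresses \<open>Dh *v (\<Sum>k\<le>n. x k)\<close> as
  \<open>(\<Sum>k\<le>n. (x (Suc k) - x k) / g k) - (\<Sum>k\<le>n. R k) - (\<Sum>k\<le>n. e (Suc k)) - (\<Sum>k\<le>n. r (Suc k))\<close>.
  After normalization the noise sum has the prescribed limit and the sum of the \<open>r\<close> vanishes by
  assumption, so everything rests on a rate \<open>norm (x n) \<le> C * (sqrt (g n) * D n)\<close> with \<open>C\<close> random but
  finite and \<open>D\<close> bounded in \<open>L\<^sup>2\<close>: then \<open>R n\<close> is of order \<open>g n\<close>, summation by parts handles the
  increments, and the conditions on the step sizes make both contributions negligible.

  For the rate, a Hurwitz matrix contracts a suitable Euclidean norm under \<open>v \<mapsto> v + s *\<^sub>R (Dh *v v)\<close>.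
  The iterate is compared with the linear recursion driven by the truncated noise, whose second
  moment is of order \<open>g n\<close>; the difference is dominated pathwise by a scalar linear
  recursion whose inputs are bounded in \<open>L\<^sup>2\<close>.
\<close>

section \<open>Contracting norms for Hurwitz matrices\<close>

text \<open>Two kinds of randomness obstruct a direct moment estimate: the noise has bounded second
  moments only after truncation on localizing events, and the times at which the truncation becomes
  inactive and the nonlinearity small vary from path to path. The proof keeps them apart. Every
  path-dependent threshold is absorbed into the constant \<open>C\<close>, whereas \<open>D\<close>
  is built from truncated data for all indices at once and refers to no threshold, so that
  \<open>D\<close> can be integrated. The constant is never integrated: restricting to the event
  that an integer \<open>j\<close> can replace it gives convergence in probability, which is all
  that characteristic functions need.

  The adapted norm has to come from an inner product, because orthogonality of martingale increments
  is used to remove a cross term, and it has to contract in a single step, because the step sizes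
  change. The condition on logarithms says that \<open>g\<close> changes by less over one step than
  the contraction gains; hence \<open>g\<close> itself is the right scale for second moments. A
  bound in \<open>L2\<close>, rather than a weaker one, is what the quadratic Taylor remainder asks
  for, since it involves the square of \<open>D\<close>.\<close>

lemma orbit_annihilated:
  fixes f :: "'a::euclidean_space \<Rightarrow> 'a"
  obtains p :: "real poly" where "p \<noteq> 0" "(\<Sum>i\<le>degree p. coeff p i *\<^sub>R (f ^^ i) v) = 0"
proof -
  let ?n = "DIM('a)"
  let ?u = "\<lambda>i. (f ^^ i) v"
  have "\<exists>c :: nat \<Rightarrow> real. (\<exists>i\<le>?n. c i \<noteq> 0) \<and> (\<Sum>i\<le>?n. c i *\<^sub>R ?u i) = 0"
  \<comment> \<open>The dimension count applies to the set of iterates and needs them to be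
    distinct; when two of them coincide, their difference is already a nontrivial relation.\<close>
  proof (cases "inj_on ?u {..?n}")
    case True
    then have "card (?u ` {..?n}) = Suc ?n" by (simp add: card_image)
    then have "dependent (?u ` {..?n})"
      by (intro dependent_biggerset) auto
    then obtain w where w: "\<exists>y\<in>?u ` {..?n}. w y \<noteq> 0" "(\<Sum>y\<in>?u ` {..?n}. w y *\<^sub>R y) = 0"
      by (subst (asm) dependent_finite) auto
    from w(2) have "(\<Sum>i\<le>?n. w (?u i) *\<^sub>R ?u i) = 0"
      by (subst (asm) sum.reindex[OF True]) simp
    with w(1) show ?thesis by (intro exI[of _ "\<lambda>i. w (?u i)"]) auto
  next
    case False
    then obtain i j where ij: "i \<le> ?n" "j \<le> ?n" "i \<noteq> j" "?u i = ?u j"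
      by (auto simp: inj_on_def)
    let ?c = "\<lambda>k. (if k = i then 1 else 0) - (if k = j then 1 else (0::real))"
    have "(\<Sum>k\<le>?n. ?c k *\<^sub>R ?u k) = (\<Sum>k\<le>?n. (if k = i then ?u k else 0) - (if k = j then ?u k else 0))"
      by (rule sum.cong) (auto simp: algebra_simps)
    also have "\<dots> = 0"
      using ij by (simp add: sum_subtractf)
    finally show ?thesis using ij by (intro exI[of _ ?c]) auto
  qed
  then obtain c :: "nat \<Rightarrow> real" and i where c: "i \<le> ?n" "c i \<noteq> 0" "(\<Sum>i\<le>?n. c i *\<^sub>R ?u i) = 0"
    by blast
  define p where "p = (\<Sum>k\<le>?n. monom (c k) k)"
  have coeff: "coeff p k = (if k \<le> ?n then c k else 0)" for k
    by (simp add: p_def coeff_sum coeff_monom)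
  have deg: "degree p \<le> ?n"
    by (rule degree_le) (auto simp: coeff)
  have "(\<Sum>k\<le>degree p. coeff p k *\<^sub>R ?u k) = (\<Sum>k\<le>?n. coeff p k *\<^sub>R ?u k)"
    by (rule sum.mono_neutral_left) (use deg in \<open>auto simp: coeff_eq_0\<close>)
  also have "\<dots> = (\<Sum>i\<le>?n. c i *\<^sub>R ?u i)" by (rule sum.cong) (auto simp: coeff)
  finally have "(\<Sum>k\<le>degree p. coeff p k *\<^sub>R ?u k) = 0" using c by simp
  moreover have "p \<noteq> 0" using c coeff[of i] by auto
  ultimately show thesis using that by blast
qed

text \<open>Summing over \<open>k < n\<close> bounds a partial sum by \<open>u 0 + suminf w\<close>
  plus \<open>\<rho>\<close> times itself, and \<open>\<rho> < 1\<close> lets the last term be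
  absorbed. This transfers summability across one linear factor of an annihilating
  polynomial.\<close>

lemma summable_linear_recurrence:
  fixes u w :: "nat \<Rightarrow> real"
  assumes "0 \<le> \<rho>" "\<rho> < 1" "\<And>k. u k \<ge> 0" "\<And>k. w k \<ge> 0" "\<And>k. u (Suc k) \<le> \<rho> * u k + w k" "summable w"
  shows "summable u"
proof (rule summableI_nonneg_bounded)
  fix n
  have "(\<Sum>k<n. u k) \<le> u 0 + (\<Sum>k<n. u (Suc k))"
    using sum.lessThan_Suc_shift[of u n] assms(3)[of n] by simp
  also have "(\<Sum>k<n. u (Suc k)) \<le> (\<Sum>k<n. \<rho> * u k + w k)"
    by (rule sum_mono) (rule assms)
  also have "\<dots> = \<rho> * (\<Sum>k<n. u k) + (\<Sum>k<n. w k)"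
    by (simp add: sum.distrib sum_distrib_left)
  also have "(\<Sum>k<n. w k) \<le> suminf w"
    by (rule sum_le_suminf) (use assms in auto)
  finally have "(1 - \<rho>) * (\<Sum>k<n. u k) \<le> u 0 + suminf w" by (simp add: algebra_simps)
  then show "(\<Sum>k<n. u k) \<le> (u 0 + suminf w) / (1 - \<rho>)"
    using assms by (simp add: field_simps)
qed (use assms in auto)

section \<open>Orbits of a complex matrix and the polynomials annihilating them\<close>

lemma norm_vector_scalar_mult_complex:
  fixes v :: "complex^'n"
  shows "norm (c *s v) = norm c * norm v"
  unfolding norm_vec_def
  by (simp add: vector_scalar_mult_def norm_mult L2_set_right_distrib)

text \<open>This is \<open>p(C) v\<close>, the polynomial functional calculus at one vector, written
  with iterates of the matrix action so that annihilation is a statement about the orbit of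
  \<open>v\<close> alone.\<close>

definition orbit_poly :: "complex^'n^'n \<Rightarrow> complex poly \<Rightarrow> complex^'n \<Rightarrow> complex^'n" where
  "orbit_poly C p v = (\<Sum>i\<le>degree p. coeff p i *s (((*v) C) ^^ i) v)"

lemma orbit_poly_eq:
  assumes "degree p \<le> n"
  shows "orbit_poly C p v = (\<Sum>i\<le>n. coeff p i *s (((*v) C) ^^ i) v)"
  unfolding orbit_poly_def
  by (rule sum.mono_neutral_left) (use assms in \<open>auto simp: coeff_eq_0\<close>)

lemma matrix_vector_funpow_linear:
  fixes C :: "complex^'n^'n"
  shows "(((*v) C) ^^ i) (v + w) = (((*v) C) ^^ i) v + (((*v) C) ^^ i) w"
    "(((*v) C) ^^ i) (c *s v) = c *s (((*v) C) ^^ i) v"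
    "(((*v) C) ^^ i) (v - w) = (((*v) C) ^^ i) v - (((*v) C) ^^ i) w"
  by (induction i) (simp_all add: matrix_vector_right_distrib matrix_vector_mult_diff_distrib vector_scalar_commute)

lemma orbit_poly_pCons: "orbit_poly C (pCons a p) v = a *s v + orbit_poly C p (C *v v)"
proof -
  have "orbit_poly C (pCons a p) v = (\<Sum>i\<le>Suc (degree p). coeff (pCons a p) i *s (((*v) C) ^^ i) v)"
    by (rule orbit_poly_eq) (rule degree_pCons_le)
  also have "\<dots> = a *s v + (\<Sum>i\<le>degree p. coeff p i *s (((*v) C) ^^ Suc i) v)"
    by (subst sum.atMost_Suc_shift) simp
  finally show ?thesis by (simp add: orbit_poly_def funpow_Suc_right del: funpow.simps)

qed

lemma orbit_poly_diff_smult: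
  "orbit_poly C p (v - c *s w) = orbit_poly C p v - c *s orbit_poly C p w"
  unfolding orbit_poly_def
  by (simp add: matrix_vector_funpow_linear vec.scale_right_diff_distrib sum_subtractf vec.scale_sum_right mult.commute)

lemma orbit_poly_matrix_vector:
  "orbit_poly C p (C *v v) = C *v orbit_poly C p v"
  unfolding orbit_poly_def
  by (simp add: vec.linear_sum[OF matrix_vector_mul_linear_gen] o_def funpow_swap1 vector_scalar_commute)

lemma orbit_poly_add: "orbit_poly C (p + q) v = orbit_poly C p v + orbit_poly C q v"
proof -
  define n where "n = max (degree p) (degree q)"
  have "degree (p + q) \<le> n" "degree p \<le> n" "degree q \<le> n"
    using degree_add_le_max[of p q] by (auto simp: n_def)
  then show ?thesis by (simp add: orbit_poly_eq[of _ n] vec.scale_left_distrib sum.distrib)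
qed

lemma orbit_poly_linear_factor:
  "orbit_poly C ([:- m, 1:] * q) v = C *v orbit_poly C q v - m *s orbit_poly C q v"
proof -
  have "[:- m, 1:] * q = pCons 0 q + smult (- m) q"
    by (simp add: mult_pCons_left)
  moreover have "orbit_poly C (smult (- m) q) v = - (m *s orbit_poly C q v)"
    unfolding orbit_poly_eq[OF degree_smult_le] 
    by (simp add: orbit_poly_def vec.scale_sum_right flip: sum_negf)
  ultimately show ?thesis
    by (simp only: orbit_poly_add orbit_poly_pCons orbit_poly_matrix_vector) simp
qed

lemma summable_orbit_of_annihilated:
  fixes C :: "complex^'n^'n"
  assumes eig: "\<And>m v. v \<noteq> 0 \<Longrightarrow> C *v v = m *s v \<Longrightarrow> norm m < 1"
  assumes "p \<noteq> 0" "orbit_poly C p v = 0"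
  shows "summable (\<lambda>k. norm ((((*v) C) ^^ k) v))"
  using assms(2,3)
proof (induction "degree p" arbitrary: p v)
  case 0
  then obtain a where a: "p = [:a:]" by (metis degree_eq_zeroE)
  with 0 have "a \<noteq> 0" by simp
  with a 0 have "v = 0" by (simp add: orbit_poly_def)
  have "(((*v) C) ^^ k) (0::complex^'n) = 0" for k
    by (induction k) auto
  then show ?case using \<open>v = 0\<close> by simp
next
  case (Suc d)
  obtain m where "poly p m = 0"
    using fundamental_theorem_of_algebra[of p] Suc.hyps(2) constant_degree[of p] by auto
  then obtain q where pq: "p = [:- m, 1:] * q" unfolding poly_eq_0_iff_dvd by (elim dvdE)
  then have q0: "q \<noteq> 0" using Suc.prems by auto
  then have "degree p = degree [:- m, 1:] + degree q"
    unfolding pq by (intro degree_mult_eq) auto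
  then have q: "q \<noteq> 0" "degree q = d"
    using q0 Suc.hyps(2) by auto
  show ?case
  proof (cases "norm m < 1")
    case True
    let ?w = "C *v v - m *s v"
    have "orbit_poly C q ?w = orbit_poly C p v"
      unfolding pq orbit_poly_linear_factor by (simp only: orbit_poly_diff_smult orbit_poly_matrix_vector)
    then have "summable (\<lambda>k. norm ((((*v) C) ^^ k) ?w))"
      using Suc.hyps(1)[OF q(2)[symmetric] q(1)] Suc.prems(2) by simp
    moreover have "norm ((((*v) C) ^^ Suc k) v) \<le> norm m * norm ((((*v) C) ^^ k) v) + norm ((((*v) C) ^^ k) ?w)" for k
    proof -
      have "(((*v) C) ^^ Suc k) v = m *s (((*v) C) ^^ k) v + (((*v) C) ^^ k) ?w"
        by (simp add: matrix_vector_funpow_linear funpow_Suc_right del: funpow.simps)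
      then show ?thesis using norm_triangle_ineq[of "m *s (((*v) C) ^^ k) v"] by (simp only: norm_vector_scalar_mult_complex)
    qed
    ultimately show ?thesis
      by - (rule summable_linear_recurrence[where w = "\<lambda>k. norm ((((*v) C) ^^ k) ?w)", OF _ True], simp_all del: funpow.simps)
  next
    case False
    have "C *v orbit_poly C q v = m *s orbit_poly C q v"
      using Suc.prems(2) unfolding pq orbit_poly_linear_factor by simp
    then have "orbit_poly C q v = 0" using eig False by blast
    then show ?thesis by (rule Suc.hyps(1)[OF q(2)[symmetric] q(1)])
  qed
qed

text \<open>As a real space \<open>complex^'n\<close> has finite dimension, which yields an
  annihilating polynomial with real coefficients; it is then read as a complex one so that its roots
  are available.\<close>

lemma summable_matrix_orbit:
  fixes C :: "complex^'n^'n"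
  assumes eig: "\<And>m v. v \<noteq> 0 \<Longrightarrow> C *v v = m *s v \<Longrightarrow> norm m < 1"
  shows "summable (\<lambda>k. norm ((((*v) C) ^^ k) v))"
proof -
  obtain p :: "real poly" where p: "p \<noteq> 0" "(\<Sum>i\<le>degree p. coeff p i *\<^sub>R (((*v) C) ^^ i) v) = 0"
    by (rule orbit_annihilated)
  have "orbit_poly C (map_poly complex_of_real p) v = 0"
    using p(2) unfolding orbit_poly_def
    by (simp add: coeff_map_poly degree_map_poly scaleR_vec_def vector_scalar_mult_def scaleR_conv_of_real[where 'a=complex])
  then show ?thesis
    using p(1) by (intro summable_orbit_of_annihilated[OF eig]) (auto simp: map_poly_eq_0_iff)
qed

section \<open>Complexification and the discretization of a Hurwitz matrix\<close>

definition complexify :: "real^'n \<Rightarrow> complex^'n" where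
  "complexify x = (\<chi> i. complex_of_real (x $ i))"

lemma norm_complexify [simp]: "norm (complexify x) = norm x"
  by (simp add: complexify_def norm_vec_def L2_set_def)

lemma complexify_matrix_vector:
  "complexify (A *v x) = (\<chi> i j. complex_of_real (A $ i $ j)) *v complexify x"
  by (simp add: complexify_def matrix_vector_mult_def vec_eq_iff)

text \<open>An eigenvalue of the discretization is \<open>1 + \<epsilon> * \<mu>\<close> with
  \<open>\<mu>\<close> an eigenvalue of \<open>A\<close>. In its squared modulus the negative term
  linear in \<open>\<epsilon>\<close> beats the quadratic one for small \<open>\<epsilon>\<close>,
  provided that \<open>Re \<mu>\<close> stays away from \<open>0\<close> and
  \<open>norm \<mu>\<close> is bounded, uniformly over all eigenvalues.\<close>

lemma hurwitz_discretization:
  fixes A :: "real^'n^'n"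
  assumes "hurwitz A"
  obtains \<epsilon> :: real where "\<epsilon> > 0"
    "\<And>m v. v \<noteq> 0 \<Longrightarrow> (\<chi> i j. complex_of_real ((mat 1 + \<epsilon> *\<^sub>R A) $ i $ j)) *v v = m *s v \<Longrightarrow> norm m < 1"
proof -
  define C where "C = (\<chi> i j. complex_of_real (A $ i $ j))"
  \<comment> \<open>Eigenvalues are kept together with unit eigenvectors: the set of these pairs is
    closed and bounded, so \<open>Re\<close> attains its maximum on it, and compactness takes over
    the role of the finiteness of the spectrum.\<close>
  define E where "E = {(m::complex, v::complex^'n). norm v = 1 \<and> C *v v = m *s v}"
  have bl: "bounded_linear ((*v) C)" by simp
  have bound: "norm m \<le> onorm ((*v) C)" if "(m, v) \<in> E" for m v
    using onorm[OF bl, of v] that by (auto simp: E_def norm_vector_scalar_mult_complex)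
  have "closed E"
  proof -
    have 1: "continuous_on UNIV (\<lambda>p::complex \<times> (complex^'n). C *v snd p)"
      by (rule bounded_linear.continuous_on[OF bl continuous_on_snd[OF continuous_on_id]])
    have 2: "continuous_on UNIV (\<lambda>p::complex \<times> (complex^'n). fst p *s snd p)"
      unfolding vector_scalar_mult_def by (intro continuous_intros)
    have "E = {p. norm (snd p) = 1} \<inter> {p. C *v snd p = fst p *s snd p}"
      by (auto simp: E_def)
    moreover have "closed {p::complex \<times> (complex^'n). norm (snd p) = 1}"
      by (intro closed_Collect_eq continuous_intros)
    ultimately show ?thesis using closed_Collect_eq[OF 1 2] by auto
  qed
  moreover have "bounded E"
  proof -
    have "E \<subseteq> cball 0 (onorm ((*v) C)) \<times> cball 0 1"
      using bound by (auto simp: E_def)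
    then show ?thesis using bounded_Times bounded_cball bounded_subset by metis
  qed
  ultimately have "compact E" by (simp add: compact_eq_bounded_closed)
  have "\<exists>c>0. \<forall>p\<in>E. Re (fst p) \<le> - c"
  proof (cases "E = {}")
    case False
    have "continuous_on E (\<lambda>p. Re (fst p))" by (intro continuous_intros)
    with \<open>compact E\<close> False obtain p where p: "p \<in> E" "\<And>q. q \<in> E \<Longrightarrow> Re (fst q) \<le> Re (fst p)"
      by (metis (no_types, lifting) continuous_attains_sup)
    obtain m v where mv: "p = (m, v)" by (cases p)
    with p(1) have "v \<noteq> 0" "C *v v = m *s v" by (auto simp: E_def)
    then have "Re (fst p) < 0"
      using assms unfolding hurwitz_def mv C_def by auto
    then show ?thesis using p(2) by (intro exI[of _ "- Re (fst p)"]) auto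
  qed (auto intro: exI[of _ 1])
  then obtain c where c: "c > 0" "\<And>m v. (m, v) \<in> E \<Longrightarrow> Re m \<le> - c" by fastforce
  define K where "K = onorm ((*v) C) + 1"
  have K: "K > 0" "norm m \<le> K" if "(m, v) \<in> E" for m v
    using bound[OF that] onorm_pos_le[OF bl] by (auto simp: K_def)
  have K0: "K > 0" using onorm_pos_le[OF bl] by (simp add: K_def)
  \<comment> \<open>With this choice \<open>\<epsilon>\<^sup>2 * K\<^sup>2\<close> equals
    \<open>\<epsilon> * c\<close>, half of the gain \<open>2 * \<epsilon> * c\<close>. The
    \<open>+ 1\<close> in \<open>K\<close> makes the division legitimate.\<close>
  define \<epsilon> where "\<epsilon> = c / K\<^sup>2"
  have \<epsilon>: "\<epsilon> > 0" using c K0 by (simp add: \<epsilon>_def)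
  show thesis
  proof (rule that[OF \<epsilon>])
    fix m and v :: "complex^'n"
    assume v: "v \<noteq> 0" and ev: "(\<chi> i j. complex_of_real ((mat 1 + \<epsilon> *\<^sub>R A) $ i $ j)) *v v = m *s v"
    have "(\<chi> i j. complex_of_real ((mat 1 + \<epsilon> *\<^sub>R A) $ i $ j)) *v v = v + complex_of_real \<epsilon> *s (C *v v)"
      by (simp add: vec_eq_iff C_def mat_def matrix_vector_mult_def distrib_right sum.distrib
          sum_distrib_left mult.assoc if_distrib[of complex_of_real] if_distribR if_distrib[of "\<lambda>x. x * _"] cong: if_cong)
    then have "complex_of_real \<epsilon> *s (C *v v) = (m - 1) *s v"
      using ev by (simp add: vec.scale_left_diff_distrib algebra_simps)
    then have "(1 / complex_of_real \<epsilon>) *s (complex_of_real \<epsilon> *s (C *v v)) = ((m - 1) / complex_of_real \<epsilon>) *s v"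
      by (simp only: vector_smult_assoc) simp
    then have eig: "C *v v = ((m - 1) / complex_of_real \<epsilon>) *s v"
      using \<epsilon> by simp
    define \<mu> where "\<mu> = (m - 1) / complex_of_real \<epsilon>"
    have m: "m = 1 + complex_of_real \<epsilon> * \<mu>" using \<epsilon> by (simp add: \<mu>_def)
    have "(\<mu>, (1 / complex_of_real (norm v)) *s v) \<in> E"
      using v eig by (simp add: E_def norm_vector_scalar_mult_complex norm_divide \<mu>_def vector_scalar_commute mult.commute)
    from c(2)[OF this] K(2)[OF this] have \<mu>: "Re \<mu> \<le> - c" "norm \<mu> \<le> K" by auto
    have "(norm m)\<^sup>2 = 1 + 2 * \<epsilon> * Re \<mu> + \<epsilon>\<^sup>2 * (norm \<mu>)\<^sup>2"
      unfolding m cmod_power2 by (simp add: algebra_simps power2_eq_square)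
    also have "\<dots> \<le> 1 + 2 * \<epsilon> * (- c) + \<epsilon>\<^sup>2 * K\<^sup>2"
      using \<mu> \<epsilon> K0 by (intro add_mono mult_left_mono power_mono) auto
    also have "\<epsilon>\<^sup>2 * K\<^sup>2 = \<epsilon> * c"
      using K0 by (simp add: \<epsilon>_def power2_eq_square)
    also have "1 + 2 * \<epsilon> * (- c) + \<epsilon> * c < 1\<^sup>2"
      using \<epsilon> c(1) mult_pos_pos[of \<epsilon> c] by simp
    finally show "norm m < 1" by (rule power2_less_imp_less) simp
  qed
qed

text \<open>The norm \<open>N\<close> of such a form is equivalent to the Euclidean one: boundedness
  gives the upper estimate, and the normalization \<open>norm_le_form\<close> gives definiteness
  together with the lower estimate with constant \<open>1\<close>.\<close>

locale inner_form = bounded_bilinear Q for Q :: "'a::euclidean_space \<Rightarrow> 'a \<Rightarrow> real" +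
  assumes sym: "Q x y = Q y x" and norm_le_form: "(norm x)\<^sup>2 \<le> Q x x"
begin

definition N :: "'a \<Rightarrow> real" where "N x = sqrt (Q x x)"

lemma form_nonneg [simp]: "0 \<le> Q x x"
  using norm_le_form[of x] by (meson order_trans zero_le_power2)

lemma N_nonneg [simp]: "0 \<le> N x" by (simp add: N_def)

lemma N_power2: "(N x)\<^sup>2 = Q x x" by (simp add: N_def)

lemma norm_le_N: "norm x \<le> N x"
  unfolding N_def by (rule real_le_rsqrt) (rule norm_le_form)

lemma N_eq_0_iff [simp]: "N x = 0 \<longleftrightarrow> x = 0"
  using norm_le_N[of x] by (auto simp: N_def zero_left)

lemma N_0 [simp]: "N 0 = 0" by simp

lemma N_scaleR: "N (c *\<^sub>R x) = \<bar>c\<bar> * N x"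
  by (simp add: N_def scaleR_left scaleR_right real_sqrt_mult flip: mult.assoc)

text \<open>Cauchy-Schwarz: the vector \<open>?z\<close> is chosen so that expanding
  \<open>0 \<le> Q ?z ?z\<close> leaves a common factor \<open>N x * N y\<close>, which cancels once
  both vectors are nonzero.\<close>

lemma form_le: "Q x y \<le> N x * N y"
proof (cases "x = 0 \<or> y = 0")
  case False
  then have pos: "N x > 0" "N y > 0"
    using N_nonneg[of x] N_nonneg[of y] N_eq_0_iff[of x] N_eq_0_iff[of y] by linarith+
  let ?z = "N y *\<^sub>R x - N x *\<^sub>R y"
  have "0 \<le> Q ?z ?z" by simp
  also have "\<dots> = 2 * (N y)\<^sup>2 * (N x)\<^sup>2 - 2 * N x * N y * Q x y"
    by (simp add: N_power2 diff_left diff_right scaleR_left scaleR_right sym[of y x] algebra_simps power2_eq_square[of "N _"])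
       (simp add: algebra_simps power2_eq_square flip: N_power2)
  finally have "(N x * N y) * Q x y \<le> (N x * N y) * (N x * N y)"
    by (simp add: power2_eq_square algebra_simps)
  then show ?thesis using pos by simp
qed (auto simp: zero_left zero_right)

lemma N_triangle: "N (x + y) \<le> N x + N y"
proof -
  have "(N (x + y))\<^sup>2 = (N x)\<^sup>2 + 2 * Q x y + (N y)\<^sup>2"
    by (simp add: N_power2 add_left add_right sym[of y x])
  also have "\<dots> \<le> (N x + N y)\<^sup>2"
    using form_le[of x y] by (simp add: power2_sum)
  finally show ?thesis by (rule power2_le_imp_le) simp
qed

lemma N_le: obtains K where "K > 0" "\<And>x. N x \<le> K * norm x"
proof -
  obtain K where K: "K > 0" "\<And>x y. norm (Q x y) \<le> norm x * norm y * K"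
    using pos_bounded by blast
  have "N x \<le> sqrt K * norm x" for x
  proof -
    have "N x \<le> sqrt (norm x * norm x * K)"
      unfolding N_def using K(2)[of x x] by simp
    then show ?thesis by (simp add: real_sqrt_mult mult.commute)
  qed
  with K(1) show thesis by (intro that[of "sqrt K"]) auto
qed

end

text \<open>\<open>Q\<close> solves a discrete Lyapunov equation: shifting the series by one index
  removes exactly the term \<open>k = 0\<close>, which is the Euclidean square. Since the shifted
  series is nonnegative, \<open>Q\<close> dominates that square.\<close>

lemma inner_form_of_summable_orbits:
  fixes f :: "'a::euclidean_space \<Rightarrow> 'a"
  assumes "linear f" and summ: "\<And>x. summable (\<lambda>k. norm ((f ^^ k) x))"
  obtains Q where "inner_form Q" "\<And>x. Q (f x) (f x) = Q x x - (norm x)\<^sup>2"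
proof -
  have lin: "linear (f ^^ k)" for k
    using linear_compose[OF _ assms(1)] by (induction k) (auto simp: linear_id o_def simp flip: id_def)
  \<comment> \<open>Summability is given orbit by orbit; adding up over a basis produces one
    summable sequence that bounds the operator norms of all \<open>f ^^ k\<close>.\<close>
  define c where "c k = (\<Sum>b\<in>Basis. norm ((f ^^ k) b))" for k
  have c: "summable c" "c k \<ge> 0" for k
    unfolding c_def by (auto intro: summable_sum summ sum_nonneg)
  have f_le: "norm ((f ^^ k) x) \<le> c k * norm x" for k x
  proof -
    have "(f ^^ k) x = (\<Sum>b\<in>Basis. (x \<bullet> b) *\<^sub>R (f ^^ k) b)"
      by (subst euclidean_representation[of x, symmetric])
         (simp only: linear_sum[OF lin] linear_cmul[OF lin] o_def)
    also have "norm \<dots> \<le> (\<Sum>b\<in>Basis. norm x * norm ((f ^^ k) b))"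
      by (rule sum_norm_le) (simp add: mult_right_mono Basis_le_norm)
    finally show ?thesis by (simp add: c_def sum_distrib_left mult.commute)
  qed
  define M where "M = suminf c"
  have M: "c k \<le> M" for k
    unfolding M_def using sum_le_suminf[OF c(1), of "{k}"] c(2) by simp
  have M0: "M \<ge> 0" using M[of 0] c(2)[of 0] by linarith
  define Q where "Q x y = (\<Sum>k. (f ^^ k) x \<bullet> (f ^^ k) y)" for x y
  \<comment> \<open>One summable factor is enough; the other is bounded by \<open>M\<close>.\<close>
  have le: "norm ((f ^^ k) x \<bullet> (f ^^ k) y) \<le> c k * (norm x * norm y * M)" for k x y
  proof -
    have "norm ((f ^^ k) x \<bullet> (f ^^ k) y) \<le> norm ((f ^^ k) x) * norm ((f ^^ k) y)"
      by (simp add: Cauchy_Schwarz_ineq2)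
    also have "\<dots> \<le> (c k * norm x) * (M * norm y)"
      using f_le[of k x] order_trans[OF f_le[of k y] mult_right_mono[OF M[of k] norm_ge_zero]] c(2)[of k]
      by (intro mult_mono) auto
    finally show ?thesis by (simp add: mult_ac)
  qed
  have sQ: "summable (\<lambda>k. (f ^^ k) x \<bullet> (f ^^ k) y)" for x y
    by (rule summable_comparison_test'[OF summable_mult2[OF c(1)] le])
  have add: "Q (x + x') y = Q x y + Q x' y" for x x' y
    unfolding Q_def by (simp add: linear_add[OF lin] inner_add_left suminf_add[OF sQ sQ])
  have scale: "Q (r *\<^sub>R x) y = r *\<^sub>R Q x y" for r x y
    unfolding Q_def by (simp add: linear_cmul[OF lin] suminf_mult[OF sQ])
  have sym: "Q x y = Q y x" for x y
    unfolding Q_def by (simp add: inner_commute)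
  have bound: "norm (Q x y) \<le> norm x * norm y * (M * M)" for x y
  proof -
    have "norm (Q x y) \<le> (\<Sum>k. c k * (norm x * norm y * M))"
      unfolding Q_def by (rule norm_suminf_le[OF le summable_mult2[OF c(1)]])
    also have "\<dots> = M * (norm x * norm y * M)"
      unfolding M_def by (rule suminf_mult2[OF c(1), symmetric])
    finally show ?thesis by (simp add: mult_ac)
  qed
  have shift: "Q (f x) (f x) = Q x x - (norm x)\<^sup>2" for x
    using suminf_split_head[OF sQ[of x x]]
    by (simp add: Q_def funpow_Suc_right power2_norm_eq_inner del: funpow.simps(2))
  have "Q (f x) (f x) \<ge> 0" for x
    unfolding Q_def by (rule suminf_nonneg[OF sQ]) simp
  then have "(norm x)\<^sup>2 \<le> Q x x" for x using shift[of x] by (metis diff_ge_0_iff_ge)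
  with sym bound add scale have "inner_form Q"
    by unfold_locales (metis+)
  with shift show thesis using that by blast
qed

text \<open>The contraction is required only for steps up to \<open>s0\<close>. Step sizes tending
  to \<open>0\<close> fall below this threshold, so later estimates hold eventually at first and are
  extended to all indices by enlarging constants.\<close>

locale contracting = inner_form Q for Q :: "'a::euclidean_space \<Rightarrow> 'a \<Rightarrow> real" +
  fixes T :: "'a \<Rightarrow> 'a" and \<beta> s0 :: real
  assumes linear_T: "linear T" and \<beta>: "\<beta> > 0" and s0: "s0 > 0"
    and contract: "0 \<le> s \<Longrightarrow> s \<le> s0 \<Longrightarrow> N (x + s *\<^sub>R T x) \<le> (1 - \<beta> * s) * N x"

text \<open>
  The discretization \<open>B = mat 1 + \<epsilon> *\<^sub>R A\<close> has spectral radius below \<open>1\<close>, so the form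
  \<open>Q x y = (\<Sum>k. (B ^ k x) \<bullet> (B ^ k y))\<close> satisfies \<open>Q (B x) (B x) = Q x x - (norm x)\<^sup>2\<close> and \<open>B\<close> contracts
  its norm; \<open>mat 1 + s *\<^sub>R A\<close> is a convex combination of \<open>mat 1\<close> and \<open>B\<close>.
\<close>

lemma hurwitz_contracting:
  fixes A :: "real^'n^'n"
  assumes "hurwitz A"
  obtains Q \<beta> s0 where "contracting Q ((*v) A) \<beta> s0"
proof -
  obtain \<epsilon> where \<epsilon>: "\<epsilon> > 0" and
    eig: "\<And>m v. v \<noteq> 0 \<Longrightarrow> (\<chi> i j. complex_of_real ((mat 1 + \<epsilon> *\<^sub>R A) $ i $ j)) *v v = m *s v \<Longrightarrow> norm m < 1"
    using hurwitz_discretization[OF assms] by blast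
  define B where "B = mat 1 + \<epsilon> *\<^sub>R A"
  have B: "B *v x = x + \<epsilon> *\<^sub>R (A *v x)" for x
    by (simp add: B_def matrix_vector_mult_add_rdistrib scaleR_matrix_vector_assoc)
  have "summable (\<lambda>k. norm ((((*v) B) ^^ k) x))" for x
  proof -
    have "complexify ((((*v) B) ^^ k) x) = (((*v) (\<chi> i j. complex_of_real (B $ i $ j))) ^^ k) (complexify x)" for k
      by (induction k) (simp_all add: complexify_matrix_vector)
    then have "norm ((((*v) B) ^^ k) x) = norm ((((*v) (\<chi> i j. complex_of_real (B $ i $ j))) ^^ k) (complexify x))" for k
      by (metis norm_complexify)
    then show ?thesis using summable_matrix_orbit[OF eig] by (simp add: B_def)
  qed
  then obtain Q where Q: "inner_form Q" "\<And>x. Q (B *v x) (B *v x) = Q x x - (norm x)\<^sup>2"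
    using inner_form_of_summable_orbits[OF matrix_vector_mul_linear[of B]] by blast
  interpret inner_form Q by fact
  obtain K0 where K0: "K0 > 0" "\<And>x. N x \<le> K0 * norm x" using N_le by blast
  \<comment> \<open>\<open>K \<ge> 1\<close> keeps \<open>1 - 1 / K\<^sup>2\<close> nonnegative, so
    that its square root can serve as the contraction factor.\<close>
  define K where "K = max K0 1"
  have K: "K \<ge> 1" "N x \<le> K * norm x" for x
    using order_trans[OF K0(2) mult_right_mono[of K0 K "norm x"]] by (auto simp: K_def)
  define \<rho> where "\<rho> = sqrt (1 - 1 / K\<^sup>2)"
  have K2: "0 < 1 / K\<^sup>2" "1 / K\<^sup>2 \<le> 1" using K(1) by (auto simp: field_simps)
  have \<rho>: "0 \<le> \<rho>" "\<rho> < 1" using K2 by (auto simp: \<rho>_def real_sqrt_lt_1_iff)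
  have NB: "N (B *v x) \<le> \<rho> * N x" for x
  proof (rule power2_le_imp_le)
    have "(N x)\<^sup>2 \<le> K\<^sup>2 * (norm x)\<^sup>2"
      using power_mono[OF K(2)[of x] N_nonneg, of 2] by (simp add: power_mult_distrib)
    then have "(1 / K\<^sup>2) * (N x)\<^sup>2 \<le> (norm x)\<^sup>2"
      using K(1) by (simp add: field_simps)
    then have "(N (B *v x))\<^sup>2 \<le> (1 - 1 / K\<^sup>2) * (N x)\<^sup>2"
      using Q(2)[of x] by (simp add: N_power2 algebra_simps)
    then show "(N (B *v x))\<^sup>2 \<le> (\<rho> * N x)\<^sup>2"
      using K2 by (simp add: \<rho>_def power_mult_distrib)
  qed (use \<rho> in simp)
  \<comment> \<open>The weight \<open>s / \<epsilon>\<close> of \<open>B\<close> in the convex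
    combination multiplies the gain \<open>1 - \<rho>\<close>, whence the rate; both weights are
    nonnegative up to \<open>s = \<epsilon>\<close>, whence the threshold.\<close>
  have "contracting Q ((*v) A) ((1 - \<rho>) / \<epsilon>) \<epsilon>"
  proof
    fix s x assume s: "0 \<le> s" "s \<le> \<epsilon>"
    have "x + s *\<^sub>R (A *v x) = (1 - s / \<epsilon>) *\<^sub>R x + (s / \<epsilon>) *\<^sub>R (B *v x)"
      using \<epsilon> by (simp add: B algebra_simps)
    then have "N (x + s *\<^sub>R (A *v x)) \<le> N ((1 - s / \<epsilon>) *\<^sub>R x) + N ((s / \<epsilon>) *\<^sub>R (B *v x))"
      using N_triangle by simp
    also have "\<dots> = (1 - s / \<epsilon>) * N x + (s / \<epsilon>) * N (B *v x)"
      using s \<epsilon> by (simp add: N_scaleR)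
    also have "\<dots> \<le> (1 - s / \<epsilon>) * N x + (s / \<epsilon>) * (\<rho> * N x)"
      using s \<epsilon> NB by (intro add_left_mono mult_left_mono) auto
    finally show "N (x + s *\<^sub>R (A *v x)) \<le> (1 - (1 - \<rho>) / \<epsilon> * s) * N x"
      by (simp add: algebra_simps diff_divide_distrib)
  qed (use \<epsilon> \<rho> in \<open>auto simp: matrix_vector_right_distrib matrix_vector_mult_scaleR\<close>)
  then show thesis by (rule that)
qed

text \<open>If \<open>T x = 0\<close>, a step of size \<open>s0\<close> fixes \<open>x\<close> and
  yet shrinks its norm. This is the source of the invertibility of \<open>Dh\<close>.\<close>

lemma (in contracting) T_eq_0_imp: "T x = 0 \<Longrightarrow> x = 0"
  using contract[of s0 x] \<beta> s0 N_nonneg[of x] mult_pos_pos[OF \<beta> s0]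
  by (cases "x = 0") (auto simp: algebra_simps mult_le_0_iff dest!: order_antisym)

section \<open>Slowly varying step sizes and the pathwise recursion\<close>

text \<open>Since \<open>b\<close> is positive, the finitely many exceptional indices only enlarge
  the constant; \<open>S\<close> adds up their ratios. Applied path by path, this is how random
  thresholds turn into random constants.\<close>

lemma eventually_le_imp_all_le:
  fixes a b :: "nat \<Rightarrow> real"
  assumes "\<And>n. b n > 0" "eventually (\<lambda>n. a n \<le> K * b n) sequentially"
  obtains K' where "K' > 0" "\<And>n. a n \<le> K' * b n"
proof -
  from assms(2) obtain n0 where n0: "\<And>n. n \<ge> n0 \<Longrightarrow> a n \<le> K * b n"
    by (auto simp: eventually_sequentially)
  define S where "S = (\<Sum>k<n0. \<bar>a k\<bar> / b k)"
  have S: "S \<ge> 0" unfolding S_def using assms(1) by (intro sum_nonneg) (simp add: less_imp_le)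
  show thesis
  proof (rule that[of "\<bar>K\<bar> + S + 1"])
    show "\<bar>K\<bar> + S + 1 > 0" using S by linarith
    show "a n \<le> (\<bar>K\<bar> + S + 1) * b n" for n
    proof (cases "n \<ge> n0")
      case True
      have "a n \<le> K * b n" by (rule n0[OF True])
      also have "\<dots> \<le> (\<bar>K\<bar> + S + 1) * b n"
        using S assms(1)[of n] by (intro mult_right_mono) auto
      finally show ?thesis .
    next
      case False
      have "\<bar>a n\<bar> / b n \<le> S"
        unfolding S_def using False assms(1)
        by (intro member_le_sum) (auto simp: less_imp_le)
      then have "a n \<le> S * b n"
        using assms(1)[of n] by (simp add: divide_le_eq)
      also have "\<dots> \<le> (\<bar>K\<bar> + S + 1) * b n"
        using S assms(1)[of n] by (intro mult_right_mono) auto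
      finally show ?thesis .
    qed
  qed
qed

text \<open>The last assumption is the logarithmic condition freed of the logarithm: the increment
  of \<open>g\<close> is \<open>o((g n)^2)\<close>. In this form the change of the scale
  \<open>g\<close> over one step can be set against the loss \<open>\<beta> * g n * g n\<close>
  caused by the contraction.\<close>

locale step_sizes =
  fixes g :: "nat \<Rightarrow> real"
  assumes g_pos: "\<And>n. g n > 0"
    and g_lim: "g \<longlonglongrightarrow> 0"
    and g_slow: "\<And>\<delta>. \<delta> > 0 \<Longrightarrow> eventually (\<lambda>n. \<bar>g n - g (Suc n)\<bar> \<le> \<delta> * (g n)\<^sup>2) sequentially"
begin

lemma g_nonneg: "0 \<le> g n"
  using g_pos[of n] by simp

lemma g_eventually_le: "\<delta> > 0 \<Longrightarrow> eventually (\<lambda>n. g n \<le> \<delta>) sequentially"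
  using order_tendstoD(2)[OF g_lim, of \<delta>] by (rule eventually_mono) auto

lemma g_diff_le: obtains c where "c > 0" "\<And>n. \<bar>g n - g (Suc n)\<bar> \<le> c * (g n)\<^sup>2"
proof -
  have "eventually (\<lambda>n. \<bar>g n - g (Suc n)\<bar> \<le> 1 * (g n)\<^sup>2) sequentially" by (rule g_slow) simp
  then show thesis
    by (rule eventually_le_imp_all_le[rotated]) (use that in \<open>auto simp: g_pos less_imp_neq[OF g_pos, symmetric]\<close>)
qed

lemma g_Suc_le: obtains c where "c > 0" "\<And>n. g (Suc n) \<le> c * g n"
proof -
  have "eventually (\<lambda>n. g (Suc n) \<le> 2 * g n) sequentially"
    using g_slow[OF zero_less_one] g_eventually_le[OF zero_less_one]
  proof eventually_elim
    case (elim n)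
    have "(g n)\<^sup>2 \<le> g n"
      using elim(2) g_pos[of n] by (simp add: power2_eq_square mult_left_le)
    then show ?case using elim by linarith
  qed
  then show thesis by (rule eventually_le_imp_all_le[OF g_pos]) (rule that)
qed

text \<open>The slow variation of the step sizes makes a multiple of \<open>g\<close> a supersolution of the recursion.\<close>

lemma recursion_bound:
  assumes "\<beta> > 0" "eventually (\<lambda>n. a (Suc n) \<le> (1 - \<beta> * g n) * a n + C * (g n)\<^sup>2) sequentially"
  obtains K where "K > 0" "\<And>n. a n \<le> K * g n"
proof -
  have "eventually (\<lambda>n. g n \<le> 1 / \<beta>) sequentially"
    using assms by (intro g_eventually_le) simp
  \<comment> \<open>Half of the contraction pays for the input \<open>C\<close>, the other half for
    the decrease of \<open>g\<close>; hence slow variation with \<open>\<beta> / 2\<close>.\<close>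
  with assms(2) g_slow[of "\<beta> / 2"] \<open>\<beta> > 0\<close>
  have "eventually (\<lambda>n. a (Suc n) \<le> (1 - \<beta> * g n) * a n + C * (g n)\<^sup>2 \<and> g n \<le> 1 / \<beta>
      \<and> \<bar>g n - g (Suc n)\<bar> \<le> \<beta> / 2 * (g n)\<^sup>2) sequentially"
    by (simp add: eventually_conj_iff)
  then obtain n0 where n0: "\<And>n. n \<ge> n0 \<Longrightarrow> a (Suc n) \<le> (1 - \<beta> * g n) * a n + C * (g n)\<^sup>2"
    "\<And>n. n \<ge> n0 \<Longrightarrow> g n \<le> 1 / \<beta>" "\<And>n. n \<ge> n0 \<Longrightarrow> \<bar>g n - g (Suc n)\<bar> \<le> \<beta> / 2 * (g n)\<^sup>2"
    by (auto simp: eventually_sequentially)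
  \<comment> \<open>The three entries serve the start of the induction at \<open>n0\<close>, the
    estimate \<open>C \<le> K * \<beta> / 2\<close>, and the sign needed for multiplying
    inequalities by \<open>K\<close>.\<close>
  define K where "K = max (a n0 / g n0) (max (2 * C / \<beta>) 0)"
  have K: "a n0 \<le> K * g n0" "2 * C / \<beta> \<le> K" "K \<ge> 0"
    unfolding K_def using g_pos[of n0] by (simp_all flip: pos_divide_le_eq)
  have "a n \<le> K * g n" if "n \<ge> n0" for n
    using that
  proof (induction n rule: dec_induct)
    case (step n)
    have 1: "1 - \<beta> * g n \<ge> 0" using n0(2)[of n] step assms(1) by (simp add: field_simps)
    have "a (Suc n) \<le> (1 - \<beta> * g n) * (K * g n) + C * (g n)\<^sup>2"
      using n0(1)[of n] step mult_left_mono[OF step.IH 1] by linarith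
    also have "\<dots> \<le> (1 - \<beta> * g n) * (K * g n) + K * \<beta> / 2 * (g n)\<^sup>2"
      using K(2) assms(1) by (intro add_left_mono mult_right_mono) (auto simp: field_simps)
    also have "\<dots> = K * (g n - \<beta> / 2 * (g n)\<^sup>2)"
      by (simp add: algebra_simps power2_eq_square)
    also have "\<dots> \<le> K * g (Suc n)"
      using abs_le_D1[OF n0(3)[OF step.hyps(1)]] K(3) by (intro mult_left_mono) linarith+
    finally show ?case .
  qed (use K in auto)
  then have "eventually (\<lambda>n. a n \<le> K * g n) sequentially"
    by (auto simp: eventually_sequentially)
  then show thesis by (rule eventually_le_imp_all_le[OF g_pos]) (rule that)
qed

end

text \<open>With \<open>u = ln (g n / g (Suc n))\<close> the increment of \<open>g\<close> is
  \<open>exp u - 1\<close> times \<open>g (Suc n)\<close>, up to sign, and the hypothesis makes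
  \<open>u\<close> small compared with \<open>g (Suc n)\<close>.\<close>

lemma step_sizesI:
  fixes g :: "nat \<Rightarrow> real"
  assumes pos: "\<And>n. g n > 0" and sq: "summable (\<lambda>n. (g n)\<^sup>2)"
    and ln: "(\<lambda>k. ln (g k / g (Suc k)) / g (Suc k)) \<longlonglongrightarrow> 0"
  shows "step_sizes g"
proof
  have "(\<lambda>n. sqrt ((g n)\<^sup>2)) \<longlonglongrightarrow> sqrt 0"
    by (intro tendsto_real_sqrt summable_LIMSEQ_zero sq)
  then show lim: "g \<longlonglongrightarrow> 0" using pos by (simp add: less_imp_le)
  fix \<delta> :: real assume \<delta>: "\<delta> > 0"
  \<comment> \<open>The \<open>8\<close> is the \<open>2\<close> from
    \<open>\<bar>exp u - 1\<bar> \<le> 2 * \<bar>u\<bar>\<close> times the \<open>4\<close> from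
    squaring \<open>g (Suc n) \<le> 2 * g n\<close>; the cap \<open>1 / 2\<close> keeps
    \<open>u\<close> in the range where both are valid.\<close>
  define \<eta> where "\<eta> = min (\<delta> / 8) (1 / 2)"
  have \<eta>: "\<eta> > 0" "\<eta> \<le> 1/2" "8 * \<eta> \<le> \<delta>" using \<delta> by (auto simp: \<eta>_def)
  have "eventually (\<lambda>n. \<bar>ln (g n / g (Suc n)) / g (Suc n)\<bar> < \<eta>) sequentially"
    using tendstoD[OF ln \<eta>(1)] by (simp add: dist_real_def)
  moreover have "eventually (\<lambda>n. g (Suc n) < 1) sequentially"
    using order_tendstoD(2)[OF LIMSEQ_Suc[OF lim], of 1] by simp
  ultimately show "eventually (\<lambda>n. \<bar>g n - g (Suc n)\<bar> \<le> \<delta> * (g n)\<^sup>2) sequentially"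
  proof eventually_elim
    case (elim n)
    define u where "u = ln (g n / g (Suc n))"
    have g: "g n > 0" "g (Suc n) > 0" using pos by auto
    have u: "\<bar>u\<bar> \<le> \<eta> * g (Suc n)" using elim(1) g by (simp add: u_def abs_divide field_simps)
    have "\<eta> * g (Suc n) \<le> \<eta> * 1" using elim(2) \<eta> by (intro mult_left_mono) auto
    then have u1: "\<bar>u\<bar> \<le> 1/2" using u \<eta> by linarith
    have q: "g n = exp u * g (Suc n)" using g by (simp add: u_def)
    have e: "\<bar>exp u - 1\<bar> \<le> 2 * \<bar>u\<bar>" using exp_bound_lemma[of u, unfolded real_norm_def abs_exp_cancel] exp_ge_add_one_self[of u] u1 by linarith
    have "\<bar>g n - g (Suc n)\<bar> = \<bar>exp u - 1\<bar> * g (Suc n)"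
      using abs_mult_pos[of "g (Suc n)" "exp u - 1"] g unfolding q by (simp add: algebra_simps)
    also have "\<dots> \<le> (2 * \<eta> * g (Suc n)) * g (Suc n)"
      using e u g by (intro mult_right_mono) auto
    also have "\<dots> = 2 * \<eta> * (g (Suc n))\<^sup>2" by (simp add: power2_eq_square)
    also have "\<dots> \<le> 2 * \<eta> * (2 * g n)\<^sup>2"
    proof (intro mult_left_mono power_mono)
      have "exp u \<ge> 1 + u" by (rule exp_ge_add_one_self)
      then have "exp u \<ge> 1/2" using u1 by linarith
      then have "1/2 * g (Suc n) \<le> exp u * g (Suc n)" using g by (intro mult_right_mono) auto
      then show "g (Suc n) \<le> 2 * g n" using q by simp
    qed (use g \<eta> in auto)
    also have "\<dots> = 8 * \<eta> * (g n)\<^sup>2" by (simp add: power_mult_distrib)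
    also have "\<dots> \<le> \<delta> * (g n)\<^sup>2" using \<eta> by (intro mult_right_mono) auto
    finally show ?case .
  qed
qed (rule pos)

section \<open>Pathwise comparison of the iterates with a linear recursion\<close>

locale sa_recursion = contracting Q T \<beta> s0 + step_sizes g
  for Q :: "'a::euclidean_space \<Rightarrow> 'a \<Rightarrow> real" and T \<beta> s0 g
begin

text \<open>
  Only the partial sums \<open>S\<close> of \<open>r2\<close> are controlled, so \<open>g n *\<^sub>R S n\<close> is subtracted from \<open>x n - mu n\<close>. The
  initial value of the recursion needs no separate treatment: \<open>H\<close> is positive from index \<open>1\<close> on,
  hence dominates it up to a constant.
\<close>

lemma path_bound:
  fixes x mu e e' r1 r2 R :: "nat \<Rightarrow> 'a" and G H :: "nat \<Rightarrow> real"
  assumes x_rec: "\<And>n. x (Suc n) = x n + g n *\<^sub>R (T (x n) + R n + e n + r1 n + r2 n)"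
    and mu_rec: "\<And>n. mu (Suc n) = mu n + g n *\<^sub>R T (mu n) + g n *\<^sub>R e' n"
    and e: "eventually (\<lambda>n. e n = e' n) sequentially"
    and R: "\<And>\<eta>. \<eta> > 0 \<Longrightarrow> eventually (\<lambda>n. norm (R n) \<le> \<eta> * norm (x n)) sequentially"
    and r1: "\<And>n. norm (r1 n) \<le> B * (sqrt (g n) * G n)"
    and r2: "\<And>n. sqrt (g n) * norm (\<Sum>k\<le>n. r2 k) \<le> B * G n"
            "\<And>n. sqrt (g n) * norm (\<Sum>k\<le>n. r2 k) \<le> B * G (Suc n)"
    and G: "\<And>n. G n \<ge> 1" and mu: "\<And>n. N (mu n) \<le> sqrt (g n) * G n"
    and H: "H 0 = 0" "\<And>n. H (Suc n) = max 0 (1 - \<beta> / 2 * g n) * H n + g n * (sqrt (g n) * G n)"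
  obtains C where "\<And>n. norm (x n) \<le> C * (H n + sqrt (g n) * G n)"
proof -
  \<comment> \<open>The range stops before \<open>n\<close>, so that the increment of
    \<open>S\<close> at step \<open>n\<close> is exactly the \<open>r2 n\<close> that has to be
    cancelled.\<close>
  define S where "S n = (\<Sum>k<n. r2 k)" for n
  define y where "y n = x n - mu n - g n *\<^sub>R S n" for n
  define w where "w n = sqrt (g n) * G n" for n
  have w: "w n > 0" for n using g_pos[of n] G[of n] by (simp add: w_def)
  have B: "B \<ge> 0"
    using r1[of 0] w[of 0] norm_ge_zero[of "r1 0"] unfolding w_def by (meson order_trans zero_le_mult_iff not_less)
  obtain c where c: "c > 0" "\<And>n. g (Suc n) \<le> c * g n" using g_Suc_le by blast
  obtain d where d: "d > 0" "\<And>n. \<bar>g n - g (Suc n)\<bar> \<le> d * (g n)\<^sup>2" using g_diff_le by blast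
  obtain K where K: "K > 0" "\<And>v. N v \<le> K * norm v" using N_le by blast
  obtain KT where KT: "KT > 0" "\<And>v. norm (T v) \<le> norm v * KT"
    using linear_T bounded_linear.pos_bounded linear_conv_bounded_linear by blast
  have S1: "g n * norm (S (Suc n)) \<le> B * w n" for n
  proof -
    have "g n * norm (S (Suc n)) = sqrt (g n) * (sqrt (g n) * norm (\<Sum>k\<le>n. r2 k))"
      using g_pos[of n] by (simp add: S_def lessThan_Suc_atMost flip: mult.assoc)
    also have "\<dots> \<le> sqrt (g n) * (B * G n)"
      using g_pos[of n] r2(1) by (intro mult_left_mono) auto
    finally show ?thesis by (simp add: w_def mult_ac)
  qed
  define c1 where "c1 = sqrt c * B"
  have c1: "c1 \<ge> 0" using c B by (simp add: c1_def)
  \<comment> \<open>\<open>S n\<close> is the partial sum up to \<open>n - 1\<close>, so its bound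
    must be carried to the later index: \<open>G\<close> is taken at \<open>n\<close> by the second
    assumption on \<open>r2\<close>, and the step size moves by
    \<open>g n \<le> c * g (n - 1)\<close>.\<close>
  have S2: "g n * norm (S n) \<le> c1 * w n" for n
  proof (cases n)
    case 0
    then show ?thesis using c1 w[of 0] by (simp add: S_def)
  next
    case (Suc m)
    have "g n * norm (S n) = sqrt (g n) * (sqrt (g n) * norm (S n))"
      using g_pos[of n] by (simp flip: mult.assoc)
    also have "\<dots> \<le> sqrt (g n) * ((sqrt c * sqrt (g m)) * norm (S n))"
      using c(2)[of m] g_pos[of n] by (intro mult_left_mono mult_right_mono) (auto simp: Suc real_sqrt_mult[symmetric])
    also have "\<dots> = sqrt (g n) * (sqrt c * (sqrt (g m) * norm (\<Sum>k\<le>m. r2 k)))"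
      by (simp add: Suc S_def lessThan_Suc_atMost)
    also have "\<dots> \<le> sqrt (g n) * (sqrt c * (B * G n))"
      using r2(2)[of m] c g_pos[of n] by (intro mult_left_mono) (auto simp: Suc)
    finally show ?thesis by (simp add: c1_def w_def mult_ac)
  qed
  have x_le: "norm (x n) \<le> N (y n) + (1 + c1) * w n" for n
  proof -
    have "x n = y n + mu n + g n *\<^sub>R S n" by (simp add: y_def)
    then have "norm (x n) \<le> norm (y n) + norm (mu n) + norm (g n *\<^sub>R S n)"
      by (metis norm_triangle_ineq norm_triangle_le add_right_mono order_trans)
    moreover have "norm (g n *\<^sub>R S n) \<le> c1 * w n" using S2[of n] g_pos[of n] by simp
    moreover have "norm (mu n) \<le> w n" using norm_le_N mu[of n] order_trans unfolding w_def by blast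
    moreover have "norm (y n) \<le> N (y n)" by (rule norm_le_N)
    ultimately show ?thesis by (simp add: algebra_simps)
  qed
  \<comment> \<open>After the cancellation \<open>r2\<close> survives only in the last two terms.
    Both are of order \<open>g n * w n\<close>: one carries an additional factor \<open>g n\<close>,
    the other the increment of \<open>g\<close>, which is at most
    \<open>d * (g n)\<^sup>2\<close>.\<close>
  have y_rec: "y (Suc n) = (y n + g n *\<^sub>R T (y n)) + (g n *\<^sub>R R n + (g n *\<^sub>R (e n - e' n) + (g n *\<^sub>R r1 n
      + ((g n * g n) *\<^sub>R T (S n) + (g n - g (Suc n)) *\<^sub>R S (Suc n)))))" for n
  proof -
    have S: "S (Suc n) = S n + r2 n" by (simp add: S_def)
    show ?thesis
      unfolding y_def x_rec mu_rec S linear_diff[OF linear_T] linear_cmul[OF linear_T]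
      by (simp add: algebra_simps)
  qed
  define C where "C = \<beta> / 2 * (1 + c1) + K * B + K * KT * c1 + K * d * B"
  have C0: "C \<ge> 0" using \<beta> c1 B K KT d by (simp add: C_def)
  \<comment> \<open>At this level the nonlinear remainder, measured in \<open>N\<close>, consumes
    half of the contraction; what is left is the rate \<open>\<beta> / 2\<close> in the recursion
    for \<open>H\<close>.\<close>
  have "\<beta> / (2 * K) > 0" using \<beta> K by simp
  from R[OF this] e g_eventually_le[OF s0]
  have "eventually (\<lambda>n. N (y (Suc n)) \<le> (1 - \<beta> / 2 * g n) * N (y n) + C * (g n * w n)) sequentially"
  proof eventually_elim
    case (elim n)
    have g: "g n > 0" by (rule g_pos)
    have "N (y (Suc n)) \<le> N (y n + g n *\<^sub>R T (y n)) + (N (g n *\<^sub>R R n) + (0 + (N (g n *\<^sub>R r1 n)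
      + (N ((g n * g n) *\<^sub>R T (S n)) + N ((g n - g (Suc n)) *\<^sub>R S (Suc n))))))"
      unfolding y_rec elim(2) by (intro order_trans[OF N_triangle] add_mono order_refl) auto
    also have "N (y n + g n *\<^sub>R T (y n)) \<le> (1 - \<beta> * g n) * N (y n)"
      using elim(3) g by (intro contract) auto
    also have "N (g n *\<^sub>R R n) \<le> g n * (\<beta> / 2 * N (y n)) + \<beta> / 2 * (1 + c1) * (g n * w n)"
    proof -
      have "N (R n) \<le> K * (\<beta> / (2 * K) * norm (x n))"
        using K(2)[of "R n"] mult_left_mono[OF elim(1), of K] K(1) by linarith
      also have "\<dots> = \<beta> / 2 * norm (x n)" using K(1) by simp
      also have "\<dots> \<le> \<beta> / 2 * (N (y n) + (1 + c1) * w n)"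
        using x_le[of n] \<beta> by (intro mult_left_mono) auto
      finally have "g n * N (R n) \<le> g n * (\<beta> / 2 * (N (y n) + (1 + c1) * w n))"
        using g by (intro mult_left_mono) auto
      then show ?thesis using g by (simp add: N_scaleR algebra_simps add_divide_distrib)
    qed
    also have "N (g n *\<^sub>R r1 n) \<le> K * B * (g n * w n)"
    proof -
      have "N (r1 n) \<le> K * (B * w n)"
        using K(2)[of "r1 n"] mult_left_mono[OF r1[of n], of K] K(1) unfolding w_def by linarith
      then have "g n * N (r1 n) \<le> g n * (K * (B * w n))" using g by (intro mult_left_mono) auto
      then show ?thesis using g by (simp add: N_scaleR mult_ac)
    qed
    also have "N ((g n * g n) *\<^sub>R T (S n)) \<le> K * KT * c1 * (g n * w n)"
    proof -
      have "N (T (S n)) \<le> K * (norm (S n) * KT)"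
        using K(2)[of "T (S n)"] mult_left_mono[OF KT(2)[of "S n"], of K] K(1) by linarith
      then have "(g n * g n) * N (T (S n)) \<le> (g n * g n) * (K * (norm (S n) * KT))"
        using g by (intro mult_left_mono) auto
      also have "\<dots> = (g n * K * KT) * (g n * norm (S n))" by (simp add: mult_ac)
      also have "\<dots> \<le> (g n * K * KT) * (c1 * w n)"
        using S2[of n] g K(1) KT(1) by (intro mult_left_mono) auto
      finally show ?thesis using g by (simp add: N_scaleR mult_ac)
    qed
    also have "N ((g n - g (Suc n)) *\<^sub>R S (Suc n)) \<le> K * d * B * (g n * w n)"
    proof -
      have "\<bar>g n - g (Suc n)\<bar> * N (S (Suc n)) \<le> (d * (g n)\<^sup>2) * (K * norm (S (Suc n)))"
        using d K by (intro mult_mono) auto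
      also have "\<dots> = (d * g n * K) * (g n * norm (S (Suc n)))" by (simp add: mult_ac power2_eq_square)
      also have "\<dots> \<le> (d * g n * K) * (B * w n)"
        using S1[of n] g K(1) d(1) by (intro mult_left_mono) auto
      finally show ?thesis by (simp add: N_scaleR mult_ac)
    qed
    finally show ?case by (simp add: C_def algebra_simps)
  qed
  then obtain n0 where n0: "\<And>n. n \<ge> n0 \<Longrightarrow> N (y (Suc n)) \<le> (1 - \<beta> / 2 * g n) * N (y n) + C * (g n * w n)"
    by (auto simp: eventually_sequentially)
  have H_nonneg: "H n \<ge> 0" for n
    by (induction n) (use w g_pos in \<open>auto simp: H less_imp_le simp flip: w_def intro!: add_nonneg_nonneg mult_nonneg_nonneg\<close>)
  have H_pos: "H (Suc n) > 0" for n
    using H_nonneg[of n] w[of n] g_pos[of n] unfolding H w_def[symmetric] by (intro add_nonneg_pos) auto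
  \<comment> \<open>The comparison starts at \<open>Suc n0\<close> because \<open>H\<close> vanishes
    at index \<open>0\<close>; \<open>C \<le> C'\<close> lets the induction absorb the
    inputs.\<close>
  define C' where "C' = max C (N (y (Suc n0)) / H (Suc n0))"
  have C': "C' \<ge> C" "C' \<ge> 0" "N (y (Suc n0)) \<le> C' * H (Suc n0)"
    using C0 H_pos[of n0] by (auto simp: C'_def max_def field_simps)
  have y_le: "N (y n) \<le> C' * H n" if "n \<ge> Suc n0" for n
    using that
  proof (induction n rule: dec_induct)
    case (step n)
    have "N (y (Suc n)) \<le> (1 - \<beta> / 2 * g n) * N (y n) + C * (g n * w n)" using n0[of n] step by simp
    also have "\<dots> \<le> max 0 (1 - \<beta> / 2 * g n) * (C' * H n) + C' * (g n * w n)"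
    proof (rule add_mono)
      have "(1 - \<beta> / 2 * g n) * N (y n) \<le> max 0 (1 - \<beta> / 2 * g n) * N (y n)"
        by (intro mult_right_mono) auto
      also have "\<dots> \<le> max 0 (1 - \<beta> / 2 * g n) * (C' * H n)"
        using step.IH by (intro mult_left_mono) auto
      finally show "(1 - \<beta> / 2 * g n) * N (y n) \<le> max 0 (1 - \<beta> / 2 * g n) * (C' * H n)" .
      show "C * (g n * w n) \<le> C' * (g n * w n)"
        using C' w[of n] g_pos[of n] by (intro mult_right_mono) auto
    qed
    also have "\<dots> = C' * H (Suc n)" by (simp add: H w_def algebra_simps)
    finally show ?case .
  qed (use C' in auto)
  have "eventually (\<lambda>n. norm (x n) \<le> (C' + 1 + c1) * (H n + w n)) sequentially"
    using eventually_ge_at_top[of "Suc n0"]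
  proof eventually_elim
    case (elim n)
    have "norm (x n) \<le> C' * H n + (1 + c1) * w n" using x_le[of n] y_le[OF elim] by linarith
    also have "\<dots> \<le> C' * H n + (1 + c1) * w n + (C' * w n + (1 + c1) * H n)"
      using C' c1 w[of n] H_nonneg[of n] by (simp add: less_imp_le)
    finally show ?case by (simp add: algebra_simps)
  qed
  moreover have "H n + w n > 0" for n using H_nonneg[of n] w[of n] by linarith
  ultimately obtain C'' where "\<And>n. norm (x n) \<le> C'' * (H n + w n)"
    using eventually_le_imp_all_le[of "\<lambda>n. H n + w n" "\<lambda>n. norm (x n)"] by blast
  then show thesis by (intro that[of C'']) (simp add: w_def)
qed

end

section \<open>Second moments\<close>

text \<open>A real-valued variant of \<open>O_L2\<close> for the Bochner integral, with
  measurability and integrability included, so that second moments can be added and compared as real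
  numbers.\<close>

definition L2_bounded :: "'a measure \<Rightarrow> (nat \<Rightarrow> 'a \<Rightarrow> real) \<Rightarrow> bool" where
  "L2_bounded M X \<longleftrightarrow> (\<forall>n. X n \<in> borel_measurable M) \<and>
     (\<exists>C. \<forall>n. integrable M (\<lambda>\<omega>. (X n \<omega>)\<^sup>2) \<and> (\<integral>\<omega>. (X n \<omega>)\<^sup>2 \<partial>M) \<le> C)"

lemma L2_boundedI:
  assumes "\<And>n. X n \<in> borel_measurable M" "\<And>n. integrable M (\<lambda>\<omega>. (X n \<omega>)\<^sup>2)"
    "\<And>n. (\<integral>\<omega>. (X n \<omega>)\<^sup>2 \<partial>M) \<le> C"
  shows "L2_bounded M X"
  using assms unfolding L2_bounded_def by blast

lemma L2_boundedE:
  assumes "L2_bounded M X"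
  obtains C where "\<And>n. X n \<in> borel_measurable M" "\<And>n. integrable M (\<lambda>\<omega>. (X n \<omega>)\<^sup>2)"
    "\<And>n. (\<integral>\<omega>. (X n \<omega>)\<^sup>2 \<partial>M) \<le> C"
  using assms unfolding L2_bounded_def by blast

lemma L2_bounded_of_nn_integral:
  assumes "\<And>n. X n \<in> borel_measurable M" "\<And>n. (\<integral>\<^sup>+ \<omega>. ennreal ((X n \<omega>)\<^sup>2) \<partial>M) \<le> ennreal C"
  shows "L2_bounded M X"
proof (rule L2_boundedI)
  show int: "integrable M (\<lambda>\<omega>. (X n \<omega>)\<^sup>2)" for n
    using assms(1)[of n] le_less_trans[OF assms(2)[of n] ennreal_less_top]
    by (intro integrableI_bounded) auto
  \<comment> \<open>\<open>ennreal C\<close> is \<open>0\<close> for negative \<open>C\<close>,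
    hence the maximum.\<close>
  show "(\<integral>\<omega>. (X n \<omega>)\<^sup>2 \<partial>M) \<le> max C 0" for n
  proof -
    have "ennreal (\<integral>\<omega>. (X n \<omega>)\<^sup>2 \<partial>M) \<le> ennreal C"
      using assms(2)[of n] nn_integral_eq_integral[OF int[of n]] by simp
    also have "\<dots> \<le> ennreal (max C 0)" by (rule ennreal_leI) simp
    finally show ?thesis using ennreal_le_iff[of "max C 0"] by simp
  qed
qed (rule assms)

lemma L2_bounded_reindex: "L2_bounded M X \<Longrightarrow> L2_bounded M (\<lambda>n. X (f n))"
  unfolding L2_bounded_def by blast

lemma L2_bounded_add:
  assumes "L2_bounded M X" "L2_bounded M Y"
  shows "L2_bounded M (\<lambda>n \<omega>. X n \<omega> + Y n \<omega>)"
proof -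
  obtain C where X: "\<And>n. X n \<in> borel_measurable M" "\<And>n. integrable M (\<lambda>\<omega>. (X n \<omega>)\<^sup>2)"
    "\<And>n. (\<integral>\<omega>. (X n \<omega>)\<^sup>2 \<partial>M) \<le> C" using L2_boundedE[OF assms(1)] by blast
  obtain C' where Y: "\<And>n. Y n \<in> borel_measurable M" "\<And>n. integrable M (\<lambda>\<omega>. (Y n \<omega>)\<^sup>2)"
    "\<And>n. (\<integral>\<omega>. (Y n \<omega>)\<^sup>2 \<partial>M) \<le> C'" using L2_boundedE[OF assms(2)] by blast
  have le: "(X n \<omega> + Y n \<omega>)\<^sup>2 \<le> 2 * (X n \<omega>)\<^sup>2 + 2 * (Y n \<omega>)\<^sup>2" for n \<omega>
    using sum_squares_bound[of "X n \<omega>" "Y n \<omega>"] by (simp add: power2_sum)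
  have int2: "integrable M (\<lambda>\<omega>. 2 * (X n \<omega>)\<^sup>2 + 2 * (Y n \<omega>)\<^sup>2)" for n
    using X Y by simp
  have int: "integrable M (\<lambda>\<omega>. (X n \<omega> + Y n \<omega>)\<^sup>2)" for n
    by (rule Bochner_Integration.integrable_bound[OF int2[of n]]) (use X Y le in auto)
  show ?thesis
  proof (rule L2_boundedI[OF _ int])
    show "(\<integral>\<omega>. (X n \<omega> + Y n \<omega>)\<^sup>2 \<partial>M) \<le> 2 * C + 2 * C'" for n
    proof -
      have "(\<integral>\<omega>. (X n \<omega> + Y n \<omega>)\<^sup>2 \<partial>M) \<le> (\<integral>\<omega>. 2 * (X n \<omega>)\<^sup>2 + 2 * (Y n \<omega>)\<^sup>2 \<partial>M)"
        by (rule integral_mono[OF int int2 le])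
      then show ?thesis using X(2,3)[of n] Y(2,3)[of n] by simp
    qed
  qed (use X Y in auto)
qed

lemma (in prob_space) L2_bounded_const: "L2_bounded M (\<lambda>n \<omega>. c)"
  by (rule L2_boundedI[where C = "c\<^sup>2"]) (auto simp: prob_space)

section \<open>Second moments of the linear recursion and of the scalar majorant\<close>

context sa_recursion
begin

lemma T_measurable [measurable]: "T \<in> borel_measurable borel"
  using linear_T linear_continuous_on linear_conv_bounded_linear
  by (intro borel_measurable_continuous_onI) blast

lemma N_measurable [measurable]: "N \<in> borel_measurable borel"
proof (rule borel_measurable_continuous_onI)
  show "continuous_on UNIV N"
    unfolding N_def by (intro continuous_intros continuous_on)
qed

lemma form_measurable:
  assumes [measurable]: "X \<in> borel_measurable M" "Y \<in> borel_measurable M"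
  shows "(\<lambda>\<omega>. Q (X \<omega>) (Y \<omega>)) \<in> borel_measurable M"
proof -
  have "(\<lambda>\<omega>. (\<lambda>p. Q (fst p) (snd p)) (X \<omega>, Y \<omega>)) \<in> borel_measurable M"
    by (rule measurable_compose[where N = borel])
       (auto intro!: borel_measurable_continuous_onI continuous_on continuous_intros)
  then show ?thesis by simp
qed

text \<open>The predictable part \<open>w n\<close> is known at time \<open>n\<close> and the noise
  is orthogonal to everything known then, so the squared \<open>N\<close>-norm splits without a
  cross term. The first part contracts, the second is at most a constant times
  \<open>(g n)\<^sup>2\<close>, and \<open>recursion_bound\<close> turns this into a second moment
  of order \<open>g n\<close>.\<close>

lemma linear_noise_second_moment:
  fixes M :: "'b measure" and F :: "nat \<Rightarrow> 'b measure" and mu e :: "nat \<Rightarrow> 'b \<Rightarrow> 'a"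
  assumes mu: "\<And>\<omega>. mu 0 \<omega> = 0" "\<And>n \<omega>. mu (Suc n) \<omega> = mu n \<omega> + g n *\<^sub>R T (mu n \<omega>) + g n *\<^sub>R e n \<omega>"
    and sub: "\<And>n. subalgebra M (F n)" "\<And>n. subalgebra (F (Suc n)) (F n)"
    and e_meas: "\<And>n. e n \<in> borel_measurable (F (Suc n))"
    and e_int: "\<And>n. integrable M (\<lambda>\<omega>. (norm (e n \<omega>))\<^sup>2)" "\<And>n. (\<integral>\<omega>. (norm (e n \<omega>))\<^sup>2 \<partial>M) \<le> C"
    and mart: "\<And>n f b. b \<in> Basis \<Longrightarrow> f \<in> borel_measurable (F n) \<Longrightarrow> integrable M (\<lambda>\<omega>. f \<omega> * (e n \<omega> \<bullet> b))
        \<Longrightarrow> (\<integral>\<omega>. f \<omega> * (e n \<omega> \<bullet> b) \<partial>M) = 0"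
  shows "L2_bounded M (\<lambda>n \<omega>. N (mu n \<omega>) / sqrt (g n))" "\<And>n. mu n \<in> borel_measurable M"
proof -
  have F_meas: "mu n \<in> borel_measurable (F n)" for n
  proof (induction n)
    case (Suc n)
    have [measurable]: "mu n \<in> borel_measurable (F (Suc n))" "e n \<in> borel_measurable (F (Suc n))"
      using measurable_from_subalg[OF sub(2) Suc] e_meas by auto
    show ?case unfolding mu(2) by measurable
  qed (simp add: mu)
  show meas[measurable]: "mu n \<in> borel_measurable M" for n
    by (rule measurable_from_subalg[OF sub(1) F_meas])
  have e_M[measurable]: "e n \<in> borel_measurable M" for n
    by (rule measurable_from_subalg[OF sub(1) e_meas])
  obtain K where K: "K > 0" "\<And>v. N v \<le> K * norm v" using N_le by blast
  obtain KQ where KQ: "KQ > 0" "\<And>x y. norm (Q x y) \<le> norm x * norm y * KQ"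
    using pos_bounded by blast
  obtain KT where KT: "KT > 0" "\<And>v. norm (T v) \<le> norm v * KT"
    using linear_T bounded_linear.pos_bounded linear_conv_bounded_linear by blast
  define w where "w n \<omega> = mu n \<omega> + g n *\<^sub>R T (mu n \<omega>)" for n \<omega>
  have w_F: "w n \<in> borel_measurable (F n)" for n
    unfolding w_def using F_meas[of n] by measurable
  have w_M[measurable]: "w n \<in> borel_measurable M" for n
    unfolding w_def by measurable
  have Ne: "(N (e n \<omega>))\<^sup>2 \<le> K\<^sup>2 * (norm (e n \<omega>))\<^sup>2" for n \<omega>
    using power_mono[OF K(2)[of "e n \<omega>"] N_nonneg, of 2] by (simp add: power_mult_distrib)
  have Ne_int: "integrable M (\<lambda>\<omega>. (N (e n \<omega>))\<^sup>2)" for n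
    by (rule Bochner_Integration.integrable_bound[OF integrable_mult_right[OF e_int(1)[of n], of "K\<^sup>2"]]) (auto intro: Ne)
  have Ne_le: "(\<integral>\<omega>. (N (e n \<omega>))\<^sup>2 \<partial>M) \<le> K\<^sup>2 * C" for n
  proof -
    have "(\<integral>\<omega>. (N (e n \<omega>))\<^sup>2 \<partial>M) \<le> (\<integral>\<omega>. K\<^sup>2 * (norm (e n \<omega>))\<^sup>2 \<partial>M)"
      by (intro integral_mono Ne Ne_int integrable_mult_right e_int)
    also have "\<dots> \<le> K\<^sup>2 * C" using mult_left_mono[OF e_int(2)[of n], of "K\<^sup>2"] by simp
    finally show ?thesis .
  qed
  have w_norm: "norm (w n \<omega>) \<le> (1 + g n * KT) * N (mu n \<omega>)" for n \<omega>
  proof -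
    have "norm (w n \<omega>) \<le> norm (mu n \<omega>) + norm (g n *\<^sub>R T (mu n \<omega>))"
      unfolding w_def by (rule norm_triangle_ineq)
    also have "\<dots> \<le> norm (mu n \<omega>) + g n * (norm (mu n \<omega>) * KT)"
      using KT(2) g_pos[of n] by (simp add: mult_left_mono)
    also have "\<dots> = (1 + g n * KT) * norm (mu n \<omega>)" by (simp add: algebra_simps)
    also have "\<dots> \<le> (1 + g n * KT) * N (mu n \<omega>)"
      using g_pos[of n] KT(1) norm_le_N[of "mu n \<omega>"] by (intro mult_left_mono) auto
    finally show ?thesis .
  qed
  have w_int: "integrable M (\<lambda>\<omega>. (norm (w n \<omega>))\<^sup>2)" "integrable M (\<lambda>\<omega>. (N (w n \<omega>))\<^sup>2)"
    if "integrable M (\<lambda>\<omega>. (N (mu n \<omega>))\<^sup>2)" for n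
  proof -
    show *: "integrable M (\<lambda>\<omega>. (norm (w n \<omega>))\<^sup>2)"
    proof (rule Bochner_Integration.integrable_bound[OF integrable_mult_right[OF that, of "(1 + g n * KT)\<^sup>2"]])
      have "(norm (w n \<omega>))\<^sup>2 \<le> ((1 + g n * KT) * N (mu n \<omega>))\<^sup>2" for \<omega>
        by (intro power_mono w_norm) simp
      then show "AE \<omega> in M. norm ((norm (w n \<omega>))\<^sup>2) \<le> norm ((1 + g n * KT)\<^sup>2 * (N (mu n \<omega>))\<^sup>2)"
        by (simp add: power_mult_distrib)
    qed measurable
    show "integrable M (\<lambda>\<omega>. (N (w n \<omega>))\<^sup>2)"
    proof (rule Bochner_Integration.integrable_bound[OF integrable_mult_right[OF *, of "K\<^sup>2"]])
      have "(N (w n \<omega>))\<^sup>2 \<le> (K * norm (w n \<omega>))\<^sup>2" for \<omega>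
        by (intro power_mono K) simp
      then show "AE \<omega> in M. norm ((N (w n \<omega>))\<^sup>2) \<le> norm (K\<^sup>2 * (norm (w n \<omega>))\<^sup>2)"
        by (simp add: power_mult_distrib)
    qed measurable
  qed
  have cross: "integrable M (\<lambda>\<omega>. Q (w n \<omega>) (e n \<omega>))" "(\<integral>\<omega>. Q (w n \<omega>) (e n \<omega>) \<partial>M) = 0"
    if "integrable M (\<lambda>\<omega>. (N (mu n \<omega>))\<^sup>2)" for n
  proof -
    \<comment> \<open>Orthogonality is assumed for single coordinates of the noise, so the form is
      expanded along a basis; the coefficient \<open>Q (w n \<omega>) b\<close> is the test
      function.\<close>
    have eq: "Q (w n \<omega>) (e n \<omega>) = (\<Sum>b\<in>Basis. Q (w n \<omega>) b * (e n \<omega> \<bullet> b))" for \<omega>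
    proof -
      have "Q (w n \<omega>) (\<Sum>b\<in>Basis. (e n \<omega> \<bullet> b) *\<^sub>R b) = (\<Sum>b\<in>Basis. Q (w n \<omega>) b * (e n \<omega> \<bullet> b))"
        by (simp add: sum_right scaleR_right mult.commute)
      then show ?thesis by (simp add: euclidean_representation)
    qed
    have Qb: "(\<lambda>\<omega>. Q (w n \<omega>) b) \<in> borel_measurable (F n)" for b
      by (rule form_measurable[OF w_F]) simp
    have int: "integrable M (\<lambda>\<omega>. Q (w n \<omega>) b * (e n \<omega> \<bullet> b))" if "b \<in> Basis" for b
    proof (rule Bochner_Integration.integrable_bound)
      show "integrable M (\<lambda>\<omega>. KQ * ((norm (w n \<omega>))\<^sup>2 + (norm (e n \<omega>))\<^sup>2))"
        using w_int(1)[OF \<open>integrable M (\<lambda>\<omega>. (N (mu n \<omega>))\<^sup>2)\<close>] e_int(1) by simp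
      have "norm (Q (w n \<omega>) b * (e n \<omega> \<bullet> b)) \<le> norm (KQ * ((norm (w n \<omega>))\<^sup>2 + (norm (e n \<omega>))\<^sup>2))" for \<omega>
      proof -
        have "norm (Q (w n \<omega>) b * (e n \<omega> \<bullet> b)) \<le> (norm (w n \<omega>) * KQ) * norm (e n \<omega>)"
          using KQ(2)[of "w n \<omega>" b] that KQ(1) Basis_le_norm[OF that, of "e n \<omega>"]
          unfolding norm_mult by (intro mult_mono) auto
        also have "\<dots> = KQ * (norm (w n \<omega>) * norm (e n \<omega>))" by simp
        also have "\<dots> \<le> KQ * ((norm (w n \<omega>))\<^sup>2 + (norm (e n \<omega>))\<^sup>2)"
          using KQ(1) sum_squares_bound[of "norm (w n \<omega>)" "norm (e n \<omega>)"]
            mult_nonneg_nonneg[OF norm_ge_zero[of "w n \<omega>"] norm_ge_zero[of "e n \<omega>"]]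
          by (intro mult_left_mono) linarith+
        finally show ?thesis by simp
      qed
      then show "AE \<omega> in M. norm (Q (w n \<omega>) b * (e n \<omega> \<bullet> b)) \<le> norm (KQ * ((norm (w n \<omega>))\<^sup>2 + (norm (e n \<omega>))\<^sup>2))"
        by simp
      show "(\<lambda>\<omega>. Q (w n \<omega>) b * (e n \<omega> \<bullet> b)) \<in> borel_measurable M"
        using measurable_from_subalg[OF sub(1) Qb[of b]] by measurable
    qed
    show "integrable M (\<lambda>\<omega>. Q (w n \<omega>) (e n \<omega>))" unfolding eq using int by simp
    show "(\<integral>\<omega>. Q (w n \<omega>) (e n \<omega>) \<partial>M) = 0"
      unfolding eq using int mart[OF _ Qb] by simp
  qed
  have expand: "(N (mu (Suc n) \<omega>))\<^sup>2 = (N (w n \<omega>))\<^sup>2 + 2 * g n * Q (w n \<omega>) (e n \<omega>) + (g n)\<^sup>2 * (N (e n \<omega>))\<^sup>2" for n \<omega>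
  proof -
    have "mu (Suc n) \<omega> = w n \<omega> + g n *\<^sub>R e n \<omega>" by (simp add: mu w_def)
    then show ?thesis
      by (simp add: N_power2 add_left add_right scaleR_left scaleR_right sym[of "e n \<omega>" "w n \<omega>"] power2_eq_square[of "g n"] algebra_simps)
  qed
  have mu_int: "integrable M (\<lambda>\<omega>. (N (mu n \<omega>))\<^sup>2)" for n
  proof (induction n)
    case (Suc n)
    then show ?case unfolding expand using w_int(2)[OF Suc] cross(1)[OF Suc] Ne_int by simp
  qed (simp add: mu)
  have rec: "eventually (\<lambda>n. (\<integral>\<omega>. (N (mu (Suc n) \<omega>))\<^sup>2 \<partial>M) \<le>
      (1 - \<beta> * g n) * (\<integral>\<omega>. (N (mu n \<omega>))\<^sup>2 \<partial>M) + (K\<^sup>2 * C) * (g n)\<^sup>2) sequentially"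
    using g_eventually_le[OF s0] g_eventually_le[of "1 / \<beta>", simplified, OF \<beta>]
  proof eventually_elim
    case (elim n)
    have b: "0 \<le> 1 - \<beta> * g n" "1 - \<beta> * g n \<le> 1" using elim(2) \<beta> g_pos[of n] by (auto simp: field_simps less_imp_le)
    have "(N (w n \<omega>))\<^sup>2 \<le> (1 - \<beta> * g n) * (N (mu n \<omega>))\<^sup>2" for \<omega>
    proof -
      have "(N (w n \<omega>))\<^sup>2 \<le> ((1 - \<beta> * g n) * N (mu n \<omega>))\<^sup>2"
        unfolding w_def using elim(1) g_pos[of n] by (intro power_mono contract) auto
      also have "\<dots> = (1 - \<beta> * g n) * ((1 - \<beta> * g n) * (N (mu n \<omega>))\<^sup>2)"
        by (simp add: power2_eq_square mult_ac)
      also have "\<dots> \<le> (1 - \<beta> * g n) * (1 * (N (mu n \<omega>))\<^sup>2)"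
        using b by (intro mult_left_mono mult_right_mono) auto
      finally show ?thesis by simp
    qed
    then have "(\<integral>\<omega>. (N (w n \<omega>))\<^sup>2 \<partial>M) \<le> (\<integral>\<omega>. (1 - \<beta> * g n) * (N (mu n \<omega>))\<^sup>2 \<partial>M)"
      by (intro integral_mono w_int mu_int integrable_mult_right)
    moreover have "(\<integral>\<omega>. (N (mu (Suc n) \<omega>))\<^sup>2 \<partial>M) = (\<integral>\<omega>. (N (w n \<omega>))\<^sup>2 \<partial>M) + (g n)\<^sup>2 * (\<integral>\<omega>. (N (e n \<omega>))\<^sup>2 \<partial>M)"
      unfolding expand using w_int(2)[OF mu_int, of n] cross[OF mu_int, of n] Ne_int[of n] by simp
    moreover have "(g n)\<^sup>2 * (\<integral>\<omega>. (N (e n \<omega>))\<^sup>2 \<partial>M) \<le> (g n)\<^sup>2 * (K\<^sup>2 * C)"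
      by (intro mult_left_mono Ne_le) simp
    ultimately show ?case by (simp add: mult_ac)
  qed
  obtain K' where K': "\<And>n. (\<integral>\<omega>. (N (mu n \<omega>))\<^sup>2 \<partial>M) \<le> K' * g n"
    using recursion_bound[OF \<beta> rec] by blast
  show "L2_bounded M (\<lambda>n \<omega>. N (mu n \<omega>) / sqrt (g n))"
  proof (rule L2_boundedI)
    show "(\<integral>\<omega>. (N (mu n \<omega>) / sqrt (g n))\<^sup>2 \<partial>M) \<le> K'" for n
      using K'[of n] g_pos[of n] by (simp add: power_divide field_simps)
    show "integrable M (\<lambda>\<omega>. (N (mu n \<omega>) / sqrt (g n))\<^sup>2)" for n
      using mu_int[of n] by (simp add: power_divide)
  qed measurable
qed

text \<open>Unlike the path difference that it dominates, this process starts at \<open>0\<close>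
  and knows of no random threshold, so its moments are accessible. The \<open>max 0\<close> keeps it
  nonnegative while the step sizes are still too large for contraction.\<close>

primrec majorant :: "(nat \<Rightarrow> 'b \<Rightarrow> real) \<Rightarrow> nat \<Rightarrow> 'b \<Rightarrow> real" where
  "majorant G 0 \<omega> = 0"
| "majorant G (Suc n) \<omega> = max 0 (1 - \<beta> / 2 * g n) * majorant G n \<omega> + g n * (sqrt (g n) * G n \<omega>)"

text \<open>Here no independence removes the cross term between the majorant and \<open>G\<close>.
  Instead one step is read as a convex combination with weight \<open>\<beta> / 2 * g n\<close>, and
  convexity of the square is used.\<close>

lemma majorant_second_moment:
  fixes M :: "'b measure"
  assumes "L2_bounded M G"
  shows "L2_bounded M (\<lambda>n \<omega>. majorant G n \<omega> / sqrt (g n))"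
proof -
  obtain C where G[measurable]: "\<And>n. G n \<in> borel_measurable M" and G2: "\<And>n. integrable M (\<lambda>\<omega>. (G n \<omega>)\<^sup>2)"
    "\<And>n. (\<integral>\<omega>. (G n \<omega>)\<^sup>2 \<partial>M) \<le> C" using L2_boundedE[OF assms] by blast
  have meas[measurable]: "majorant G n \<in> borel_measurable M" for n
    by (induction n) (simp_all del: times_divide_eq_left)
  have int: "integrable M (\<lambda>\<omega>. (majorant G n \<omega>)\<^sup>2)" for n
  proof (induction n)
    case (Suc n)
    let ?c = "max 0 (1 - \<beta> / 2 * g n)" and ?d = "g n * sqrt (g n)"
    show ?case
    proof (rule Bochner_Integration.integrable_bound)
      show "integrable M (\<lambda>\<omega>. 2 * ?c\<^sup>2 * (majorant G n \<omega>)\<^sup>2 + 2 * ?d\<^sup>2 * (G n \<omega>)\<^sup>2)"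
        using Suc G2(1) by simp
      have "(?c * majorant G n \<omega> + ?d * G n \<omega>)\<^sup>2 \<le> 2 * (?c * majorant G n \<omega>)\<^sup>2 + 2 * (?d * G n \<omega>)\<^sup>2" for \<omega>
        using sum_squares_bound[of "?c * majorant G n \<omega>" "?d * G n \<omega>"] by (simp add: power2_sum)
      then have "(majorant G (Suc n) \<omega>)\<^sup>2 \<le> 2 * ?c\<^sup>2 * (majorant G n \<omega>)\<^sup>2 + 2 * ?d\<^sup>2 * (G n \<omega>)\<^sup>2" for \<omega>
        by (simp only: majorant.simps power_mult_distrib mult.assoc)
      then show "AE \<omega> in M. norm ((majorant G (Suc n) \<omega>)\<^sup>2) \<le> norm (2 * ?c\<^sup>2 * (majorant G n \<omega>)\<^sup>2 + 2 * ?d\<^sup>2 * (G n \<omega>)\<^sup>2)"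
        by (intro AE_I2) (metis abs_of_nonneg order_trans real_norm_def zero_le_power2)
    qed measurable
  qed simp
  let ?b = "\<beta> / 2"
  have b: "?b > 0" using \<beta> by simp
  have rec: "eventually (\<lambda>n. (\<integral>\<omega>. (majorant G (Suc n) \<omega>)\<^sup>2 \<partial>M) \<le>
      (1 - ?b * g n) * (\<integral>\<omega>. (majorant G n \<omega>)\<^sup>2 \<partial>M) + (C / ?b) * (g n)\<^sup>2) sequentially"
    using g_eventually_le[of "1 / ?b", simplified, OF \<beta>]
  proof eventually_elim
    case (elim n)
    have c: "0 \<le> 1 - ?b * g n" using elim \<beta> by (simp add: field_simps)
    have g: "g n > 0" by (rule g_pos)
    have le: "(majorant G (Suc n) \<omega>)\<^sup>2 \<le> (1 - ?b * g n) * (majorant G n \<omega>)\<^sup>2 + (g n)\<^sup>2 / ?b * (G n \<omega>)\<^sup>2" for \<omega>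
    proof -
      \<comment> \<open>The scaling makes the input equal to \<open>?t * ?z\<close>, so that
        \<open>?t * ?z\<^sup>2\<close> has the order \<open>(g n)\<^sup>2\<close> required by
        \<open>recursion_bound\<close>.\<close>
      let ?z = "sqrt (g n) * G n \<omega> / ?b" and ?t = "?b * g n"
      have "majorant G (Suc n) \<omega> = (1 - ?t) * majorant G n \<omega> + ?t * ?z"
        using c \<beta> by simp
      moreover have "((1 - t) * a + t * z)\<^sup>2 = (1 - t) * a\<^sup>2 + t * z\<^sup>2 - (1 - t) * t * (a - z)\<^sup>2" for t a z :: real
        by (simp add: power2_eq_square algebra_simps)
      ultimately have "(majorant G (Suc n) \<omega>)\<^sup>2 =
          (1 - ?t) * (majorant G n \<omega>)\<^sup>2 + ?t * ?z\<^sup>2 - (1 - ?t) * ?t * (majorant G n \<omega> - ?z)\<^sup>2"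
        by (simp only:)
      also have "\<dots> \<le> (1 - ?t) * (majorant G n \<omega>)\<^sup>2 + ?t * ?z\<^sup>2"
        using c b g by simp
      also have "?t * ?z\<^sup>2 = (g n)\<^sup>2 / ?b * (G n \<omega>)\<^sup>2"
        using b g by (simp add: power_mult_distrib power_divide power2_eq_square[of "g n"] power2_eq_square[of \<beta>])
      finally show ?thesis .
    qed
    have "(\<integral>\<omega>. (majorant G (Suc n) \<omega>)\<^sup>2 \<partial>M)
        \<le> (\<integral>\<omega>. (1 - ?b * g n) * (majorant G n \<omega>)\<^sup>2 + (g n)\<^sup>2 / ?b * (G n \<omega>)\<^sup>2 \<partial>M)"
      using int G2 by (intro integral_mono le Bochner_Integration.integrable_add integrable_mult_right) 
    also have "\<dots> = (1 - ?b * g n) * (\<integral>\<omega>. (majorant G n \<omega>)\<^sup>2 \<partial>M) + (g n)\<^sup>2 / ?b * (\<integral>\<omega>. (G n \<omega>)\<^sup>2 \<partial>M)"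
      using int G2 by simp
    also have "(g n)\<^sup>2 / ?b * (\<integral>\<omega>. (G n \<omega>)\<^sup>2 \<partial>M) \<le> (g n)\<^sup>2 / ?b * C"
      using b by (intro mult_left_mono G2) simp
    finally show ?case by (simp add: mult_ac)
  qed
  obtain K where K: "\<And>n. (\<integral>\<omega>. (majorant G n \<omega>)\<^sup>2 \<partial>M) \<le> K * g n"
    using recursion_bound[OF b rec] by blast
  show ?thesis
  proof (rule L2_boundedI)
    show "(\<integral>\<omega>. (majorant G n \<omega> / sqrt (g n))\<^sup>2 \<partial>M) \<le> K" for n
      using K[of n] g_pos[of n] by (simp add: power_divide field_simps)
    show "integrable M (\<lambda>\<omega>. (majorant G n \<omega> / sqrt (g n))\<^sup>2)" for n
      using int[of n] by (simp add: power_divide)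
  qed measurable
qed

end

section \<open>Convergence in probability of the averaged increments\<close>

text \<open>The constant \<open>C\<close> depends on the path and need not be integrable. Discarding
  a part of \<open>L\<close> of small probability leaves paths on which one integer works for all
  \<open>n\<close>, and there the expectation of \<open>Z n\<close> decides. The three thirds of
  \<open>\<epsilon>\<close> pay for passing from \<open>L\<close> to \<open>A m \<inter> L\<close>,
  from there to \<open>B j\<close>, and for \<open>Z\<close>.\<close>

lemma (in prob_space) localized_convergence_in_prob:
  fixes Y :: "nat \<Rightarrow> 'a \<Rightarrow> real" and A :: "nat \<Rightarrow> 'a set"
  assumes L[measurable]: "L \<in> sets M" and A[measurable]: "\<And>m. A m \<in> sets M"
    and lim: "(\<lambda>m. prob (A m \<inter> L)) \<longlonglongrightarrow> prob L"
    and Y[measurable]: "\<And>n. Y n \<in> borel_measurable M" and Y0: "\<And>n \<omega>. 0 \<le> Y n \<omega>"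
    and loc: "\<And>m. \<exists>Z. (\<forall>n. integrable M (Z n)) \<and> (\<forall>n \<omega>. 0 \<le> Z n \<omega>) \<and> (\<lambda>n. \<integral>\<omega>. Z n \<omega> \<partial>M) \<longlonglongrightarrow> 0
      \<and> (AE \<omega> in M. \<omega> \<in> L \<inter> A m \<longrightarrow> (\<exists>C. \<forall>n. Y n \<omega> \<le> C * Z n \<omega>))"
  shows "(\<lambda>n. \<integral>\<omega>. indicator L \<omega> * min 1 (Y n \<omega>) \<partial>M) \<longlonglongrightarrow> 0"
proof (rule LIMSEQ_I)
  fix \<epsilon> :: real assume \<epsilon>: "\<epsilon> > 0"
  have "eventually (\<lambda>m. prob L - \<epsilon> / 3 < prob (A m \<inter> L)) sequentially"
    using \<epsilon> by (intro order_tendstoD(1)[OF lim]) simp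
  then obtain m where m: "prob L - \<epsilon> / 3 < prob (A m \<inter> L)"
    by (auto simp: eventually_sequentially)
  obtain Z where Z: "\<And>n. integrable M (Z n)" "\<And>n \<omega>. 0 \<le> Z n \<omega>" "(\<lambda>n. \<integral>\<omega>. Z n \<omega> \<partial>M) \<longlonglongrightarrow> 0"
    "AE \<omega> in M. \<omega> \<in> L \<inter> A m \<longrightarrow> (\<exists>C. \<forall>n. Y n \<omega> \<le> C * Z n \<omega>)"
    using loc[of m] by blast
  have [measurable]: "Z n \<in> borel_measurable M" for n using Z(1) by auto
  \<comment> \<open>Asking for a common integer bound over countably many \<open>n\<close> makes
    these events measurable, and nonnegativity of \<open>Z\<close> makes them increase with
    \<open>j\<close>.\<close>
  define B where "B j = {\<omega> \<in> space M. \<omega> \<in> L \<inter> A m \<and> (\<forall>n. Y n \<omega> \<le> real j * Z n \<omega>)}" for j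
  have B[measurable]: "B j \<in> sets M" for j unfolding B_def by measurable
  have "incseq B"
  proof (rule incseq_SucI, rule subsetI)
    fix j \<omega> assume "\<omega> \<in> B j"
    then show "\<omega> \<in> B (Suc j)"
      unfolding B_def using Z(2) by (auto intro: order_trans[OF _ mult_right_mono])
  qed
  then have "(\<lambda>j. prob (B j)) \<longlonglongrightarrow> prob (\<Union>j. B j)"
    by (intro finite_Lim_measure_incseq) auto
  also have "prob (\<Union>j. B j) = prob (A m \<inter> L)"
  proof (rule finite_measure_eq_AE)
    show "AE \<omega> in M. \<omega> \<in> (\<Union>j. B j) \<longleftrightarrow> \<omega> \<in> A m \<inter> L"
      using Z(4) AE_space
    proof eventually_elim
      case (elim \<omega>)
      show ?case
      proof
        assume \<omega>: "\<omega> \<in> A m \<inter> L"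
        then obtain C where C: "\<And>n. Y n \<omega> \<le> C * Z n \<omega>" using elim by auto
        have "Y n \<omega> \<le> real (nat \<lceil>C\<rceil>) * Z n \<omega>" for n
          using C[of n] by (rule order_trans) (intro mult_right_mono Z(2) real_nat_ceiling_ge)
        then show "\<omega> \<in> (\<Union>j. B j)" using \<omega> elim by (auto simp: B_def)
      qed (auto simp: B_def)
    qed
  qed auto
  finally have "eventually (\<lambda>j. prob (A m \<inter> L) - \<epsilon> / 3 < prob (B j)) sequentially"
    using \<epsilon> by (intro order_tendstoD(1)) auto
  then obtain j where j: "prob (A m \<inter> L) - \<epsilon> / 3 < prob (B j)"
    by (auto simp: eventually_sequentially)
  have ind: "integrable M (\<lambda>\<omega>. indicator (L - B j) \<omega> :: real)"
    by (intro integrable_real_indicator) (auto simp: less_top[symmetric])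
  have le: "(\<integral>\<omega>. indicator L \<omega> * min 1 (Y n \<omega>) \<partial>M) \<le> prob L - prob (B j) + real j * (\<integral>\<omega>. Z n \<omega> \<partial>M)" for n
  proof -
    have "(\<integral>\<omega>. indicator L \<omega> * min 1 (Y n \<omega>) \<partial>M) \<le> (\<integral>\<omega>. indicator (L - B j) \<omega> + real j * Z n \<omega> \<partial>M)"
    proof (rule integral_mono)
      show "integrable M (\<lambda>\<omega>. indicator L \<omega> * min 1 (Y n \<omega>))"
        by (rule integrable_const_bound[of _ 1]) (use Y0 in \<open>auto simp: indicator_def\<close>)
      show "integrable M (\<lambda>\<omega>. indicator (L - B j) \<omega> + real j * Z n \<omega>)"
        by (intro Bochner_Integration.integrable_add integrable_mult_right Z ind)
      show "indicator L \<omega> * min 1 (Y n \<omega>) \<le> indicator (L - B j) \<omega> + real j * Z n \<omega>" for \<omega>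
        using Z(2)[of n \<omega>] by (auto simp: indicator_def B_def min_le_iff_disj)
    qed
    also have "\<dots> = prob (L - B j) + real j * (\<integral>\<omega>. Z n \<omega> \<partial>M)"
      by (subst Bochner_Integration.integral_add[OF ind integrable_mult_right[OF Z(1)]]) simp
    also have "prob (L - B j) = prob L - prob (B j)"
      by (rule finite_measure_Diff) (auto simp: B_def)
    finally show ?thesis .
  qed
  have "(\<lambda>n. real j * (\<integral>\<omega>. Z n \<omega> \<partial>M)) \<longlonglongrightarrow> 0"
    using tendsto_mult_right_zero[OF Z(3)] by simp
  then have "eventually (\<lambda>n. real j * (\<integral>\<omega>. Z n \<omega> \<partial>M) < \<epsilon> / 3) sequentially"
    using \<epsilon> by (intro order_tendstoD(2)) auto
  then obtain n0 where n0: "\<And>n. n \<ge> n0 \<Longrightarrow> real j * (\<integral>\<omega>. Z n \<omega> \<partial>M) < \<epsilon> / 3"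
    by (auto simp: eventually_sequentially)
  have "norm ((\<integral>\<omega>. indicator L \<omega> * min 1 (Y n \<omega>) \<partial>M) - 0) < \<epsilon>" if "n \<ge> n0" for n
  proof -
    have "0 \<le> (\<integral>\<omega>. indicator L \<omega> * min 1 (Y n \<omega>) \<partial>M)"
      using Y0 by (intro integral_nonneg_AE) auto
    then show ?thesis using le[of n] n0[OF that] j m by simp
  qed
  then show "\<exists>n0. \<forall>n\<ge>n0. norm ((\<integral>\<omega>. indicator L \<omega> * min 1 (Y n \<omega>) \<partial>M) - 0) < \<epsilon>" by blast
qed

lemma sum_scaled_increments:
  fixes x :: "nat \<Rightarrow> 'a::real_vector" and c :: "nat \<Rightarrow> real"
  shows "(\<Sum>k\<le>n. c k *\<^sub>R (x (Suc k) - x k)) =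
    c n *\<^sub>R x (Suc n) - c 0 *\<^sub>R x 0 + (\<Sum>k<n. (c k - c (Suc k)) *\<^sub>R x (Suc k))"
  by (induction n) (simp_all add: algebra_simps)

section \<open>Deterministic weights of the averaged error terms\<close>

context step_sizes
begin

text \<open>The first two summands are the boundary term and the variation of \<open>1 / g\<close>
  left by summation by parts, the third is the Taylor remainder, and the final \<open>1\<close>
  stands for the initial value. The argument \<open>d\<close> will be the square of
  \<open>D\<close>, or constantly \<open>1\<close> when only the rate of the weights
  matters.\<close>

definition average_weight :: "(nat \<Rightarrow> real) \<Rightarrow> nat \<Rightarrow> real" where
  "average_weight d n = (1 / sqrt (real (Suc n))) *
     (sqrt (g (Suc n)) / g n * d (Suc n)
      + (\<Sum>k<n. \<bar>1 / g k - 1 / g (Suc k)\<bar> * sqrt (g (Suc k)) * d (Suc k))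
      + (\<Sum>k\<le>n. g k * d k) + 1)"

text \<open>Once \<open>sqrt (g (Suc k))\<close> is replaced by a multiple of
  \<open>sqrt (g k)\<close>, the boundary term is of the order of the inverse of
  \<open>sqrt (real (Suc n) * g n)\<close>, and the variation of \<open>1 / g\<close> becomes a
  relative increment times \<open>g k powr (-1/2)\<close>. Thus each summand meets one of the three
  conditions.\<close>

lemma average_weight_tendsto:
  assumes av1: "filterlim (\<lambda>n. real (Suc n) * g n) at_top sequentially"
    and av2: "(\<lambda>n. (1 / sqrt (real n)) * (\<Sum>k<n. g k powr (-1/2) * \<bar>1 - g k / g (Suc k)\<bar>)) \<longlonglongrightarrow> 0"
    and av3: "(\<lambda>n. (1 / sqrt (real n)) * (\<Sum>k<n. g k)) \<longlonglongrightarrow> 0"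
  shows "average_weight (\<lambda>_. 1) \<longlonglongrightarrow> 0"
proof -
  obtain c where c: "c > 0" "\<And>n. g (Suc n) \<le> c * g n" using g_Suc_le by blast
  have sq: "sqrt (g (Suc n)) \<le> sqrt c * sqrt (g n)" for n
    using c(2)[of n] by (simp flip: real_sqrt_mult)
  have "(\<lambda>n. sqrt (real (Suc n) * g n)) = sqrt \<circ> (\<lambda>n. real (Suc n) * g n)" by auto
  then have "filterlim (\<lambda>n. sqrt (real (Suc n) * g n)) at_top sequentially"
    using filterlim_compose[OF sqrt_at_top av1] by simp
  then have "(\<lambda>n. inverse (sqrt (real (Suc n) * g n))) \<longlonglongrightarrow> 0"
    by (rule tendsto_inverse_0_at_top)
  from tendsto_mult_right_zero[OF this, of "sqrt c"]
  have l1: "(\<lambda>n. sqrt c * inverse (sqrt (real (Suc n) * g n))) \<longlonglongrightarrow> 0" .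
  from tendsto_mult_right_zero[OF av2, of "sqrt c"]
  have l2: "(\<lambda>n. sqrt c * ((1 / sqrt (real n)) * (\<Sum>k<n. g k powr (-1/2) * \<bar>1 - g k / g (Suc k)\<bar>))) \<longlonglongrightarrow> 0" .
  from LIMSEQ_Suc[OF av3]
  have l3: "(\<lambda>n. (1 / sqrt (real (Suc n))) * (\<Sum>k<Suc n. g k)) \<longlonglongrightarrow> 0" .
  have l4: "(\<lambda>n. 1 / sqrt (real (Suc n))) \<longlonglongrightarrow> 0"
    using tendsto_real_sqrt[OF LIMSEQ_inverse_real_of_nat] by (simp add: real_sqrt_inverse inverse_eq_divide real_sqrt_divide)
  have lim: "(\<lambda>n. sqrt c * inverse (sqrt (real (Suc n) * g n))
      + sqrt c * ((1 / sqrt (real n)) * (\<Sum>k<n. g k powr (-1/2) * \<bar>1 - g k / g (Suc k)\<bar>))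
      + (1 / sqrt (real (Suc n))) * (\<Sum>k<Suc n. g k) + 1 / sqrt (real (Suc n))) \<longlonglongrightarrow> 0"
    using tendsto_add[OF tendsto_add[OF tendsto_add[OF l1 l2] l3] l4] by simp
  have up: "eventually (\<lambda>n. average_weight (\<lambda>_. 1) n \<le> sqrt c * inverse (sqrt (real (Suc n) * g n))
      + sqrt c * ((1 / sqrt (real n)) * (\<Sum>k<n. g k powr (-1/2) * \<bar>1 - g k / g (Suc k)\<bar>))
      + (1 / sqrt (real (Suc n))) * (\<Sum>k<Suc n. g k) + 1 / sqrt (real (Suc n))) sequentially"
    using eventually_gt_at_top[of 0]
  proof eventually_elim
    case (elim n)
    let ?s = "1 / sqrt (real (Suc n))"
    have "?s * (sqrt (g (Suc n)) / g n) \<le> ?s * (sqrt c * sqrt (g n) / g n)"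
      using sq[of n] g_pos[of n] by (intro mult_left_mono divide_right_mono) auto
    also have "\<dots> = sqrt c * inverse (sqrt (real (Suc n) * g n))"
      using sqrt_divide_self_eq[of "g n"] g_pos[of n]
      by (simp only: real_sqrt_mult inverse_mult_distrib times_divide_eq_right[symmetric] inverse_eq_divide) (simp add: less_imp_le)
    finally have 1: "?s * (sqrt (g (Suc n)) / g n) \<le> sqrt c * inverse (sqrt (real (Suc n) * g n))" .
    have "(\<Sum>k<n. \<bar>1 / g k - 1 / g (Suc k)\<bar> * sqrt (g (Suc k)))
        \<le> (\<Sum>k<n. sqrt c * (g k powr (-1/2) * \<bar>1 - g k / g (Suc k)\<bar>))"
    proof (rule sum_mono)
      fix k
      have g: "g k > 0" "g (Suc k) > 0" using g_pos by auto
      have "\<bar>1 / g k - 1 / g (Suc k)\<bar> = \<bar>1 - g k / g (Suc k)\<bar> / g k"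
        using abs_divide[of "1 - g k / g (Suc k)" "g k"] g by (simp add: diff_divide_distrib)
      then have "\<bar>1 / g k - 1 / g (Suc k)\<bar> * sqrt (g (Suc k)) \<le> \<bar>1 - g k / g (Suc k)\<bar> / g k * (sqrt c * sqrt (g k))"
        using g by (simp only:) (intro mult_left_mono sq divide_nonneg_pos abs_ge_zero)
      also have "\<dots> = sqrt c * (\<bar>1 - g k / g (Suc k)\<bar> * (sqrt (g k) / g k))" by simp
      also have "sqrt (g k) / g k = g k powr (-1/2)"
      proof -
        have "(- 1 / 2 :: real) = - (1 / 2)" by simp
        then show ?thesis
          using g by (simp only: powr_minus powr_half_sqrt sqrt_divide_self_eq less_imp_le)
      qed
      finally show "\<bar>1 / g k - 1 / g (Suc k)\<bar> * sqrt (g (Suc k)) \<le> sqrt c * (g k powr (-1/2) * \<bar>1 - g k / g (Suc k)\<bar>)"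
        by (simp add: mult_ac)
    qed
    then have "?s * (\<Sum>k<n. \<bar>1 / g k - 1 / g (Suc k)\<bar> * sqrt (g (Suc k)))
      \<le> (1 / sqrt (real n)) * (\<Sum>k<n. sqrt c * (g k powr (-1/2) * \<bar>1 - g k / g (Suc k)\<bar>))"
      using elim by (intro mult_mono frac_le) (auto intro!: sum_nonneg mult_nonneg_nonneg simp: less_imp_le[OF g_pos])
    also have "\<dots> = sqrt c * ((1 / sqrt (real n)) * (\<Sum>k<n. g k powr (-1/2) * \<bar>1 - g k / g (Suc k)\<bar>))"
      by (simp only: sum_distrib_left mult_ac)
    finally have 2: "?s * (\<Sum>k<n. \<bar>1 / g k - 1 / g (Suc k)\<bar> * sqrt (g (Suc k))) \<le> \<dots>" .
    have "average_weight (\<lambda>_. 1) n = ?s * (sqrt (g (Suc n)) / g n)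
      + ?s * (\<Sum>k<n. \<bar>1 / g k - 1 / g (Suc k)\<bar> * sqrt (g (Suc k))) + ?s * (\<Sum>k<Suc n. g k) + ?s"
      unfolding average_weight_def by (simp only: distrib_left mult_1_right lessThan_Suc_atMost)
    then show ?case using 1 2 by linarith
  qed
  have low: "eventually (\<lambda>n. 0 \<le> average_weight (\<lambda>_. 1) n) sequentially"
    unfolding average_weight_def using g_pos
    by (intro always_eventually allI mult_nonneg_nonneg add_nonneg_nonneg sum_nonneg) (auto simp: less_imp_le)
  show ?thesis by (rule tendsto_sandwich[OF low up tendsto_const lim])
qed

lemma average_weight_nonneg:
  "(\<And>k. 0 \<le> d k) \<Longrightarrow> 0 \<le> average_weight d n"
  unfolding average_weight_def using g_pos
  by (intro mult_nonneg_nonneg add_nonneg_nonneg sum_nonneg) (auto simp: less_imp_le)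

text \<open>The weight is affine in \<open>d\<close> with nonnegative coefficients, so expectations
  pass inside and a uniform bound on second moments comes out as a factor. That bound is taken at
  least \<open>1\<close> so that it also covers the constant summand.\<close>

lemma average_weight_integral_tendsto:
  assumes D: "L2_bounded M D" and M: "prob_space M" and lim: "average_weight (\<lambda>_. 1) \<longlonglongrightarrow> 0"
  shows "integrable M (\<lambda>\<omega>. average_weight (\<lambda>k. (D k \<omega>)\<^sup>2) n)"
    "(\<lambda>n. \<integral>\<omega>. average_weight (\<lambda>k. (D k \<omega>)\<^sup>2) n \<partial>M) \<longlonglongrightarrow> 0"
proof -
  interpret prob_space M by (rule M)
  obtain C0 where "\<And>k. D k \<in> borel_measurable M" and int: "\<And>k. integrable M (\<lambda>\<omega>. (D k \<omega>)\<^sup>2)"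
    and C0: "\<And>k. (\<integral>\<omega>. (D k \<omega>)\<^sup>2 \<partial>M) \<le> C0"
    by (rule L2_boundedE[OF D]) (rule that)
  define C where "C = max C0 1"
  have C: "C \<ge> 1" "(\<integral>\<omega>. (D k \<omega>)\<^sup>2 \<partial>M) \<le> C" for k using C0[of k] by (auto simp: C_def)
  have one: "has_bochner_integral M (\<lambda>\<omega>. 1 :: real) 1"
    by (simp add: has_bochner_integral_iff prob_space)
  have hb: "has_bochner_integral M (\<lambda>\<omega>. average_weight (\<lambda>k. (D k \<omega>)\<^sup>2) n)
      (average_weight (\<lambda>k. \<integral>\<omega>. (D k \<omega>)\<^sup>2 \<partial>M) n)" for n
    unfolding average_weight_def
    by (intro has_bochner_integral_mult_right has_bochner_integral_add has_bochner_integral_sum one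
        has_bochner_integral_integrable int)
  show "integrable M (\<lambda>\<omega>. average_weight (\<lambda>k. (D k \<omega>)\<^sup>2) n)"
    using hb by (simp add: has_bochner_integral_iff)
  have le: "(\<integral>\<omega>. average_weight (\<lambda>k. (D k \<omega>)\<^sup>2) n \<partial>M) \<le> C * average_weight (\<lambda>_. 1) n" for n
  proof -
    have "(\<integral>\<omega>. average_weight (\<lambda>k. (D k \<omega>)\<^sup>2) n \<partial>M) = average_weight (\<lambda>k. \<integral>\<omega>. (D k \<omega>)\<^sup>2 \<partial>M) n"
      by (rule has_bochner_integral_integral_eq[OF hb])
    also have "\<dots> \<le> (1 / sqrt (real (Suc n))) *
     (sqrt (g (Suc n)) / g n * C
      + (\<Sum>k<n. \<bar>1 / g k - 1 / g (Suc k)\<bar> * sqrt (g (Suc k)) * C)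
      + (\<Sum>k\<le>n. g k * C) + C)"
      unfolding average_weight_def
      by (intro mult_left_mono add_mono sum_mono C order_refl mult_nonneg_nonneg divide_nonneg_nonneg
          real_sqrt_ge_zero g_nonneg abs_ge_zero zero_le_one of_nat_0_le_iff)
    also have "\<dots> = C * average_weight (\<lambda>_. 1) n"
      unfolding average_weight_def sum_distrib_right[symmetric]
      by (simp only: mult_1_right distrib_left mult_ac)
    finally show ?thesis .
  qed
  have lim': "(\<lambda>n. C * average_weight (\<lambda>_. 1) n) \<longlonglongrightarrow> 0" using tendsto_mult_right_zero[OF lim] by simp
  show "(\<lambda>n. \<integral>\<omega>. average_weight (\<lambda>k. (D k \<omega>)\<^sup>2) n \<partial>M) \<longlonglongrightarrow> 0"
  proof (rule tendsto_sandwich[OF _ _ tendsto_const lim'])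
    show "eventually (\<lambda>n. 0 \<le> (\<integral>\<omega>. average_weight (\<lambda>k. (D k \<omega>)\<^sup>2) n \<partial>M)) sequentially"
      by (intro always_eventually allI integral_nonneg_AE AE_I2 average_weight_nonneg) simp
    show "eventually (\<lambda>n. (\<integral>\<omega>. average_weight (\<lambda>k. (D k \<omega>)\<^sup>2) n \<partial>M) \<le> C * average_weight (\<lambda>_. 1) n) sequentially"
      by (intro always_eventually allI le)
  qed
qed

text \<open>The iterates are linear in \<open>D\<close> and the remainder is quadratic. As
  \<open>D k \<ge> 1\<close>, both can be measured by the square, which gives a single weight for
  all terms.\<close>

lemma increments_le_average_weight:
  fixes x R :: "nat \<Rightarrow> 'a::real_normed_vector" and D :: "nat \<Rightarrow> real"
  assumes D: "\<And>k. D k \<ge> 1" and x: "\<And>k. norm (x k) \<le> C * (sqrt (g k) * D k)"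
    and R: "\<And>k. norm (R k) \<le> C * (g k * (D k)\<^sup>2)"
  obtains C' where "\<And>n. norm ((1 / sqrt (real (Suc n))) *\<^sub>R
      ((\<Sum>k\<le>n. (1 / g k) *\<^sub>R (x (Suc k) - x k)) - (\<Sum>k\<le>n. R k))) \<le> C' * average_weight (\<lambda>k. (D k)\<^sup>2) n"
proof -
  have C: "C \<ge> 0"
  proof -
    have "sqrt (g 0) * D 0 > 0" using g_pos[of 0] D[of 0] by simp
    then show ?thesis using x[of 0] norm_ge_zero[of "x 0"] by (meson order_trans zero_le_mult_iff not_less)
  qed
  have D2: "D k \<le> (D k)\<^sup>2" for k using D[of k] by (simp add: power2_eq_square)
  have x2: "norm (x k) \<le> C * (sqrt (g k) * (D k)\<^sup>2)" for k
    using x[of k] by (rule order_trans) (intro mult_left_mono C D2, use g_pos[of k] in simp)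
  define c0 where "c0 = norm ((1 / g 0) *\<^sub>R x 0)"
  \<comment> \<open>\<open>c0\<close> is the boundary term at index \<open>0\<close>; it is charged
    to the constant summand of the weight.\<close>
  define C' where "C' = max C c0"
  have C': "C \<le> C'" "c0 \<le> C'" "C' \<ge> 0" using C by (auto simp: C'_def)
  have "norm ((1 / sqrt (real (Suc n))) *\<^sub>R
      ((\<Sum>k\<le>n. (1 / g k) *\<^sub>R (x (Suc k) - x k)) - (\<Sum>k\<le>n. R k))) \<le> C' * average_weight (\<lambda>k. (D k)\<^sup>2) n" for n
  proof -
    have t1: "norm ((1 / g n) *\<^sub>R x (Suc n)) \<le> C' * (sqrt (g (Suc n)) / g n * (D (Suc n))\<^sup>2)"
    proof -
      have "norm ((1 / g n) *\<^sub>R x (Suc n)) = norm (x (Suc n)) / g n" using g_pos[of n] by simp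
      also have "\<dots> \<le> C' * (sqrt (g (Suc n)) * (D (Suc n))\<^sup>2) / g n"
        using g_pos[of n] g_pos[of "Suc n"] C' by (intro divide_right_mono order_trans[OF x2] mult_right_mono) auto
      finally show ?thesis by simp
    qed
    have t2: "norm (\<Sum>k<n. (1 / g k - 1 / g (Suc k)) *\<^sub>R x (Suc k))
        \<le> C' * (\<Sum>k<n. \<bar>1 / g k - 1 / g (Suc k)\<bar> * sqrt (g (Suc k)) * (D (Suc k))\<^sup>2)"
      unfolding sum_distrib_left
    proof (rule sum_norm_le)
      fix k
      have "norm ((1 / g k - 1 / g (Suc k)) *\<^sub>R x (Suc k)) \<le> \<bar>1 / g k - 1 / g (Suc k)\<bar> * (C' * (sqrt (g (Suc k)) * (D (Suc k))\<^sup>2))"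
        unfolding norm_scaleR using g_pos[of "Suc k"] C'
        by (intro mult_left_mono order_trans[OF x2] mult_right_mono) auto
      then show "norm ((1 / g k - 1 / g (Suc k)) *\<^sub>R x (Suc k)) \<le> C' * (\<bar>1 / g k - 1 / g (Suc k)\<bar> * sqrt (g (Suc k)) * (D (Suc k))\<^sup>2)"
        by (simp only: mult_ac)
    qed
    have t3: "norm (\<Sum>k\<le>n. R k) \<le> C' * (\<Sum>k\<le>n. g k * (D k)\<^sup>2)"
      unfolding sum_distrib_left using g_pos C'
      by (intro sum_norm_le order_trans[OF R] mult_right_mono) (auto simp: less_imp_le)
    have tri: "norm (a - b + s - r) \<le> norm a + norm b + norm s + norm r" for a b s r :: 'a
      using norm_triangle_ineq4[of "a - b + s" r] norm_triangle_ineq[of "a - b" s] norm_triangle_ineq4[of a b] by linarith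
    have "norm ((\<Sum>k\<le>n. (1 / g k) *\<^sub>R (x (Suc k) - x k)) - (\<Sum>k\<le>n. R k))
        \<le> norm ((1 / g n) *\<^sub>R x (Suc n)) + c0 + norm (\<Sum>k<n. (1 / g k - 1 / g (Suc k)) *\<^sub>R x (Suc k)) + norm (\<Sum>k\<le>n. R k)"
      unfolding sum_scaled_increments[of "\<lambda>k. 1 / g k"] c0_def by (rule tri)
    also have "\<dots> \<le> C' * (sqrt (g (Suc n)) / g n * (D (Suc n))\<^sup>2) + C' * 1
        + C' * (\<Sum>k<n. \<bar>1 / g k - 1 / g (Suc k)\<bar> * sqrt (g (Suc k)) * (D (Suc k))\<^sup>2) + C' * (\<Sum>k\<le>n. g k * (D k)\<^sup>2)"
      using t1 t2 t3 C' by (intro add_mono) auto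
    finally have "(1 / sqrt (real (Suc n))) * norm ((\<Sum>k\<le>n. (1 / g k) *\<^sub>R (x (Suc k) - x k)) - (\<Sum>k\<le>n. R k))
        \<le> (1 / sqrt (real (Suc n))) * \<dots>" by (intro mult_left_mono) auto
    also have "\<dots> = C' * average_weight (\<lambda>k. (D k)\<^sup>2) n"
      unfolding average_weight_def by (simp only: distrib_left mult_ac add_ac)
    finally show ?thesis by simp
  qed
  then show thesis by (rule that)
qed

end

section \<open>Taylor remainder, characteristic functions and the localized rate\<close>

text \<open>The mean value inequality is applied to \<open>h\<close> minus its linearization at
  \<open>c\<close>. The derivative of this difference is \<open>f' z - f' c\<close>, which is at
  most a multiple of \<open>norm (z - c)\<close> because \<open>f'\<close> is differentiable at
  \<open>c\<close>.\<close>

lemma C2_quadratic_remainder: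
  fixes h :: "'a::euclidean_space \<Rightarrow> 'b::euclidean_space"
  assumes V: "open V" "c \<in> V" and C2: "C2_on h V" and D: "(h has_derivative D) (at c)"
  obtains \<delta> K where "\<delta> > 0" "K \<ge> 0" "\<And>y. norm (y - c) < \<delta> \<Longrightarrow> norm (h y - h c - D (y - c)) \<le> K * (norm (y - c))\<^sup>2"
proof -
  obtain f' f'' where f': "\<And>x. x \<in> V \<Longrightarrow> (h has_derivative blinfun_apply (f' x)) (at x)"
    and f'': "\<And>x. x \<in> V \<Longrightarrow> (f' has_derivative blinfun_apply (f'' x)) (at x)"
    using C2 unfolding C2_on_def by blast
  have Dc: "D = blinfun_apply (f' c)" using has_derivative_unique[OF D f'[OF V(2)]] .
  obtain \<delta>1 where \<delta>1: "\<delta>1 > 0" "\<And>y. norm (y - c) < \<delta>1 \<Longrightarrow> norm (f' y - f' c - f'' c (y - c)) \<le> 1 * norm (y - c)"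
    using f''[OF V(2)] unfolding has_derivative_at_alt by (metis zero_less_one)
  obtain \<delta>2 where \<delta>2: "\<delta>2 > 0" "cball c \<delta>2 \<subseteq> V"
    using V open_contains_cball by blast
  define K where "K = 1 + norm (f'' c)"
  have lip: "norm (f' y - f' c) \<le> K * norm (y - c)" if "norm (y - c) < \<delta>1" for y
  proof -
    have "norm (f' y - f' c) \<le> norm (f' y - f' c - f'' c (y - c)) + norm (f'' c (y - c))"
      using norm_triangle_ineq[of "f' y - f' c - f'' c (y - c)" "f'' c (y - c)"] by simp
    also have "\<dots> \<le> 1 * norm (y - c) + norm (f'' c) * norm (y - c)"
      by (intro add_mono \<delta>1 that norm_blinfun)
    finally show ?thesis by (simp add: K_def algebra_simps)
  qed
  show thesis
  proof (rule that[of "min \<delta>1 \<delta>2" K])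
    show "min \<delta>1 \<delta>2 > 0" using \<delta>1 \<delta>2 by simp
    show "K \<ge> 0" by (simp add: K_def)
    fix y assume y: "norm (y - c) < min \<delta>1 \<delta>2"
    let ?S = "cball c (norm (y - c))"
    have S: "z \<in> V" "norm (z - c) \<le> norm (y - c)" if "z \<in> ?S" for z
    proof -
      show "norm (z - c) \<le> norm (y - c)" using that by (simp add: dist_norm norm_minus_commute)
      then have "z \<in> cball c \<delta>2" using y by (simp add: dist_norm norm_minus_commute)
      then show "z \<in> V" using \<delta>2 by blast
    qed
    have "norm ((h y - f' c y) - (h c - f' c c)) \<le> (K * norm (y - c)) * norm (y - c)"
    proof (rule differentiable_bound[where f' = "\<lambda>z. blinfun_apply (f' z - f' c)" and S = ?S])
      fix z assume z: "z \<in> ?S"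
      have "((\<lambda>z. h z - f' c z) has_derivative (\<lambda>v. f' z v - f' c v)) (at z)"
        using f'[OF S(1)[OF z]] by (intro has_derivative_diff) (auto intro!: derivative_eq_intros)
      then show "((\<lambda>z. h z - f' c z) has_derivative blinfun_apply (f' z - f' c)) (at z within ?S)"
        by (simp add: has_derivative_at_withinI minus_blinfun.rep_eq)
      have "onorm (blinfun_apply (f' z - f' c)) = norm (f' z - f' c)" by (simp add: norm_blinfun.rep_eq)
      also have "\<dots> \<le> K * norm (z - c)" using lip S(2)[OF z] y by simp
      also have "\<dots> \<le> K * norm (y - c)" using S(2)[OF z] by (intro mult_left_mono) (auto simp: K_def)
      finally show "onorm (blinfun_apply (f' z - f' c)) \<le> K * norm (y - c)" .
    qed (auto simp: dist_norm norm_minus_commute)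
    moreover have "(h y - f' c y) - (h c - f' c c) = h y - h c - D (y - c)"
      by (simp add: Dc blinfun.diff_right)
    ultimately show "norm (h y - h c - D (y - c)) \<le> K * (norm (y - c))\<^sup>2"
      by (simp add: power2_eq_square mult.assoc)
  qed
qed

section \<open>Truncated distances and characteristic functions\<close>

lemma norm_exp_imaginary_diff_le:
  "norm (exp (\<i> * complex_of_real a) - exp (\<i> * complex_of_real b)) \<le> 2 * min 1 \<bar>a - b\<bar>"
proof -
  have "exp (\<i> * complex_of_real a) - exp (\<i> * complex_of_real b)
      = exp (\<i> * complex_of_real b) * (exp (\<i> * complex_of_real (a - b)) - 1)"
    by (simp add: algebra_simps flip: exp_add)
  then have "norm (exp (\<i> * complex_of_real a) - exp (\<i> * complex_of_real b)) = norm (exp (\<i> * complex_of_real (a - b)) - 1)"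
    by (simp add: norm_mult)
  also have "\<dots> = 2 * \<bar>sin ((a - b) / 2)\<bar>" by (rule dist_exp_i_1)
  also have "\<dots> \<le> 2 * min 1 \<bar>a - b\<bar>"
    using abs_sin_le_one[of "(a - b) / 2"] abs_sin_x_le_abs_x[of "(a - b) / 2"] by (auto simp: min_def)
  finally show ?thesis .
qed

text \<open>A Slutsky argument on the event \<open>L\<close>: the exponential is bounded and
  Lipschitz, so the difference of the two integrals is controlled by errors truncated at
  \<open>1\<close>, whose expectations express convergence in probability.\<close>

lemma (in prob_space) char_fun_diff_tendsto:
  fixes X X' Y1 Y2 Y3 :: "nat \<Rightarrow> 'a \<Rightarrow> real"
  assumes [measurable]: "L \<in> events" "\<And>n. X n \<in> borel_measurable M" "\<And>n. X' n \<in> borel_measurable M"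
    "\<And>n. Y1 n \<in> borel_measurable M" "\<And>n. Y2 n \<in> borel_measurable M" "\<And>n. Y3 n \<in> borel_measurable M"
    and nonneg: "\<And>n \<omega>. 0 \<le> Y1 n \<omega>" "\<And>n \<omega>. 0 \<le> Y2 n \<omega>" "\<And>n \<omega>. 0 \<le> Y3 n \<omega>"
    and le: "\<And>n \<omega>. \<omega> \<in> L \<Longrightarrow> \<bar>X n \<omega> - X' n \<omega>\<bar> \<le> c * (Y1 n \<omega> + Y2 n \<omega> + Y3 n \<omega>)"
    and lim: "(\<lambda>n. \<integral>\<omega>. indicator L \<omega> * min 1 (Y1 n \<omega>) \<partial>M) \<longlonglongrightarrow> 0"
      "(\<lambda>n. \<integral>\<omega>. indicator L \<omega> * min 1 (Y2 n \<omega>) \<partial>M) \<longlonglongrightarrow> 0"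
      "(\<lambda>n. \<integral>\<omega>. indicator L \<omega> * min 1 (Y3 n \<omega>) \<partial>M) \<longlonglongrightarrow> 0"
    and X': "(\<lambda>n. \<integral>\<omega>. indicator L \<omega> * exp (\<i> * complex_of_real (X' n \<omega>)) \<partial>M) \<longlonglongrightarrow> l"
  shows "(\<lambda>n. \<integral>\<omega>. indicator L \<omega> * exp (\<i> * complex_of_real (X n \<omega>)) \<partial>M) \<longlonglongrightarrow> l"
proof -
  define c' where "c' = max 1 c"
  have c': "c' \<ge> 1" "c \<le> c'" by (auto simp: c'_def)
  \<comment> \<open>Truncation is subadditive: if one of the three errors exceeds \<open>1\<close>,
    the right-hand side is at least \<open>1\<close> already. Here \<open>c' \<ge> 1\<close> is
    essential.\<close>
  have min_le: "min 1 (c * (a + b + d)) \<le> c' * (min 1 a + min 1 b + min 1 d)" if "0 \<le> a" "0 \<le> b" "0 \<le> d" for a b d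
  proof (cases "a \<le> 1 \<and> b \<le> 1 \<and> d \<le> 1")
    case True
    then have "min 1 a = a" "min 1 b = b" "min 1 d = d" by auto
    then show ?thesis using that mult_right_mono[OF c'(2), of "a + b + d"] by (simp add: min.coboundedI2)
  next
    case False
    then have "1 \<le> min 1 a + min 1 b + min 1 d" using that by (auto simp: min_def)
    then have "1 * 1 \<le> c' * (min 1 a + min 1 b + min 1 d)" using c' by (intro mult_mono) auto
    then show ?thesis by simp
  qed
  have int: "integrable M (\<lambda>\<omega>. indicator L \<omega> * min 1 (Y \<omega>))" if [measurable]: "Y \<in> borel_measurable M" "\<And>\<omega>. 0 \<le> Y \<omega>" for Y :: "'a \<Rightarrow> real"
    by (rule integrable_const_bound[of _ 1]) (use that in \<open>auto simp: indicator_def\<close>)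
  note ints = int[OF assms(4) nonneg(1)] int[OF assms(5) nonneg(2)] int[OF assms(6) nonneg(3)]
  have intc: "integrable M (\<lambda>\<omega>. indicator L \<omega> * exp (\<i> * complex_of_real (Z \<omega>)))" if [measurable]: "Z \<in> borel_measurable M" for Z
    by (rule integrable_const_bound[of _ 1]) (auto simp: indicator_def)
  let ?d = "\<lambda>n. (\<integral>\<omega>. indicator L \<omega> * exp (\<i> * complex_of_real (X n \<omega>)) \<partial>M) - (\<integral>\<omega>. indicator L \<omega> * exp (\<i> * complex_of_real (X' n \<omega>)) \<partial>M)"
  let ?I = "\<lambda>Y n. \<integral>\<omega>. indicator L \<omega> * min 1 (Y n \<omega>) \<partial>M"
  have "norm (?d n) \<le> 2 * c' * (?I Y1 n + ?I Y2 n + ?I Y3 n)" for n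
  proof -
    have "?d n = (\<integral>\<omega>. indicator L \<omega> * exp (\<i> * complex_of_real (X n \<omega>)) - indicator L \<omega> * exp (\<i> * complex_of_real (X' n \<omega>)) \<partial>M)"
      by (simp add: intc)
    also have "norm \<dots> \<le> (\<integral>\<omega>. norm (indicator L \<omega> * exp (\<i> * complex_of_real (X n \<omega>)) - indicator L \<omega> * exp (\<i> * complex_of_real (X' n \<omega>))) \<partial>M)"
      by (rule integral_norm_bound)
    also have "\<dots> \<le> (\<integral>\<omega>. 2 * c' * (indicator L \<omega> * min 1 (Y1 n \<omega>) + indicator L \<omega> * min 1 (Y2 n \<omega>) + indicator L \<omega> * min 1 (Y3 n \<omega>)) \<partial>M)"
    proof (rule integral_mono)
      show "integrable M (\<lambda>\<omega>. norm (indicator L \<omega> * exp (\<i> * complex_of_real (X n \<omega>)) - indicator L \<omega> * exp (\<i> * complex_of_real (X' n \<omega>))))"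
        by (intro integrable_norm Bochner_Integration.integrable_diff intc assms)
      show "integrable M (\<lambda>\<omega>. 2 * c' * (indicator L \<omega> * min 1 (Y1 n \<omega>) + indicator L \<omega> * min 1 (Y2 n \<omega>) + indicator L \<omega> * min 1 (Y3 n \<omega>)))"
        by (intro integrable_mult_right Bochner_Integration.integrable_add ints)
      show "norm (indicator L \<omega> * exp (\<i> * complex_of_real (X n \<omega>)) - indicator L \<omega> * exp (\<i> * complex_of_real (X' n \<omega>)))
        \<le> 2 * c' * (indicator L \<omega> * min 1 (Y1 n \<omega>) + indicator L \<omega> * min 1 (Y2 n \<omega>) + indicator L \<omega> * min 1 (Y3 n \<omega>))" for \<omega>
      proof (cases "\<omega> \<in> L")
        case True
        have "norm (exp (\<i> * complex_of_real (X n \<omega>)) - exp (\<i> * complex_of_real (X' n \<omega>))) \<le> 2 * min 1 \<bar>X n \<omega> - X' n \<omega>\<bar>"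
          by (rule norm_exp_imaginary_diff_le)
        also have "\<dots> \<le> 2 * min 1 (c * (Y1 n \<omega> + Y2 n \<omega> + Y3 n \<omega>))"
          using le[OF True, of n] by (auto simp: min_def)
        also have "\<dots> \<le> 2 * (c' * (min 1 (Y1 n \<omega>) + min 1 (Y2 n \<omega>) + min 1 (Y3 n \<omega>)))"
          by (intro mult_left_mono min_le nonneg) auto
        finally show ?thesis using True by simp
      qed simp
    qed
    also have "\<dots> = 2 * c' * (?I Y1 n + ?I Y2 n + ?I Y3 n)"
      by (subst integral_mult_right_zero)
         (simp only: Bochner_Integration.integral_add ints Bochner_Integration.integrable_add)
    finally show ?thesis .
  qed
  moreover have "(\<lambda>n. 2 * c' * (?I Y1 n + ?I Y2 n + ?I Y3 n)) \<longlonglongrightarrow> 0"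
    using tendsto_mult_right_zero[OF tendsto_add[OF tendsto_add[OF lim(1,2)] lim(3), simplified], of "2 * c'"] by simp
  ultimately have "?d \<longlonglongrightarrow> 0"
    by (intro Lim_null_comparison[of ?d]) (auto intro: always_eventually)
  from tendsto_add[OF this X'] show ?thesis by simp
qed

lemma (in prob_space) min_integral_tendsto_of_prob:
  fixes Y :: "nat \<Rightarrow> 'a \<Rightarrow> real"
  assumes L[measurable]: "L \<in> events" and Y[measurable]: "\<And>n. Y n \<in> borel_measurable M" and nonneg: "\<And>n \<omega>. 0 \<le> Y n \<omega>"
    and lim: "\<And>\<epsilon>. \<epsilon> > 0 \<Longrightarrow> (\<lambda>n. prob {\<omega> \<in> space M. \<omega> \<in> L \<and> Y n \<omega> > \<epsilon>}) \<longlonglongrightarrow> 0"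
  shows "(\<lambda>n. \<integral>\<omega>. indicator L \<omega> * min 1 (Y n \<omega>) \<partial>M) \<longlonglongrightarrow> 0"
proof (rule LIMSEQ_I)
  fix \<epsilon> :: real assume \<epsilon>: "\<epsilon> > 0"
  let ?B = "\<lambda>n. {\<omega> \<in> space M. \<omega> \<in> L \<and> Y n \<omega> > \<epsilon> / 2}"
  have ind: "integrable M (\<lambda>\<omega>. indicator (?B n) \<omega> :: real)" for n
    by (intro integrable_real_indicator) (auto simp: less_top[symmetric])
  have c: "integrable M (\<lambda>\<omega>. \<epsilon> / 2)" by simp
  have le: "(\<integral>\<omega>. indicator L \<omega> * min 1 (Y n \<omega>) \<partial>M) \<le> prob (?B n) + \<epsilon> / 2" for n
  proof -
    have "(\<integral>\<omega>. indicator L \<omega> * min 1 (Y n \<omega>) \<partial>M) \<le> (\<integral>\<omega>. indicator (?B n) \<omega> + \<epsilon> / 2 \<partial>M)"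
    proof (rule integral_mono)
      show "integrable M (\<lambda>\<omega>. indicator L \<omega> * min 1 (Y n \<omega>))"
        by (rule integrable_const_bound[of _ 1]) (use nonneg in \<open>auto simp: indicator_def\<close>)
      show "integrable M (\<lambda>\<omega>. indicator (?B n) \<omega> + \<epsilon> / 2)"
        by (intro Bochner_Integration.integrable_add ind c)
      show "indicator L \<omega> * min 1 (Y n \<omega>) \<le> indicator (?B n) \<omega> + \<epsilon> / 2" if "\<omega> \<in> space M" for \<omega>
        using \<epsilon> that by (auto simp: indicator_def min_le_iff_disj)
    qed
    also have "\<dots> = prob (?B n) + \<epsilon> / 2"
      by (subst Bochner_Integration.integral_add[OF ind c]) (simp add: prob_space)
    finally show ?thesis .
  qed
  have "eventually (\<lambda>n. prob (?B n) < \<epsilon> / 2) sequentially"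
    using \<epsilon> by (intro order_tendstoD(2)[OF lim]) auto
  then obtain n0 where n0: "\<And>n. n \<ge> n0 \<Longrightarrow> prob (?B n) < \<epsilon> / 2"
    by (auto simp: eventually_sequentially)
  have "norm ((\<integral>\<omega>. indicator L \<omega> * min 1 (Y n \<omega>) \<partial>M) - 0) < \<epsilon>" if "n \<ge> n0" for n
  proof -
    have "0 \<le> (\<integral>\<omega>. indicator L \<omega> * min 1 (Y n \<omega>) \<partial>M)"
      using nonneg by (intro integral_nonneg_AE) auto
    then show ?thesis using le[of n] n0[OF that] by simp
  qed
  then show "\<exists>n0. \<forall>n\<ge>n0. norm ((\<integral>\<omega>. indicator L \<omega> * min 1 (Y n \<omega>) \<partial>M) - 0) < \<epsilon>" by blast
qed

lemma (in prob_space) min_integral_tendsto_of_pointwise: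
  fixes Y :: "nat \<Rightarrow> 'a \<Rightarrow> real"
  assumes L[measurable]: "L \<in> events" and Y[measurable]: "\<And>n. Y n \<in> borel_measurable M" and nonneg: "\<And>n \<omega>. 0 \<le> Y n \<omega>"
    and lim: "\<And>\<omega>. \<omega> \<in> L \<Longrightarrow> (\<lambda>n. Y n \<omega>) \<longlonglongrightarrow> 0"
  shows "(\<lambda>n. \<integral>\<omega>. indicator L \<omega> * min 1 (Y n \<omega>) \<partial>M) \<longlonglongrightarrow> 0"
proof -
  have "(\<lambda>n. \<integral>\<omega>. indicator L \<omega> * min 1 (Y n \<omega>) \<partial>M) \<longlonglongrightarrow> (\<integral>\<omega>. 0 \<partial>M)"
  proof (rule integral_dominated_convergence[where w = "\<lambda>_. 1"])
    show "AE \<omega> in M. (\<lambda>n. indicator L \<omega> * min 1 (Y n \<omega>)) \<longlonglongrightarrow> 0"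
    proof (rule AE_I2)
      fix \<omega>
      show "(\<lambda>n. indicator L \<omega> * min 1 (Y n \<omega>)) \<longlonglongrightarrow> 0"
        using tendsto_min[OF tendsto_const[of "1::real"] lim[of \<omega>]] by (cases "\<omega> \<in> L") auto
    qed
    show "AE \<omega> in M. norm (indicator L \<omega> * min 1 (Y n \<omega>)) \<le> 1" for n
      using nonneg by (auto simp: indicator_def)
  qed auto
  then show ?thesis by simp
qed

context sa_recursion
begin

text \<open>On \<open>L \<inter> A\<close> the indicators of \<open>Ak k\<close> converge to
  \<open>1\<close>, hence equal \<open>1\<close> from some index on, so each such path eventually
  sees the truncated noise. This lets \<open>path_bound\<close> combine the second moments of
  truncated quantities with the untruncated iterates.\<close>

lemma localized_rate:
  fixes M :: "'b measure" and F :: "nat \<Rightarrow> 'b measure" and x e r r1 r2 R :: "nat \<Rightarrow> 'b \<Rightarrow> 'a"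
  assumes M: "prob_space M"
    and sub: "\<And>n. subalgebra M (F n)" "\<And>n. subalgebra (F (Suc n)) (F n)"
    and x_rec: "\<And>n \<omega>. \<omega> \<in> L \<Longrightarrow> x (Suc n) \<omega> = x n \<omega> + g n *\<^sub>R (T (x n \<omega>) + R n \<omega> + e n \<omega> + r n \<omega>)"
    and r: "\<And>n \<omega>. \<omega> \<in> L \<Longrightarrow> r n \<omega> = r1 n \<omega> + r2 n \<omega>"
    and L: "L \<subseteq> space M"
    and R: "\<And>\<omega> \<eta>. \<omega> \<in> L \<Longrightarrow> \<eta> > 0 \<Longrightarrow> eventually (\<lambda>n. norm (R n \<omega>) \<le> \<eta> * norm (x n \<omega>)) sequentially"
    and e_meas: "\<And>n. e n \<in> borel_measurable (F (Suc n))"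
    and mart: "\<And>n f b. b \<in> Basis \<Longrightarrow> f \<in> borel_measurable (F n) \<Longrightarrow> integrable M (\<lambda>\<omega>. f \<omega> * (e n \<omega> \<bullet> b))
        \<Longrightarrow> (\<integral>\<omega>. f \<omega> * (e n \<omega> \<bullet> b) \<partial>M) = 0"
    and Ak: "\<And>k. Ak k \<in> sets (F k)"
    and e_bound: "\<And>k. (\<integral>\<^sup>+ \<omega>. ennreal ((norm (e k \<omega>))\<^sup>2) * indicator (Ak k) \<omega> \<partial>M) \<le> ennreal C"
    and Ak_lim: "AE \<omega> in M. \<omega> \<in> L \<longrightarrow> (\<lambda>k. indicator (Ak k) \<omega> :: real) \<longlonglongrightarrow> indicator A \<omega>"
    and r1: "O_wp1_L2 M (\<lambda>n \<omega>. ((g n) powr (-1/2) * indicator L \<omega> * indicator A \<omega>) *\<^sub>R r1 n \<omega>)"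
    and r2: "O_wp1_L2 M (\<lambda>n \<omega>. (sqrt (g n) * indicator L \<omega> * indicator A \<omega>) *\<^sub>R (\<Sum>k\<le>n. r2 k \<omega>))"
  obtains D where "L2_bounded M D" "\<And>n \<omega>. D n \<omega> \<ge> 1"
    "AE \<omega> in M. \<omega> \<in> L \<inter> A \<longrightarrow> (\<exists>C. \<forall>n. norm (x n \<omega>) \<le> C * (sqrt (g n) * D n \<omega>))"
proof -
  interpret prob_space M by (rule M)
  define e' where "e' n \<omega> = indicator (Ak n) \<omega> *\<^sub>R e n \<omega>" for n \<omega>
  define mu where "mu n = rec_nat (\<lambda>\<omega>. 0) (\<lambda>n m \<omega>. m \<omega> + g n *\<^sub>R T (m \<omega>) + g n *\<^sub>R e' n \<omega>) n" for n
  have mu: "mu 0 \<omega> = 0" "mu (Suc n) \<omega> = mu n \<omega> + g n *\<^sub>R T (mu n \<omega>) + g n *\<^sub>R e' n \<omega>" for n \<omega>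
    by (simp_all add: mu_def)
  have Ak': "Ak k \<in> sets (F (Suc k))" for k
    using Ak[of k] sub(2)[of k] unfolding subalgebra_def by blast
  have e'_meas: "e' n \<in> borel_measurable (F (Suc n))" for n
    unfolding e'_def using Ak'[of n] e_meas[of n] by measurable
  have e'_M[measurable]: "e' n \<in> borel_measurable M" for n
    by (rule measurable_from_subalg[OF sub(1) e'_meas])
  have "L2_bounded M (\<lambda>n \<omega>. norm (e' n \<omega>))"
  proof (rule L2_bounded_of_nn_integral)
    show "(\<integral>\<^sup>+ \<omega>. ennreal ((norm (e' n \<omega>))\<^sup>2) \<partial>M) \<le> ennreal C" for n
    proof -
      have "(\<integral>\<^sup>+ \<omega>. ennreal ((norm (e' n \<omega>))\<^sup>2) \<partial>M) = (\<integral>\<^sup>+ \<omega>. ennreal ((norm (e n \<omega>))\<^sup>2) * indicator (Ak n) \<omega> \<partial>M)"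
        by (intro nn_integral_cong) (auto simp: e'_def indicator_def)
      then show ?thesis using e_bound[of n] by simp
    qed
  qed measurable
  then obtain C' where "\<And>n. (\<lambda>\<omega>. norm (e' n \<omega>)) \<in> borel_measurable M"
    and e'_int: "\<And>n. integrable M (\<lambda>\<omega>. (norm (e' n \<omega>))\<^sup>2)" "\<And>n. (\<integral>\<omega>. (norm (e' n \<omega>))\<^sup>2 \<partial>M) \<le> C'"
    by (rule L2_boundedE) (rule that)
  \<comment> \<open>\<open>Ak n\<close> is known at time \<open>n\<close>, so the truncation can be
    moved from the noise into the test function.\<close>
  have e'_mart: "(\<integral>\<omega>. f \<omega> * (e' n \<omega> \<bullet> b) \<partial>M) = 0"
    if b: "b \<in> Basis" and f: "f \<in> borel_measurable (F n)" and int: "integrable M (\<lambda>\<omega>. f \<omega> * (e' n \<omega> \<bullet> b))" for n f b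
  proof -
    have eq: "f \<omega> * (e' n \<omega> \<bullet> b) = (f \<omega> * indicator (Ak n) \<omega>) * (e n \<omega> \<bullet> b)" for \<omega>
      by (simp add: e'_def)
    have fm: "(\<lambda>\<omega>. f \<omega> * indicator (Ak n) \<omega>) \<in> borel_measurable (F n)"
      using f Ak[of n] by measurable
    show ?thesis using mart[OF b fm] int unfolding eq by blast
  qed
  note mu_L2 = linear_noise_second_moment[where M = M and F = F, OF mu sub e'_meas e'_int e'_mart]
  obtain W1 Wb1 where W1: "\<And>n. Wb1 n \<in> borel_measurable M" "O_wp1 M W1" "O_L2 M Wb1"
    "\<And>n \<omega>. \<omega> \<in> space M \<Longrightarrow> ((g n) powr (-1/2) * indicator L \<omega> * indicator A \<omega>) *\<^sub>R r1 n \<omega> = W1 n \<omega> *\<^sub>R Wb1 n \<omega>"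
    using r1 unfolding O_wp1_L2_def by blast
  obtain W2 Wb2 where W2: "\<And>n. Wb2 n \<in> borel_measurable M" "O_wp1 M W2" "O_L2 M Wb2"
    "\<And>n \<omega>. \<omega> \<in> space M \<Longrightarrow> (sqrt (g n) * indicator L \<omega> * indicator A \<omega>) *\<^sub>R (\<Sum>k\<le>n. r2 k \<omega>) = W2 n \<omega> *\<^sub>R Wb2 n \<omega>"
    using r2 unfolding O_wp1_L2_def by blast
  have L2W: "L2_bounded M (\<lambda>n \<omega>. norm (Wb n \<omega>))" if [measurable]: "\<And>n. Wb n \<in> borel_measurable M" and "O_L2 M Wb" for Wb :: "nat \<Rightarrow> 'b \<Rightarrow> 'a"
  proof -
    obtain c where "\<And>n. (\<integral>\<^sup>+ \<omega>. ennreal ((norm (Wb n \<omega>))\<^sup>2) \<partial>M) \<le> ennreal c"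
      using \<open>O_L2 M Wb\<close> unfolding O_L2_def by blast
    then show ?thesis by (intro L2_bounded_of_nn_integral) measurable
  qed
  \<comment> \<open>\<open>G\<close> collects all inputs integrated later; the \<open>1\<close>
    makes it bounded below. The shifted \<open>Wb2 (n - 1)\<close> is there because the partial sums
    of \<open>r2\<close> up to \<open>n\<close> must also be bounded by \<open>G (Suc n)\<close>; at
    \<open>n = 0\<close> truncated subtraction merely repeats a term.\<close>
  define G where "G n \<omega> = 1 + (norm (Wb1 n \<omega>) + (norm (Wb2 n \<omega>) + (norm (Wb2 (n - 1) \<omega>) + N (mu n \<omega>) / sqrt (g n))))" for n \<omega>
  have G_L2: "L2_bounded M G"
    unfolding G_def
    by (intro L2_bounded_add L2_bounded_const mu_L2 L2W W1 W2 L2_bounded_reindex[OF L2W[OF W2(1,3)]])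
  have Nn: "N (mu n \<omega>) / sqrt (g n) \<ge> 0" for n \<omega> using g_nonneg by simp
  have G1: "G n \<omega> \<ge> 1" and G_Wb: "norm (Wb1 n \<omega>) \<le> G n \<omega>" "norm (Wb2 n \<omega>) \<le> G n \<omega>" "norm (Wb2 n \<omega>) \<le> G (Suc n) \<omega>"
    "N (mu n \<omega>) / sqrt (g n) \<le> G n \<omega>" for n \<omega>
    using Nn[of n \<omega>] Nn[of "Suc n" \<omega>] by (simp_all add: G_def)
  have maj: "majorant G n \<omega> \<ge> 0" for n \<omega>
    using G1 by (induction n) (auto intro!: add_nonneg_nonneg mult_nonneg_nonneg simp: g_nonneg order_trans[OF zero_le_one])
  define D where "D n \<omega> = majorant G n \<omega> / sqrt (g n) + G n \<omega>" for n \<omega>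
  have gD: "sqrt (g n) * D n \<omega> = majorant G n \<omega> + sqrt (g n) * G n \<omega>" for n \<omega>
    using g_pos[of n] by (simp add: D_def distrib_left)
  show thesis
  proof (rule that[of D])
    show "L2_bounded M D"
      unfolding D_def by (intro L2_bounded_add majorant_second_moment G_L2)
    show "D n \<omega> \<ge> 1" for n \<omega>
      using maj[of n \<omega>] G1[of n \<omega>] divide_nonneg_nonneg[OF maj[of n \<omega>] real_sqrt_ge_zero[OF g_nonneg[of n]]] by (simp add: D_def)
    show "AE \<omega> in M. \<omega> \<in> L \<inter> A \<longrightarrow> (\<exists>C. \<forall>n. norm (x n \<omega>) \<le> C * (sqrt (g n) * D n \<omega>))"
      using Ak_lim W1(2)[unfolded O_wp1_def] W2(2)[unfolded O_wp1_def]
    proof eventually_elim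
      case (elim \<omega>)
      show ?case
      proof
        assume "\<omega> \<in> L \<inter> A"
        then have \<omega>: "\<omega> \<in> L" "\<omega> \<in> A" "\<omega> \<in> space M" using L by auto
        obtain B1 where B1: "\<And>n. norm (W1 n \<omega>) \<le> B1" using elim(2) by blast
        obtain B2 where B2: "\<And>n. norm (W2 n \<omega>) \<le> B2" using elim(3) by blast
        define B where "B = max B1 B2"
        have B: "norm (W1 n \<omega>) \<le> B" "norm (W2 n \<omega>) \<le> B" "B \<ge> 0" for n
          using B1[of n] B2[of n] norm_ge_zero[of "W1 n \<omega>"] unfolding B_def by linarith+
        have "eventually (\<lambda>k. (indicator (Ak k) \<omega> :: real) > 1/2) sequentially"
          using elim(1) \<omega> by (intro order_tendstoD(1)) auto
        then have ev: "eventually (\<lambda>k. e k \<omega> = e' k \<omega>) sequentially"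
          by (rule eventually_mono) (auto simp: e'_def indicator_def split: if_splits)
        have b1: "norm (r1 n \<omega>) \<le> B * (sqrt (g n) * G n \<omega>)" for n
        proof -
          have "g n powr (-1/2) * norm (r1 n \<omega>) = norm (W1 n \<omega>) * norm (Wb1 n \<omega>)"
            using arg_cong[OF W1(4)[OF \<omega>(3), of n], of norm] \<omega> by simp
          also have "\<dots> \<le> B * G n \<omega>" using B by (intro mult_mono B G_Wb) auto
          finally have le: "g n powr (-1/2) * norm (r1 n \<omega>) \<le> B * G n \<omega>" .
          have "sqrt (g n) * g n powr (-1/2) = g n powr (1/2 + (-1/2))"
            unfolding powr_add powr_half_sqrt[OF g_nonneg] ..
          then have "sqrt (g n) * g n powr (-1/2) = 1" using g_pos[of n] by simp
          then have "norm (r1 n \<omega>) = sqrt (g n) * (g n powr (-1/2) * norm (r1 n \<omega>))"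
            by (simp only: mult.assoc[symmetric] mult_1)
          also have "\<dots> \<le> sqrt (g n) * (B * G n \<omega>)"
            by (intro mult_left_mono le real_sqrt_ge_zero g_nonneg)
          finally show ?thesis by (simp add: mult_ac)
        qed
        have b2: "sqrt (g n) * norm (\<Sum>k\<le>n. r2 k \<omega>) \<le> B * norm (Wb2 n \<omega>)" for n
        proof -
          have "sqrt (g n) * norm (\<Sum>k\<le>n. r2 k \<omega>) = norm (W2 n \<omega>) * norm (Wb2 n \<omega>)"
            using arg_cong[OF W2(4)[OF \<omega>(3), of n], of norm] \<omega> g_nonneg[of n] by simp
          also have "\<dots> \<le> B * norm (Wb2 n \<omega>)" by (intro mult_right_mono B) simp
          finally show ?thesis .
        qed
        obtain C where "\<And>n. norm (x n \<omega>) \<le> C * (majorant G n \<omega> + sqrt (g n) * G n \<omega>)"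
        proof (rule path_bound[where x = "\<lambda>n. x n \<omega>" and mu = "\<lambda>n. mu n \<omega>" and e = "\<lambda>n. e n \<omega>" and e' = "\<lambda>n. e' n \<omega>"
              and ?r1.0 = "\<lambda>n. r1 n \<omega>" and ?r2.0 = "\<lambda>n. r2 n \<omega>" and R = "\<lambda>n. R n \<omega>" and G = "\<lambda>n. G n \<omega>" and H = "\<lambda>n. majorant G n \<omega>" and B = B])
          show "x (Suc n) \<omega> = x n \<omega> + g n *\<^sub>R (T (x n \<omega>) + R n \<omega> + e n \<omega> + r1 n \<omega> + r2 n \<omega>)" for n
            using x_rec[OF \<omega>(1), of n] r[OF \<omega>(1), of n] by (simp add: add.assoc)
          show "N (mu n \<omega>) \<le> sqrt (g n) * G n \<omega>" for n
            using G_Wb(4)[of n \<omega>] g_pos[of n] by (simp add: pos_divide_le_eq mult.commute)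
          show "sqrt (g n) * norm (\<Sum>k\<le>n. r2 k \<omega>) \<le> B * G n \<omega>" for n
            by (rule order_trans[OF b2]) (intro mult_left_mono G_Wb B)
          show "sqrt (g n) * norm (\<Sum>k\<le>n. r2 k \<omega>) \<le> B * G (Suc n) \<omega>" for n
            by (rule order_trans[OF b2]) (intro mult_left_mono G_Wb B)
        qed (use mu ev R[OF \<omega>(1)] b1 G1 in \<open>auto\<close>)
        then show "\<exists>C. \<forall>n. norm (x n \<omega>) \<le> C * (sqrt (g n) * D n \<omega>)"
          unfolding gD by blast
      qed
    qed
  qed
qed

end

text \<open>On \<open>L \<inter> A m\<close> the rate and the quadratic remainder bound each path by
  a random constant times the weight of the squared \<open>D\<close>. The expectation of that weight
  tends to \<open>0\<close>, and localization disposes of the constant and of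
  \<open>A m\<close>.\<close>

lemma (in step_sizes) averaged_increments_tendsto:
  fixes M :: "'b measure" and x R :: "nat \<Rightarrow> 'b \<Rightarrow> 'a::euclidean_space"
  assumes M: "prob_space M" and L: "L \<in> sets M" and A: "\<And>m. A m \<in> sets M"
    and lim: "(\<lambda>m. measure M (A m \<inter> L)) \<longlonglongrightarrow> measure M L"
    and [measurable]: "\<And>n. x n \<in> borel_measurable M" "\<And>n. R n \<in> borel_measurable M"
    and rate: "\<And>m. \<exists>D. L2_bounded M D \<and> (\<forall>n \<omega>. D n \<omega> \<ge> 1) \<and>
      (AE \<omega> in M. \<omega> \<in> L \<inter> A m \<longrightarrow> (\<exists>C. \<forall>n. norm (x n \<omega>) \<le> C * (sqrt (g n) * D n \<omega>)))"
    and quad: "\<And>\<omega>. \<omega> \<in> L \<Longrightarrow> \<exists>K\<ge>0. \<forall>n. norm (R n \<omega>) \<le> K * (norm (x n \<omega>))\<^sup>2"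
    and weight: "average_weight (\<lambda>_. 1) \<longlonglongrightarrow> 0"
  shows "(\<lambda>n. \<integral>\<omega>. indicator L \<omega> * min 1 (norm ((1 / sqrt (real (Suc n))) *\<^sub>R
      ((\<Sum>k\<le>n. (1 / g k) *\<^sub>R (x (Suc k) \<omega> - x k \<omega>)) - (\<Sum>k\<le>n. R k \<omega>)))) \<partial>M) \<longlonglongrightarrow> 0"
proof (rule prob_space.localized_convergence_in_prob[OF M L A lim _ norm_ge_zero])
  fix m
  obtain D where D: "L2_bounded M D" "\<And>n \<omega>. D n \<omega> \<ge> 1"
    "AE \<omega> in M. \<omega> \<in> L \<inter> A m \<longrightarrow> (\<exists>C. \<forall>n. norm (x n \<omega>) \<le> C * (sqrt (g n) * D n \<omega>))"
    using rate[of m] by blast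
  have "AE \<omega> in M. \<omega> \<in> L \<inter> A m \<longrightarrow> (\<exists>C. \<forall>n. norm ((1 / sqrt (real (Suc n))) *\<^sub>R
      ((\<Sum>k\<le>n. (1 / g k) *\<^sub>R (x (Suc k) \<omega> - x k \<omega>)) - (\<Sum>k\<le>n. R k \<omega>))) \<le> C * average_weight (\<lambda>k. (D k \<omega>)\<^sup>2) n)"
    using D(3)
  proof eventually_elim
    case (elim \<omega>)
    show ?case
    proof
      assume \<omega>: "\<omega> \<in> L \<inter> A m"
      obtain C where C: "\<And>n. norm (x n \<omega>) \<le> C * (sqrt (g n) * D n \<omega>)" using elim \<omega> by blast
      obtain K where K: "K \<ge> 0" "\<And>n. norm (R n \<omega>) \<le> K * (norm (x n \<omega>))\<^sup>2" using quad \<omega> by blast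
      \<comment> \<open>The second entry comes from inserting the rate into the quadratic bound for
        \<open>R\<close>.\<close>
      define C' where "C' = max C (K * C\<^sup>2)"
      have "norm (x n \<omega>) \<le> C' * (sqrt (g n) * D n \<omega>)" for n
        by (rule order_trans[OF C], rule mult_right_mono)
           (use g_nonneg[of n] D(2)[of n \<omega>] in \<open>auto simp: C'_def\<close>)
      moreover have "norm (R n \<omega>) \<le> C' * (g n * (D n \<omega>)\<^sup>2)" for n
      proof -
        have "norm (R n \<omega>) \<le> K * (C * (sqrt (g n) * D n \<omega>))\<^sup>2"
          by (rule order_trans[OF K(2)]) (intro mult_left_mono power_mono C K norm_ge_zero)
        also have "\<dots> = (K * C\<^sup>2) * (g n * (D n \<omega>)\<^sup>2)"
          using g_nonneg[of n] by (simp add: power_mult_distrib)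
        also have "\<dots> \<le> C' * (g n * (D n \<omega>)\<^sup>2)"
          using g_nonneg[of n] by (intro mult_right_mono) (auto simp: C'_def)
        finally show ?thesis .
      qed
      ultimately obtain C'' where "\<And>n. norm ((1 / sqrt (real (Suc n))) *\<^sub>R
          ((\<Sum>k\<le>n. (1 / g k) *\<^sub>R (x (Suc k) \<omega> - x k \<omega>)) - (\<Sum>k\<le>n. R k \<omega>))) \<le> C'' * average_weight (\<lambda>k. (D k \<omega>)\<^sup>2) n"
        using increments_le_average_weight[of "\<lambda>k. D k \<omega>" "\<lambda>k. x k \<omega>" C' "\<lambda>k. R k \<omega>"] D(2) by blast
      then show "\<exists>C. \<forall>n. norm ((1 / sqrt (real (Suc n))) *\<^sub>R
          ((\<Sum>k\<le>n. (1 / g k) *\<^sub>R (x (Suc k) \<omega> - x k \<omega>)) - (\<Sum>k\<le>n. R k \<omega>))) \<le> C * average_weight (\<lambda>k. (D k \<omega>)\<^sup>2) n"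
        by blast
    qed
  qed
  then show "\<exists>Z. (\<forall>n. integrable M (Z n)) \<and> (\<forall>n \<omega>. 0 \<le> Z n \<omega>) \<and> (\<lambda>n. \<integral>\<omega>. Z n \<omega> \<partial>M) \<longlonglongrightarrow> 0
      \<and> (AE \<omega> in M. \<omega> \<in> L \<inter> A m \<longrightarrow> (\<exists>C. \<forall>n. norm ((1 / sqrt (real (Suc n))) *\<^sub>R
      ((\<Sum>k\<le>n. (1 / g k) *\<^sub>R (x (Suc k) \<omega> - x k \<omega>)) - (\<Sum>k\<le>n. R k \<omega>))) \<le> C * Z n \<omega>))"
    using average_weight_integral_tendsto[OF D(1) M weight]
    by (intro exI[of _ "\<lambda>n \<omega>. average_weight (\<lambda>k. (D k \<omega>)\<^sup>2) n"]) (auto intro: average_weight_nonneg)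
qed measurable

text \<open>The local estimate covers all but finitely many indices. The others can be absorbed into
  the constant unless \<open>x n = 0\<close>, where the bound itself vanishes; there
  \<open>R n = 0\<close> is needed, and \<open>b\<close> substitutes a harmless positive
  weight.\<close>

lemma all_quadratic_remainder:
  fixes x R :: "nat \<Rightarrow> 'a::real_normed_vector"
  assumes x: "x \<longlonglongrightarrow> 0" and \<delta>: "\<delta> > 0" and K: "\<And>n. norm (x n) < \<delta> \<Longrightarrow> norm (R n) \<le> K * (norm (x n))\<^sup>2"
    and zero: "\<And>n. x n = 0 \<Longrightarrow> R n = 0"
  shows "\<exists>K\<ge>0. \<forall>n. norm (R n) \<le> K * (norm (x n))\<^sup>2"
proof -
  define b where "b n = (if x n = 0 then 1 else (norm (x n))\<^sup>2)" for n
  have b: "b n > 0" for n by (simp add: b_def)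
  have "eventually (\<lambda>n. norm (x n) < \<delta>) sequentially"
    using tendstoD[OF x \<delta>] by simp
  then have "eventually (\<lambda>n. norm (R n) \<le> \<bar>K\<bar> * b n) sequentially"
  proof eventually_elim
    case (elim n)
    show ?case
      using zero[of n] order_trans[OF K[OF elim] mult_right_mono[OF abs_ge_self]] by (auto simp: b_def)
  qed
  then obtain K' where K': "K' > 0" "\<And>n. norm (R n) \<le> K' * b n"
    using eventually_le_imp_all_le[of b "\<lambda>n. norm (R n)", OF b] by blast
  have "norm (R n) \<le> K' * (norm (x n))\<^sup>2" for n
    using K'(2)[of n] zero[of n] by (cases "x n = 0") (auto simp: b_def)
  then show ?thesis using K'(1) by (intro exI[of _ K']) simp
qed

theorem theorem2:
  fixes M :: "'a measure"
    and F :: "nat \<Rightarrow> 'a measure"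
    and \<Theta> :: "(real^'d) set"
    and h :: "real^'d \<Rightarrow> real^'d"
    and \<gamma> :: "nat \<Rightarrow> real"
    and e r r1 r2 :: "nat \<Rightarrow> 'a \<Rightarrow> real^'d"
    and \<theta> :: "nat \<Rightarrow> 'a \<Rightarrow> real^'d"
    and \<theta>s :: "real^'d"
    and Dh :: "real^'d^'d"
    and U :: "'a \<Rightarrow> real^'d^'d"
    and L :: "'a set"
    and t :: "real^'d"
  assumes prob: "prob_space M"
    and filt_sub: "\<And>n. sigma_finite_subalgebra M (F n)"
    and filt_mono: "\<And>n m. n \<le> m \<Longrightarrow> sets (F n) \<subseteq> sets (F m)"
    and h_meas: "h \<in> borel_measurable (restrict_space borel \<Theta>)"
    and \<gamma>_pos: "\<And>n. n \<ge> 1 \<Longrightarrow> \<gamma> n > 0"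
    and \<theta>0_meas: "\<theta> 0 \<in> borel_measurable M"
    and \<theta>_in: "\<And>n \<omega>. \<omega> \<in> space M \<Longrightarrow> \<theta> n \<omega> \<in> \<Theta>"
    and \<theta>_rec: "\<And>n \<omega>. \<omega> \<in> space M \<Longrightarrow>
        \<theta> (Suc n) \<omega> = \<theta> n \<omega> + \<gamma> (Suc n) *\<^sub>R h (\<theta> n \<omega>)
                      + \<gamma> (Suc n) *\<^sub>R e (Suc n) \<omega> + \<gamma> (Suc n) *\<^sub>R r (Suc n) \<omega>"
    and \<theta>s_in: "\<theta>s \<in> \<Theta>"
    and L_def: "L = {\<omega> \<in> space M. (\<lambda>q. \<theta> q \<omega>) \<longlonglongrightarrow> \<theta>s}"
    \<comment> \<open>(C1)\<close>
    and C1a: "\<theta>s \<in> interior \<Theta>" "h \<theta>s = 0"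
    and C1b: "\<exists>V. open V \<and> \<theta>s \<in> V \<and> V \<subseteq> \<Theta> \<and> C2_on h V"
    and Dh_def: "(h has_derivative (\<lambda>v. Dh *v v)) (at \<theta>s)"
    and C1c: "hurwitz Dh"
    \<comment> \<open>(C4a)\<close>
    and C4a: "\<not> summable (\<lambda>n. \<gamma> (Suc n))"
             "summable (\<lambda>n. (\<gamma> (Suc n))\<^sup>2)"
             "(\<lambda>k. ln (\<gamma> (Suc k) / \<gamma> (Suc (Suc k))) / \<gamma> (Suc (Suc k))) \<longlonglongrightarrow> 0"
    \<comment> \<open>(AV1)(a)\<close>
    and AV1a_meas: "\<And>n. n \<ge> 1 \<Longrightarrow> e n \<in> borel_measurable (F n)"
    and AV1a_int: "\<And>n i. n \<ge> 1 \<Longrightarrow> integrable M (\<lambda>\<omega>. e n \<omega> $ i)"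
    and AV1a_ce: "\<And>n i. n \<ge> 1 \<Longrightarrow>
        AE \<omega> in M. real_cond_exp M (F (n - 1)) (\<lambda>\<omega>. e n \<omega> $ i) \<omega> = 0"
    \<comment> \<open>(AV1)(b)\<close>
    and AV1b: "\<exists>(A :: nat \<Rightarrow> 'a set) (Amk :: nat \<Rightarrow> nat \<Rightarrow> 'a set).
        (\<forall>m. A m \<in> sets M)
        \<and> (\<lambda>m. measure M (A m \<inter> L)) \<longlonglongrightarrow> measure M L
        \<and> (\<forall>m k. Amk m k \<in> sets (F k))
        \<and> (\<forall>m. \<exists>C::real. \<forall>k\<ge>1.
              (\<integral>\<^sup>+ \<omega>. ennreal ((norm (e k \<omega>))\<^sup>2) * indicator (Amk m (k - 1)) \<omega> \<partial>M) \<le> ennreal C)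
        \<and> (\<forall>m. AE \<omega> in M. \<omega> \<in> L \<longrightarrow>
              (\<lambda>k. indicator (Amk m k) \<omega> :: real) \<longlonglongrightarrow> indicator (A m) \<omega>)
        \<comment> \<open>(AV2)(a),(b) for every m, with these sets A m\<close>
        \<and> (\<forall>m. O_wp1_L2 M (\<lambda>n \<omega>. ((\<gamma> (Suc n)) powr (-1/2) * indicator L \<omega> * indicator (A m) \<omega>)
                                   *\<^sub>R r1 (Suc n) \<omega>))
        \<and> (\<forall>m. O_wp1_L2 M (\<lambda>n \<omega>. (sqrt (\<gamma> (Suc n)) * indicator L \<omega> * indicator (A m) \<omega>)
                                   *\<^sub>R (\<Sum>k=1..Suc n. r2 k \<omega>)))"
    \<comment> \<open>(AV1)(c)\<close>
    and U_meas: "U \<in> borel_measurable M"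
    and U_pd: "AE \<omega> in M. \<omega> \<in> L \<longrightarrow>
        transpose (U \<omega>) = U \<omega> \<and> (\<forall>x. x \<noteq> 0 \<longrightarrow> x \<bullet> (U \<omega> *v x) > 0)"
    and AV1c: "\<And>s::real^'d.
        (\<lambda>n. \<integral>\<omega>. indicator L \<omega> *
               exp (\<i> * complex_of_real (s \<bullet> ((1 / sqrt (real (Suc n))) *\<^sub>R (\<Sum>k\<le>n. e (Suc k) \<omega>)))) \<partial>M)
        \<longlonglongrightarrow> complex_of_real (\<integral>\<omega>. indicator L \<omega> * exp (- (1/2) * (s \<bullet> (U \<omega> *v s))) \<partial>M)"
    \<comment> \<open>(AV2)\<close>
    and AV2_meas: "\<And>n. n \<ge> 1 \<Longrightarrow> r n \<in> borel_measurable (F n)"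
    and AV2_split: "\<And>n \<omega>. n \<ge> 1 \<Longrightarrow> \<omega> \<in> space M \<Longrightarrow> r n \<omega> = r1 n \<omega> + r2 n \<omega>"
    and AV2c: "\<And>\<epsilon>. \<epsilon> > 0 \<Longrightarrow>
        (\<lambda>n. measure M {\<omega> \<in> space M.
            norm ((1 / sqrt (real n) * indicator L \<omega>) *\<^sub>R (\<Sum>k\<le>n. r (Suc k) \<omega>)) > \<epsilon>})
        \<longlonglongrightarrow> 0"
    \<comment> \<open>(AV3)\<close>
    and AV3: "filterlim (\<lambda>n. real n * \<gamma> n) at_top sequentially"
             "(\<lambda>n. (1 / sqrt (real n)) *
                 (\<Sum>k=1..n. (\<gamma> k) powr (-1/2) * \<bar>1 - \<gamma> k / \<gamma> (Suc k)\<bar>)) \<longlonglongrightarrow> 0"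
             "(\<lambda>n. (1 / sqrt (real n)) * (\<Sum>k=1..n. \<gamma> k)) \<longlonglongrightarrow> 0"
  shows "(\<lambda>n. \<integral>\<omega>. indicator L \<omega> *
             exp (\<i> * complex_of_real (sqrt (real n) *
                 (t \<bullet> ((1 / real (Suc n)) *\<^sub>R (\<Sum>k\<le>n. \<theta> k \<omega>) - \<theta>s)))) \<partial>M)
         \<longlonglongrightarrow> complex_of_real (\<integral>\<omega>. indicator L \<omega> *
             exp (- (1/2) * (t \<bullet> ((matrix_inv Dh ** U \<omega> ** transpose (matrix_inv Dh)) *v t))) \<partial>M)"
proof -
  interpret prob_space M by (rule prob)
  define g where "g n = \<gamma> (Suc n)" for n
  define x where "x n \<omega> = \<theta> n \<omega> - \<theta>s" for n \<omega>
  define R where "R n \<omega> = h (\<theta> n \<omega>) - Dh *v x n \<omega>" for n \<omega>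
  have sub: "subalgebra M (F n)" for n
    using filt_sub[of n] by (rule sigma_finite_subalgebra.subalg)
  have sub': "subalgebra (F (Suc n)) (F n)" for n
    using sub[of n] sub[of "Suc n"] filt_mono[of n "Suc n"] by (auto simp: subalgebra_def)
  have e_F: "e (Suc n) \<in> borel_measurable (F (Suc n))" for n by (rule AV1a_meas) simp
  have e_M[measurable]: "e (Suc n) \<in> borel_measurable M" for n
    by (rule measurable_from_subalg[OF sub e_F])
  have r_M[measurable]: "r (Suc n) \<in> borel_measurable M" for n
    by (rule measurable_from_subalg[OF sub AV2_meas]) simp
  \<comment> \<open>\<open>h\<close> is measurable on \<open>\<Theta>\<close> only, so the
    composition goes through the restricted space.\<close>
  have h_\<theta>: "(\<lambda>\<omega>. h (\<theta> n \<omega>)) \<in> borel_measurable M" if "\<theta> n \<in> borel_measurable M" for n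
    by (rule measurable_compose[OF measurable_restrict_space2 h_meas]) (use that \<theta>_in in auto)
  have \<theta>_M[measurable]: "\<theta> n \<in> borel_measurable M" for n
  proof (induction n)
    case (Suc n)
    note [measurable] = h_\<theta>[OF Suc] Suc
    have "(\<lambda>\<omega>. \<theta> n \<omega> + \<gamma> (Suc n) *\<^sub>R h (\<theta> n \<omega>)
                      + \<gamma> (Suc n) *\<^sub>R e (Suc n) \<omega> + \<gamma> (Suc n) *\<^sub>R r (Suc n) \<omega>) \<in> borel_measurable M"
      by measurable
    then show ?case by (subst measurable_cong[OF \<theta>_rec])
  qed (rule \<theta>0_meas)
  note [measurable] = h_\<theta>[OF \<theta>_M]
  have x_M[measurable]: "x n \<in> borel_measurable M" for n unfolding x_def by measurable
  have Dh_M[measurable]: "(\<lambda>v. Dh *v v) \<in> borel_measurable borel"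
    by (intro borel_measurable_continuous_onI linear_continuous_on) simp
  have R_M[measurable]: "R n \<in> borel_measurable M" for n unfolding R_def by measurable
  have L_M[measurable]: "L \<in> sets M" unfolding L_def by measurable
  have L_space: "L \<subseteq> space M" by (auto simp: L_def)
  have x_rec: "x (Suc n) \<omega> = x n \<omega> + g n *\<^sub>R (Dh *v x n \<omega> + R n \<omega> + e (Suc n) \<omega> + r (Suc n) \<omega>)"
    if "\<omega> \<in> space M" for n \<omega>
    by (simp add: x_def R_def g_def \<theta>_rec[OF that] algebra_simps)
  have x_lim: "(\<lambda>n. x n \<omega>) \<longlonglongrightarrow> 0" if "\<omega> \<in> L" for \<omega>
    using that unfolding L_def x_def by (simp add: LIM_zero)
  obtain Q \<beta> s0 where con: "contracting Q ((*v) Dh) \<beta> s0"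
    using hurwitz_contracting[OF C1c] by blast
  have "step_sizes g"
    unfolding g_def using C4a \<gamma>_pos by (intro step_sizesI) auto
  then interpret sa_recursion Q "(*v) Dh" \<beta> s0 g
    by (intro sa_recursion.intro con)

  obtain V where V: "open V" "\<theta>s \<in> V" "C2_on h V" using C1b by blast
  obtain \<delta> K where \<delta>: "\<delta> > 0" and K: "\<And>y. norm (y - \<theta>s) < \<delta> \<Longrightarrow> norm (h y - h \<theta>s - Dh *v (y - \<theta>s)) \<le> K * (norm (y - \<theta>s))\<^sup>2"
    using C2_quadratic_remainder[OF V Dh_def] by metis
  have quad: "\<exists>K\<ge>0. \<forall>n. norm (R n \<omega>) \<le> K * (norm (x n \<omega>))\<^sup>2" if "\<omega> \<in> L" for \<omega>
  proof (rule all_quadratic_remainder[OF x_lim[OF that] \<delta>])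
    show "norm (R n \<omega>) \<le> K * (norm (x n \<omega>))\<^sup>2" if "norm (x n \<omega>) < \<delta>" for n
      using K[of "\<theta> n \<omega>"] that C1a(2) by (simp add: R_def x_def)
    show "R n \<omega> = 0" if "x n \<omega> = 0" for n
      using that C1a(2) by (simp add: R_def x_def)
  qed
  have R_small: "eventually (\<lambda>n. norm (R n \<omega>) \<le> \<eta> * norm (x n \<omega>)) sequentially" if "\<omega> \<in> L" "\<eta> > 0" for \<omega> \<eta>
  proof -
    obtain K where K: "K \<ge> 0" "\<And>n. norm (R n \<omega>) \<le> K * (norm (x n \<omega>))\<^sup>2" using quad[OF \<open>\<omega> \<in> L\<close>] by blast
    have "\<eta> / (K + 1) > 0" using K \<open>\<eta> > 0\<close> by simp
    from tendstoD[OF x_lim[OF \<open>\<omega> \<in> L\<close>] this] show ?thesis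
    proof (rule eventually_mono)
      fix n assume "dist (x n \<omega>) 0 < \<eta> / (K + 1)"
      then have "(K + 1) * norm (x n \<omega>) \<le> \<eta>" using K by (simp add: field_simps)
      then have "K * norm (x n \<omega>) \<le> \<eta>" using norm_ge_zero[of "x n \<omega>"] unfolding distrib_right mult_1 by linarith
      then have "K * norm (x n \<omega>) * norm (x n \<omega>) \<le> \<eta> * norm (x n \<omega>)" by (rule mult_right_mono) simp
      then show "norm (R n \<omega>) \<le> \<eta> * norm (x n \<omega>)" using K(2)[of n] by (simp add: power2_eq_square mult.assoc)
    qed
  qed
  \<comment> \<open>The vanishing conditional expectation of each coordinate is turned into
    orthogonality to test functions measurable for \<open>F n\<close>; basis vectors are the
    coordinate axes.\<close>
  have mart: "(\<integral>\<omega>. f \<omega> * (e (Suc n) \<omega> \<bullet> b) \<partial>M) = 0"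
    if b: "b \<in> Basis" and f[measurable]: "f \<in> borel_measurable (F n)" and int: "integrable M (\<lambda>\<omega>. f \<omega> * (e (Suc n) \<omega> \<bullet> b))" for n f b
  proof -
    obtain i where i: "b = axis i 1" using b by (auto simp: Basis_vec_def)
    have "(\<lambda>\<omega>. e (Suc n) \<omega> \<bullet> axis i 1) \<in> borel_measurable M" by measurable
    then have ei: "(\<lambda>\<omega>. e (Suc n) \<omega> $ i) \<in> borel_measurable M" by (simp add: inner_axis)
    have int': "integrable M (\<lambda>\<omega>. f \<omega> * e (Suc n) \<omega> $ i)" using int by (simp add: i inner_axis)
    have "(\<integral>\<omega>. f \<omega> * (e (Suc n) \<omega> \<bullet> b) \<partial>M) = (\<integral>\<omega>. f \<omega> * real_cond_exp M (F n) (\<lambda>\<omega>. e (Suc n) \<omega> $ i) \<omega> \<partial>M)"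
      using sigma_finite_subalgebra.real_cond_exp_intg(2)[OF filt_sub int' f ei] by (simp add: i inner_axis)
    also have "\<dots> = 0"
      by (rule integral_eq_zero_AE) (use AV1a_ce[of "Suc n" i] in auto)
    finally show ?thesis .
  qed
  obtain A :: "nat \<Rightarrow> 'a set" and Amk where all: "\<forall>m. A m \<in> sets M"
      "(\<lambda>m. measure M (A m \<inter> L)) \<longlonglongrightarrow> measure M L"
      "\<forall>m k. Amk m k \<in> sets (F k)"
      "\<forall>m. \<exists>C. \<forall>k\<ge>1. (\<integral>\<^sup>+ \<omega>. ennreal ((norm (e k \<omega>))\<^sup>2) * indicator (Amk m (k - 1)) \<omega> \<partial>M) \<le> ennreal C"
      "\<forall>m. AE \<omega> in M. \<omega> \<in> L \<longrightarrow> (\<lambda>k. indicator (Amk m k) \<omega> :: real) \<longlonglongrightarrow> indicator (A m) \<omega>"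
      "\<forall>m. O_wp1_L2 M (\<lambda>n \<omega>. ((\<gamma> (Suc n)) powr (-1/2) * indicator L \<omega> * indicator (A m) \<omega>) *\<^sub>R r1 (Suc n) \<omega>)"
      "\<forall>m. O_wp1_L2 M (\<lambda>n \<omega>. (sqrt (\<gamma> (Suc n)) * indicator L \<omega> * indicator (A m) \<omega>) *\<^sub>R (\<Sum>k=1..Suc n. r2 k \<omega>))"
    using AV1b by (elim exE conjE) (rule that; assumption)
  note A = all(1)[THEN spec] all(2)
  note Amk = all(3)[THEN spec, THEN spec] all(4,5)[THEN spec]
  note r1 = all(6)[THEN spec] and r2 = all(7)[THEN spec]
  have rate: "\<exists>D. L2_bounded M D \<and> (\<forall>n \<omega>. D n \<omega> \<ge> 1) \<and>
      (AE \<omega> in M. \<omega> \<in> L \<inter> A m \<longrightarrow> (\<exists>C. \<forall>n. norm (x n \<omega>) \<le> C * (sqrt (g n) * D n \<omega>)))" for m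
  proof -
    obtain C where C: "\<And>k. k \<ge> 1 \<Longrightarrow> (\<integral>\<^sup>+ \<omega>. ennreal ((norm (e k \<omega>))\<^sup>2) * indicator (Amk m (k - 1)) \<omega> \<partial>M) \<le> ennreal C"
      using Amk(2)[of m] by blast
    have C': "(\<integral>\<^sup>+ \<omega>. ennreal ((norm (e (Suc k) \<omega>))\<^sup>2) * indicator (Amk m k) \<omega> \<partial>M) \<le> ennreal C" for k
      using C[of "Suc k"] by simp
    have r1': "O_wp1_L2 M (\<lambda>n \<omega>. ((g n) powr (-1/2) * indicator L \<omega> * indicator (A m) \<omega>) *\<^sub>R r1 (Suc n) \<omega>)"
      using r1[of m] by (simp only: g_def)
    have "(\<Sum>k=1..Suc n. r2 k \<omega>) = (\<Sum>k\<le>n. r2 (Suc k) \<omega>)" for n \<omega>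
      by (simp only: One_nat_def sum.shift_bounds_cl_Suc_ivl atMost_atLeast0)
    then have r2': "O_wp1_L2 M (\<lambda>n \<omega>. (sqrt (g n) * indicator L \<omega> * indicator (A m) \<omega>) *\<^sub>R (\<Sum>k\<le>n. r2 (Suc k) \<omega>))"
      using r2[of m] by (simp only: g_def)
    have split: "r (Suc n) \<omega> = r1 (Suc n) \<omega> + r2 (Suc n) \<omega>" if "\<omega> \<in> L" for n \<omega>
      using AV2_split[of "Suc n" \<omega>] that L_space by auto
    have rec: "x (Suc n) \<omega> = x n \<omega> + g n *\<^sub>R (Dh *v x n \<omega> + R n \<omega> + e (Suc n) \<omega> + r (Suc n) \<omega>)"
      if "\<omega> \<in> L" for n \<omega> using x_rec that L_space by blast
    obtain D where "L2_bounded M D" "\<And>n \<omega>. D n \<omega> \<ge> 1"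
      "AE \<omega> in M. \<omega> \<in> L \<inter> A m \<longrightarrow> (\<exists>C. \<forall>n. norm (x n \<omega>) \<le> C * (sqrt (g n) * D n \<omega>))"
      by (rule localized_rate[where M = M and F = F and x = x and R = R and e = "\<lambda>n. e (Suc n)" and r = "\<lambda>n. r (Suc n)"
          and ?r1.0 = "\<lambda>n. r1 (Suc n)" and ?r2.0 = "\<lambda>n. r2 (Suc n)" and L = L and A = "A m" and Ak = "Amk m",
          OF prob sub sub' rec split L_space R_small e_F mart Amk(1) C' Amk(3) r1' r2'])
        (assumption+, rule that)
    then show ?thesis by (intro exI[of _ D] conjI allI)
  qed
  have weight: "average_weight (\<lambda>_. 1) \<longlonglongrightarrow> 0"
  proof (rule average_weight_tendsto)
    show "filterlim (\<lambda>n. real (Suc n) * g n) at_top sequentially"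
      unfolding g_def using AV3(1) filterlim_sequentially_Suc[of "\<lambda>n. real n * \<gamma> n"] by simp
    show "(\<lambda>n. (1 / sqrt (real n)) * (\<Sum>k<n. g k powr (-1/2) * \<bar>1 - g k / g (Suc k)\<bar>)) \<longlonglongrightarrow> 0"
      using AV3(2) by (simp only: g_def One_nat_def sum.atLeast1_atMost_eq)
    show "(\<lambda>n. (1 / sqrt (real n)) * (\<Sum>k<n. g k)) \<longlonglongrightarrow> 0"
      using AV3(3) by (simp only: g_def One_nat_def sum.atLeast1_atMost_eq)
  qed

  \<comment> \<open>\<open>s\<close> normalizes the noise sum, whereas \<open>d\<close> is the
    factor that \<open>sqrt n\<close> and the average over \<open>n + 1\<close> terms produce. Their
    mismatch is the error \<open>Y3\<close>.\<close>
  define s where "s n = 1 / sqrt (real (Suc n))" for n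
  define d where "d n = sqrt (real n) / real (Suc n)" for n
  define I where "I n \<omega> = (\<Sum>k\<le>n. (1 / g k) *\<^sub>R (x (Suc k) \<omega> - x k \<omega>)) - (\<Sum>k\<le>n. R k \<omega>)" for n \<omega>
  define Y1 where "Y1 n \<omega> = norm (s n *\<^sub>R I n \<omega>)" for n \<omega>
  define Y2 where "Y2 n \<omega> = norm (s n *\<^sub>R (\<Sum>k\<le>n. r (Suc k) \<omega>))" for n \<omega>
  define Y3 where "Y3 n \<omega> = norm ((d n - s n) *\<^sub>R (\<Sum>k\<le>n. x k \<omega>))" for n \<omega>
  have YM: "Y1 n \<in> borel_measurable M" "Y2 n \<in> borel_measurable M" "Y3 n \<in> borel_measurable M" for n
    unfolding Y1_def I_def Y2_def Y3_def by measurable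
  have Y0: "0 \<le> Y1 n \<omega>" "0 \<le> Y2 n \<omega>" "0 \<le> Y3 n \<omega>" for n \<omega>
    by (simp_all add: Y1_def Y2_def Y3_def)
  have Y1: "(\<lambda>n. \<integral>\<omega>. indicator L \<omega> * min 1 (Y1 n \<omega>) \<partial>M) \<longlonglongrightarrow> 0"
    unfolding Y1_def s_def I_def
    by (rule averaged_increments_tendsto[OF prob L_M A x_M R_M rate quad weight])
  have Y2: "(\<lambda>n. \<integral>\<omega>. indicator L \<omega> * min 1 (Y2 n \<omega>) \<partial>M) \<longlonglongrightarrow> 0"
  proof (rule min_integral_tendsto_of_prob[OF L_M YM(2) Y0(2)])
    fix \<epsilon> :: real assume \<epsilon>: "\<epsilon> > 0"
    let ?B = "\<lambda>n. {\<omega> \<in> space M. norm ((1 / sqrt (real n) * indicator L \<omega>) *\<^sub>R (\<Sum>k\<le>n. r (Suc k) \<omega>)) > \<epsilon>}"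
    show "(\<lambda>n. prob {\<omega> \<in> space M. \<omega> \<in> L \<and> Y2 n \<omega> > \<epsilon>}) \<longlonglongrightarrow> 0"
    proof (rule tendsto_sandwich[OF _ _ tendsto_const AV2c[OF \<epsilon>]])
      show "eventually (\<lambda>n. prob {\<omega> \<in> space M. \<omega> \<in> L \<and> Y2 n \<omega> > \<epsilon>} \<le> prob (?B n)) sequentially"
        \<comment> \<open>At \<open>n = 0\<close> the factor \<open>1 / sqrt (real n)\<close> is
          \<open>0\<close> by convention; for positive \<open>n\<close> it dominates
          \<open>s n\<close>.\<close>
        using eventually_gt_at_top[of 0]
      proof eventually_elim
        case (elim n)
        show ?case
        proof (rule finite_measure_mono)
          have "Y2 n \<omega> \<le> norm ((1 / sqrt (real n)) *\<^sub>R (\<Sum>k\<le>n. r (Suc k) \<omega>))" for \<omega>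
            unfolding Y2_def norm_scaleR using elim by (intro mult_right_mono) (auto simp: s_def intro!: frac_le)
          then show "{\<omega> \<in> space M. \<omega> \<in> L \<and> Y2 n \<omega> > \<epsilon>} \<subseteq> ?B n"
            by (fastforce intro: less_le_trans)
        qed measurable
      qed
    qed simp
  qed
  have Y3: "(\<lambda>n. \<integral>\<omega>. indicator L \<omega> * min 1 (Y3 n \<omega>) \<partial>M) \<longlonglongrightarrow> 0"
  proof (rule min_integral_tendsto_of_pointwise[OF L_M YM(3) Y0(3)])
    fix \<omega> assume "\<omega> \<in> L"
    then have "Bseq (\<lambda>n. x n \<omega>)" using x_lim convergentI convergent_imp_Bseq by blast
    then obtain B where B: "\<And>n. norm (x n \<omega>) \<le> B" by (auto simp: Bseq_def)
    \<comment> \<open>On \<open>L\<close> the errors \<open>x\<close> are bounded, so their sum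
      grows at most linearly, and \<open>real (Suc n)\<close> times the mismatch of \<open>d\<close>
      and \<open>s\<close> is only a difference of consecutive square roots.\<close>
    have "norm (Y3 n \<omega>) \<le> (sqrt (real (Suc n)) - sqrt (real n)) * B" for n
    proof -
      have "(d n - s n) * real (Suc n) = sqrt (real n) - sqrt (real (Suc n))"
        using real_div_sqrt[of "real (Suc n)"] by (simp add: d_def s_def left_diff_distrib del: of_nat_Suc)
      then have "\<bar>d n - s n\<bar> * real (Suc n) = sqrt (real (Suc n)) - sqrt (real n)"
        using abs_mult[of "d n - s n" "real (Suc n)"] by simp
      moreover have "norm (\<Sum>k\<le>n. x k \<omega>) \<le> real (Suc n) * B"
        using sum_norm_bound[of "{..n}" "\<lambda>k. x k \<omega>" B] B by simp
      then have "norm (Y3 n \<omega>) \<le> \<bar>d n - s n\<bar> * (real (Suc n) * B)"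
        unfolding Y3_def by (simp add: mult_left_mono)
      ultimately show ?thesis by (metis mult.assoc)
    qed
    moreover have "(\<lambda>n. sqrt (real (Suc n)) - sqrt (real n)) \<longlonglongrightarrow> 0" by real_asymp
    then have "(\<lambda>n. (sqrt (real (Suc n)) - sqrt (real n)) * B) \<longlonglongrightarrow> 0" by (rule tendsto_mult_left_zero)
    ultimately show "(\<lambda>n. Y3 n \<omega>) \<longlonglongrightarrow> 0"
      by (intro Lim_null_comparison[of "\<lambda>n. Y3 n \<omega>"]) (auto intro: always_eventually)
  qed

  define Ai where "Ai = matrix_inv Dh"
  \<comment> \<open>Transposing moves the inverse from the random sums to the fixed vector
    \<open>t\<close>, so the whole argument runs with the scalar products against
    \<open>u\<close>.\<close>
  define u where "u = transpose Ai *v t"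
  have "inj ((*v) Dh)"
    using T_eq_0_imp linear_injective_0[OF matrix_vector_mul_linear[of Dh]] by blast
  then have "invertible Dh"
    using matrix_left_invertible_injective invertible_left_inverse by blast
  then have "Ai ** Dh = mat 1"
    unfolding Ai_def matrix_inv_def invertible_def by (rule someI2_ex) simp
  then have Ai: "Ai *v (Dh *v v) = v" for v
    by (simp add: matrix_vector_mul_assoc)
  have u: "t \<bullet> (Ai *v v) = u \<bullet> v" for v
    by (simp add: u_def transpose_matrix_vector dot_lmul_matrix)
  define E where "E n \<omega> = (\<Sum>k\<le>n. e (Suc k) \<omega>)" for n \<omega>
  have tX: "t \<bullet> (\<Sum>k\<le>n. x k \<omega>) = u \<bullet> (I n \<omega> - E n \<omega> - (\<Sum>k\<le>n. r (Suc k) \<omega>))" if "\<omega> \<in> space M" for n \<omega>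
  proof -
    have "(1 / g k) *\<^sub>R (x (Suc k) \<omega> - x k \<omega>) = Dh *v x k \<omega> + R k \<omega> + e (Suc k) \<omega> + r (Suc k) \<omega>" for k
      using x_rec[OF that, of k] g_pos[of k] by simp
    then have "I n \<omega> - E n \<omega> - (\<Sum>k\<le>n. r (Suc k) \<omega>) = Dh *v (\<Sum>k\<le>n. x k \<omega>)"
      by (simp add: I_def E_def sum.distrib linear_sum[OF matrix_vector_mul_linear])
    then show ?thesis using u[of "Dh *v (\<Sum>k\<le>n. x k \<omega>)"] by (simp add: Ai)
  qed
  define X where "X n \<omega> = sqrt (real n) * (t \<bullet> ((1 / real (Suc n)) *\<^sub>R (\<Sum>k\<le>n. \<theta> k \<omega>) - \<theta>s))" for n \<omega>
  \<comment> \<open>The noise sum enters the decomposition with a negative sign, so its limit is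
    taken at \<open>- u\<close>; the quadratic form in the limit does not see the sign.\<close>
  define X' where "X' n \<omega> = (- u) \<bullet> (s n *\<^sub>R (\<Sum>k\<le>n. e (Suc k) \<omega>))" for n \<omega>
  have le: "\<bar>X n \<omega> - X' n \<omega>\<bar> \<le> (norm t + norm u) * (Y1 n \<omega> + Y2 n \<omega> + Y3 n \<omega>)" if "\<omega> \<in> L" for n \<omega>
  proof -
    have "(\<Sum>k\<le>n. x k \<omega>) = (\<Sum>k\<le>n. \<theta> k \<omega>) - real (Suc n) *\<^sub>R \<theta>s"
      by (simp add: x_def sum_subtractf sum_constant_scaleR del: sum_constant)
    then have "(1 / real (Suc n)) *\<^sub>R (\<Sum>k\<le>n. \<theta> k \<omega>) - \<theta>s = (1 / real (Suc n)) *\<^sub>R (\<Sum>k\<le>n. x k \<omega>)"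
      by (simp add: scaleR_right_diff_distrib)
    then have "X n \<omega> = d n * (t \<bullet> (\<Sum>k\<le>n. x k \<omega>))"
      by (simp add: X_def d_def)
    also have "\<dots> = t \<bullet> ((d n - s n) *\<^sub>R (\<Sum>k\<le>n. x k \<omega>)) + s n * (t \<bullet> (\<Sum>k\<le>n. x k \<omega>))"
      by (simp add: algebra_simps)
    also have "s n * (t \<bullet> (\<Sum>k\<le>n. x k \<omega>)) = u \<bullet> (s n *\<^sub>R I n \<omega>) + X' n \<omega> - u \<bullet> (s n *\<^sub>R (\<Sum>k\<le>n. r (Suc k) \<omega>))"
      unfolding tX[OF subsetD[OF L_space that]]
      by (simp add: X'_def E_def inner_diff_right right_diff_distrib)
    finally have "X n \<omega> - X' n \<omega> = t \<bullet> ((d n - s n) *\<^sub>R (\<Sum>k\<le>n. x k \<omega>)) + u \<bullet> (s n *\<^sub>R I n \<omega>)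
        - u \<bullet> (s n *\<^sub>R (\<Sum>k\<le>n. r (Suc k) \<omega>))" by simp
    then have "\<bar>X n \<omega> - X' n \<omega>\<bar> \<le> norm t * Y3 n \<omega> + norm u * Y1 n \<omega> + norm u * Y2 n \<omega>"
      using Cauchy_Schwarz_ineq2[of t "(d n - s n) *\<^sub>R (\<Sum>k\<le>n. x k \<omega>)"] Cauchy_Schwarz_ineq2[of u "s n *\<^sub>R I n \<omega>"]
        Cauchy_Schwarz_ineq2[of u "s n *\<^sub>R (\<Sum>k\<le>n. r (Suc k) \<omega>)"]
      unfolding Y1_def Y2_def Y3_def by linarith
    also have "\<dots> \<le> (norm t + norm u) * Y3 n \<omega> + (norm t + norm u) * Y1 n \<omega> + (norm t + norm u) * Y2 n \<omega>"
      unfolding Y1_def Y2_def Y3_def by (intro add_mono mult_right_mono) auto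
    finally show ?thesis by (simp add: algebra_simps)
  qed
  have "(\<lambda>n. \<integral>\<omega>. indicator L \<omega> * exp (\<i> * complex_of_real (X n \<omega>)) \<partial>M)
      \<longlonglongrightarrow> complex_of_real (\<integral>\<omega>. indicator L \<omega> * exp (- (1/2) * ((- u) \<bullet> (U \<omega> *v (- u)))) \<partial>M)"
  proof (rule char_fun_diff_tendsto[OF L_M _ _ YM Y0 le Y1 Y2 Y3])
    show "(\<lambda>n. \<integral>\<omega>. indicator L \<omega> * exp (\<i> * complex_of_real (X' n \<omega>)) \<partial>M)
      \<longlonglongrightarrow> complex_of_real (\<integral>\<omega>. indicator L \<omega> * exp (- (1/2) * ((- u) \<bullet> (U \<omega> *v (- u)))) \<partial>M)"
      unfolding X'_def s_def by (rule AV1c)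
    show "X n \<in> borel_measurable M" "X' n \<in> borel_measurable M" for n
      unfolding X_def X'_def by measurable
  qed
  moreover have "(- u) \<bullet> (U \<omega> *v (- u)) = t \<bullet> ((matrix_inv Dh ** U \<omega> ** transpose (matrix_inv Dh)) *v t)" for \<omega>
  proof -
    have "(- u) \<bullet> (U \<omega> *v (- u)) = u \<bullet> (U \<omega> *v u)"
      by (simp add: linear_neg[OF matrix_vector_mul_linear])
    also have "\<dots> = t \<bullet> (Ai *v (U \<omega> *v u))" by (rule u[symmetric])
    also have "\<dots> = t \<bullet> ((Ai ** U \<omega> ** transpose Ai) *v t)"
      by (simp add: u_def matrix_vector_mul_assoc matrix_mul_assoc del: transpose_matrix_vector)
    finally show ?thesis by (simp add: Ai_def)
  qed
  ultimately show ?thesis unfolding X_def by (simp only:)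
qed

end
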